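(* For every $\varepsilon>0$ there is a constant $C_\varepsilon>0$ such that for all positive integers $q$, \[D(\mu_q)\le C_\varepsilon\, q^{-\frac13+\varepsilon}.\]
   Context: $\mathbb{T}^2=(\mathbb{R}/\mathbb{Z})^2$ carries the flat metric induced from $\mathbb{R}^2$ and Lebesgue (Haar) probability measure $\mathrm{vol}$. For $y\in\mathbb{T}^2$ and $0<R<\frac12$, $B_R(y)$ is the (injective) geodesic ball of radius $R$ centred at $y$, and $\mathrm{vol}(B_R)=\pi R^2$ its volume. For a positive integer $q$, $\varphi(q)=\#(\mathbb{Z}/q\mathbb{Z})^\times$, and for $d\in(\mathbb{Z}/q\mathbb{Z})^\times$, $\overline{d}$ denotes its multiplicative inverse modulo $q$. The probability measure $\mu_q$ on $\mathbb{T}^2$ is defined by $\mu_q(B)=\frac{1}{\varphi(q)}\#\{d\in(\mathbb{Z}/q\mathbb{Z})^\times:(d/q,\overline{d}/q)\in B\}$ for Borel $B\subset\mathbb{T}^2$. The ball discrepancy is $D(\mu_q)=\sup_{y\in\mathbb{T}^2,\,0<R<\frac12}|\mu_q(B_R(y))-\mathrm{vol}(B_R)|$. *)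

theory Defs
  imports "HOL-Analysis.Analysis" "HOL-Number_Theory.Number_Theory"
begin

section \<open>The circle and the flat torus\<close>

quotient_type circle = real / "\<lambda>x y :: real. x - y \<in> \<int>"
  morphisms rep_circle circle_of
proof (rule equivpI)
  show "reflp (\<lambda>x y :: real. x - y \<in> \<int>)"
    by (simp add: reflp_def)
  show "symp (\<lambda>x y :: real. x - y \<in> \<int>)"
    unfolding symp_def by (metis Ints_minus minus_diff_eq)
  show "transp (\<lambda>x y :: real. x - y \<in> \<int>)"
    unfolding transp_def by (metis Ints_add add_diff_eq diff_add_cancel)
qed

lemma circle_of_eq_iff: "circle_of x = circle_of y \<longleftrightarrow> x - y \<in> \<int>"
  by (rule circle.abs_eq_iff)

lemma INF_abs_diff_int: "(INF n::int. \<bar>t - of_int n\<bar>) = \<bar>t - of_int (round t)\<bar>" for t :: real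
proof (rule antisym)
  show "(INF n::int. \<bar>t - of_int n\<bar>) \<le> \<bar>t - of_int (round t)\<bar>"
    by (rule cINF_lower) (auto intro!: bdd_belowI[of _ 0])
  show "\<bar>t - of_int (round t)\<bar> \<le> (INF n::int. \<bar>t - of_int n\<bar>)"
    by (rule cINF_greatest) (auto simp: round_diff_minimal)
qed

instantiation circle :: metric_space
begin

lift_definition dist_circle :: "circle \<Rightarrow> circle \<Rightarrow> real"
  is "\<lambda>x y :: real. INF n::int. \<bar>x - y - of_int n\<bar>"
proof -
  fix x x' y y' :: real
  assume "x - x' \<in> \<int>" "y - y' \<in> \<int>"
  then obtain k l where k: "x - x' = of_int k" and l: "y - y' = of_int l"
    by (auto elim!: Ints_cases)
  have eq: "\<bar>x - y - of_int n\<bar> = \<bar>x' - y' - of_int (n - k + l)\<bar>" for n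
    using k l by (simp add: algebra_simps)
  have "surj (\<lambda>n. n - k + l)"
    by (rule surjI[of _ "\<lambda>n. n + k - l"]) simp
  then have "range (\<lambda>n. \<bar>x - y - of_int n\<bar>) = range (\<lambda>n. \<bar>x' - y' - of_int n\<bar>)"
    unfolding eq by (metis image_image)
  then show "(INF n::int. \<bar>x - y - of_int n\<bar>) = (INF n::int. \<bar>x' - y' - of_int n\<bar>)"
    by simp
qed

definition uniformity_circle :: "(circle \<times> circle) filter"
  where "uniformity_circle = (INF e\<in>{0 <..}. principal {(x, y). dist x y < e})"

definition open_circle :: "circle set \<Rightarrow> bool"
  where "open_circle U \<longleftrightarrow> (\<forall>x\<in>U. eventually (\<lambda>(x', y). x' = x \<longrightarrow> y \<in> U) uniformity)"

instance
proof
  fix x y z :: circle and U :: "circle set"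
  show "uniformity = (INF e\<in>{0 <..}. principal {(x, y :: circle). dist x y < e})"
    by (rule uniformity_circle_def)
  show "open U \<longleftrightarrow> (\<forall>x\<in>U. eventually (\<lambda>(x', y). x' = x \<longrightarrow> y \<in> U) uniformity)"
    by (rule open_circle_def)
  show "dist x y = 0 \<longleftrightarrow> x = y"
  proof (transfer, unfold INF_abs_diff_int)
    fix x y :: real
    show "\<bar>x - y - of_int (round (x - y))\<bar> = 0 \<longleftrightarrow> x - y \<in> \<int>"
      by (auto elim!: Ints_cases) (metis Ints_of_int)
  qed
  show "dist x y \<le> dist x z + dist y z"
  proof (transfer, unfold INF_abs_diff_int)
    fix x y z :: real
    have "\<bar>x - y - of_int (round (x - y))\<bar>
        \<le> \<bar>x - y - of_int (round (x - z) - round (y - z))\<bar>"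
      by (rule round_diff_minimal)
    also have "\<dots> \<le> \<bar>x - z - of_int (round (x - z))\<bar> + \<bar>y - z - of_int (round (y - z))\<bar>"
      by simp
    finally show "\<bar>x - y - of_int (round (x - y))\<bar>
        \<le> \<bar>x - z - of_int (round (x - z))\<bar> + \<bar>y - z - of_int (round (y - z))\<bar>" .
  qed
qed

end

lemma dist_circle_of: "dist (circle_of x) (circle_of y) = \<bar>x - y - of_int (round (x - y))\<bar>"
  by (simp add: dist_circle.abs_eq INF_abs_diff_int)

text \<open>
  The library's metric on a product type is the Euclidean combination of the metrics of the
  factors, so on this type it is the flat metric of \<open>\<real>\<^sup>2 / \<int>\<^sup>2\<close>; see \<open>dist_torus_of\<close> below.
\<close>

type_synonym torus = "circle \<times> circle"

definition torus_of :: "real \<times> real \<Rightarrow> torus"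
  where "torus_of p = (circle_of (fst p), circle_of (snd p))"

lemma dist_torus_of:
  "dist (torus_of p) (torus_of p') = (INF (m, n) \<in> (UNIV :: (int \<times> int) set).
     dist p (p' + (of_int m, of_int n)))"
proof -
  let ?f = "\<lambda>(m :: int, n :: int). dist p (p' + (of_int m, of_int n))"
  obtain a b c d where p: "p = (a, b)" "p' = (c, d)"
    by (metis surj_pair)
  have f: "?f (m, n) = sqrt (\<bar>a - c - of_int m\<bar>\<^sup>2 + \<bar>b - d - of_int n\<bar>\<^sup>2)" for m n
    by (simp add: p dist_prod_def dist_real_def algebra_simps)
  have d: "dist (torus_of p) (torus_of p') = ?f (round (a - c), round (b - d))"
    unfolding f by (simp add: p torus_of_def dist_Pair_Pair dist_circle_of)
  have le: "?f (round (a - c), round (b - d)) \<le> ?f (m, n)" for m n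
    unfolding f by (intro real_sqrt_le_mono add_mono power_mono round_diff_minimal) auto
  have "(INF k. ?f k) = ?f (round (a - c), round (b - d))"
  proof (rule antisym)
    show "(INF k. ?f k) \<le> ?f (round (a - c), round (b - d))"
      by (rule cINF_lower) (auto intro!: bdd_belowI[of _ 0])
    show "?f (round (a - c), round (b - d)) \<le> (INF k. ?f k)"
      by (rule cINF_greatest) (use le in auto)
  qed
  with d show ?thesis
    by simp
qed

lemma continuous_on_torus_of: "continuous_on A torus_of"
proof (rule continuous_on_subset[OF _ subset_UNIV], unfold continuous_on_iff, intro ballI allI impI)
  fix p :: "real \<times> real" and e :: real
  assume e: "e > 0"
  have "dist (torus_of p') (torus_of p) \<le> dist p' p" for p'
  proof -
    have "dist (torus_of p') (torus_of p) \<le>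
        (\<lambda>(m :: int, n :: int). dist p' (p + (of_int m, of_int n))) (0, 0)"
      unfolding dist_torus_of by (rule cINF_lower) (auto intro!: bdd_belowI[of _ 0])
    then show ?thesis
      by (cases p) (simp add: zero_prod_def)
  qed
  then show "\<exists>d>0. \<forall>p'\<in>UNIV. dist p' p < d \<longrightarrow> dist (torus_of p') (torus_of p) < e"
    using e by (meson order_le_less_trans)
qed

lemma torus_of_measurable [measurable]: "torus_of \<in> borel_measurable borel"
  by (intro borel_measurable_continuous_onI continuous_on_torus_of)

definition vol :: "torus measure"
  where "vol = distr (restrict_space lborel ({0..<1} \<times> {0..<1})) borel torus_of"

lemma sets_vol [simp]: "sets vol = sets borel"
  by (simp add: vol_def)

lemma emeasure_vol_UNIV: "emeasure vol UNIV = 1"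
proof -
  let ?S = "{0..<1} \<times> {0..<1} :: (real \<times> real) set"
  have S: "?S \<in> sets borel"
    by (intro borel_Times) auto
  have "emeasure vol UNIV = emeasure (restrict_space lborel ?S) ?S"
    unfolding vol_def
    by (subst emeasure_distr)
       (auto intro: measurable_restrict_space1 simp: space_restrict_space)
  also have "\<dots> = emeasure lborel ?S"
    using S by (subst emeasure_restrict_space) auto
  also have "\<dots> = emeasure (lborel :: real measure) {0..<1} * emeasure (lborel :: real measure) {0..<1}"
    unfolding lborel_prod[symmetric] by (subst lborel.emeasure_pair_measure_Times) auto
  finally show ?thesis
    by simp
qed


section \<open>Modular inverse points\<close>

text \<open>
  The group \<open>(\<int>/q\<int>)\<^sup>\<times>\<close> is represented by its residues in \<open>{1..q}\<close>. The modular inverse is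
  taken in the type of integers; only its class modulo \<open>q\<close> matters for the point in the torus.
\<close>

definition inverse_point :: "nat \<Rightarrow> nat \<Rightarrow> torus"
  where "inverse_point q d =
    torus_of (real d / real q, of_int (modular_inverse (int q) (int d)) / real q)"

definition mu :: "nat \<Rightarrow> torus measure"
  where "mu q = distr (uniform_count_measure (totatives q)) borel (inverse_point q)"

lemma sets_mu [simp]: "sets (mu q) = sets borel"
  by (simp add: mu_def)

lemma measure_mu:
  assumes "B \<in> sets borel"
  shows "measure (mu q) B = real (card {d \<in> totatives q. inverse_point q d \<in> B}) / real (totient q)"
proof -
  have "measure (mu q) B =
      measure (uniform_count_measure (totatives q)) {d \<in> totatives q. inverse_point q d \<in> B}"
    unfolding mu_def using assms
    by (subst measure_distr)
       (auto simp: measurable_def space_uniform_count_measure sets_uniform_count_measure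
             intro!: arg_cong2[where f = measure])
  then show ?thesis
    by (simp add: measure_uniform_count_measure totient_def)
qed

definition ball_discrepancy :: "torus measure \<Rightarrow> real"
  where "ball_discrepancy M =
    (SUP (y, R) \<in> UNIV \<times> {0<..<1/2}. \<bar>measure M (ball y R) - measure vol (ball y R)\<bar>)"

lemma bdd_above_ball_discrepancy:
  assumes "finite_measure M"
  shows "bdd_above ((\<lambda>(y, R). \<bar>measure M (ball y R) - measure vol (ball y R)\<bar>) ` (UNIV \<times> {0<..<1/2}))"
proof -
  have vol: "finite_measure vol"
    by (rule finite_measureI) (use emeasure_vol_UNIV sets_eq_imp_space_eq[OF sets_vol] in auto)
  have "\<bar>measure M (ball y R) - measure vol (ball y R)\<bar>
      \<le> measure M (space M) + measure vol (space vol)" for y and R :: real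
    using finite_measure.bounded_measure[OF assms, of "ball y R"]
      finite_measure.bounded_measure[OF vol, of "ball y R"]
      measure_nonneg[of M "ball y R"] measure_nonneg[of vol "ball y R"] by linarith
  then show ?thesis
    by (intro bdd_aboveI[of _ "measure M (space M) + measure vol (space vol)"]) auto
qed

end

(* Smoothing a disc by trigonometric polynomials of degree about q^(1/3) and applying Weyl's
   criterion reduces the theorem to Kloosterman sums K(k, l; q), weighted by the Fourier
   coefficients of a disc, which decay like max(|k|, |l|)^(-3/2). What is needed is Weil's bound
   |K(k, l; q)| <= 6^omega(q) sqrt(q gcd(k, l, q)). By the Chinese remainder theorem it suffices to
   treat prime powers. For p^n with n >= 2 the sum localises at the solutions of
   k u = l v (mod p^(n/2)), a p-adic stationary phase. For a prime, the number of points of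
   x + b/x = y^p - y over F_(p^n), bounded by Stepanov's method for large odd n, controls the
   Kloosterman sums over all these extensions, and the quadratic L-function relating them turns
   any bound O(p^(n/2)) into |K| <= 2 sqrt(p). *)

theory Submission
  imports "HOL-Algebra.Algebraic_Closure_Type" "Berlekamp_Zassenhaus.Finite_Field" Defs
begin

section \<open>Stepanov's method for the curve \<open>x + b / x = y\<^sup>p - y\<close>\<close>

text \<open>The exponent 1/3 is a balance: degree M resolves a disc up to an error of about 1/M,
  while the weighted Kloosterman sums add about sqrt(M / q), and both are q^(-1/3) for M = q^(1/3).
  The loss q^\<epsilon> comes from the number omega of prime factors of q, through 6^omega and
  through totient(q) \<ge> q / 2^omega, and from a smoothing radius q^\<epsilon> times wider than
  1/M, which makes the tails of the kernel harmless. Discs get no explicit majorants: a nonnegative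
  kernel applied to slightly larger and smaller discs takes their place. Stepanov's method bounds
  point counts only from above, but with main term exactly p^n for p times each trace fibre. As the
  fibres partition a set of known size, this controls the sums over a character. The degree is odd,
  n = 2 k + 3, because the auxiliary function uses a splitting p^n = r s with r = p^(k+1) and s = p
  r. That it does not vanish identically is read off from its norm, a polynomial in y.\<close>

lemma homogeneous_system_nontrivial:
  fixes T :: "'e \<Rightarrow> 'i \<Rightarrow> 'a::field"
  assumes "finite I" "finite E" "card I < card E"
  shows "\<exists>\<beta>. (\<exists>e\<in>E. \<beta> e \<noteq> 0) \<and> (\<forall>i\<in>I. (\<Sum>e\<in>E. \<beta> e * T e i) = 0)"
  using assms
proof (induction I arbitrary: E T rule: finite_induct)
  case empty
  then have "E \<noteq> {}" by auto
  then show ?case by (intro exI[of _ "\<lambda>_. 1"]) auto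
next
  case (insert i I)
  show ?case
  proof (cases "\<forall>e\<in>E. T e i = 0")
    case True
    have "card I < card E" using insert by simp
    from insert.IH[OF insert.prems(1) this, of T] True show ?thesis
      by auto
  next
    case False
    then obtain e0 where e0: "e0 \<in> E" "T e0 i \<noteq> 0" by auto
    define E' where "E' = E - {e0}"
    have fin: "finite E'" using insert by (simp add: E'_def)
    have E: "E = insert e0 E'" "e0 \<notin> E'" using e0 by (auto simp: E'_def)
    have "card I < card E'" using insert e0 by (simp add: E'_def)
    from insert.IH[OF fin this, of "\<lambda>e k. T e k - T e i / T e0 i * T e0 k"]
    obtain \<beta> where \<beta>: "\<exists>e\<in>E'. \<beta> e \<noteq> 0"
      "\<And>k. k \<in> I \<Longrightarrow> (\<Sum>e\<in>E'. \<beta> e * (T e k - T e i / T e0 i * T e0 k)) = 0" by blast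
    define S where "S = (\<Sum>e\<in>E'. \<beta> e * T e i) / T e0 i"
    define \<gamma> where "\<gamma> = (\<lambda>e. if e = e0 then - S else \<beta> e)"
    have sum_eq: "(\<Sum>e\<in>E. \<gamma> e * T e k) = - S * T e0 k + (\<Sum>e\<in>E'. \<beta> e * T e k)" for k
    proof -
      have "(\<Sum>e\<in>E'. \<gamma> e * T e k) = (\<Sum>e\<in>E'. \<beta> e * T e k)"
        using E by (intro sum.cong) (auto simp: \<gamma>_def)
      then show ?thesis using E fin by (simp add: \<gamma>_def)
    qed
    have "(\<Sum>e\<in>E. \<gamma> e * T e k) = 0" if "k \<in> insert i I" for k
    proof (cases "k = i")
      case True
      then show ?thesis unfolding sum_eq using e0 by (simp add: S_def)
    next
      case False
      then have "k \<in> I" using that by auto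
      from \<beta>(2)[OF this] have "(\<Sum>e\<in>E'. \<beta> e * T e k) = (\<Sum>e\<in>E'. \<beta> e * T e i * (T e0 k / T e0 i))"
        by (simp add: right_diff_distrib sum_subtractf algebra_simps)
      also have "\<dots> = S * T e0 k" by (simp add: S_def sum_distrib_right sum_divide_distrib)
      finally show ?thesis unfolding sum_eq by simp
    qed
    moreover have "\<exists>e\<in>E. \<gamma> e \<noteq> 0" using \<beta>(1) E by (auto simp: \<gamma>_def)
    ultimately show ?thesis by blast
  qed
qed

section \<open>Reduction of functions on the curve by the Artin-Schreier relation\<close>

definition curve :: "'a::{alg_closed_field,field_prime_char} \<Rightarrow> ('a \<times> 'a) set" where
  "curve b = {(x, y). x \<noteq> 0 \<and> x + b / x = y ^ CHAR('a) - y}"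

text \<open>Functions on the curve that the Artin--Schreier relation reduces to degree \<open>< p\<close> in \<open>y\<close>, with
  a bound on the degree in \<open>x\<close>.\<close>

definition reducible_fun :: "'a::{alg_closed_field,field_prime_char} \<Rightarrow> nat \<Rightarrow> ('a \<Rightarrow> 'a \<Rightarrow> 'a) \<Rightarrow> bool" where
  "reducible_fun b n f \<longleftrightarrow> (\<exists>t::nat \<Rightarrow> 'a poly. (\<forall>i. degree (t i) \<le> n) \<and>
     (\<forall>(x, y)\<in>curve b. f x y = (\<Sum>i<CHAR('a). poly (t i) x * y ^ i)))"

lemma prime_CHAR: "prime CHAR('a::field_prime_char)"
  by (rule prime_CHAR_semidom) simp

lemma curve_mult:
  assumes "(x, y) \<in> curve b"
  shows "x * y ^ CHAR('a::{alg_closed_field,field_prime_char}) = x * (y::'a) + x\<^sup>2 + b"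
proof -
  have "x \<noteq> 0" "y ^ CHAR('a) = y + x + b / x" using assms by (auto simp: curve_def algebra_simps)
  then show ?thesis by (simp add: field_simps power2_eq_square)
qed

lemma reducible_fun_cong:
  fixes b :: "'a::{alg_closed_field,field_prime_char}"
  assumes "reducible_fun b n f" "\<And>x y. (x, y) \<in> curve b \<Longrightarrow> g x y = f x y"
  shows "reducible_fun b n g"
proof -
  from assms(1) obtain t where t: "\<And>i. degree (t i) \<le> n"
    "\<And>x y. (x, y) \<in> curve b \<Longrightarrow> f x y = (\<Sum>i<CHAR('a). poly (t i) x * y ^ i)"
    unfolding reducible_fun_def by blast
  show ?thesis unfolding reducible_fun_def
    by (rule exI[of _ t]) (auto simp: t(1) t(2)[symmetric] assms(2))
qed

lemma reducible_fun_mono: "reducible_fun b n f \<Longrightarrow> n \<le> m \<Longrightarrow> reducible_fun b m f"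
  unfolding reducible_fun_def using le_trans by blast

lemma reducible_fun_add:
  fixes b :: "'a::{alg_closed_field,field_prime_char}"
  assumes "reducible_fun b n f" "reducible_fun b n g"
  shows "reducible_fun b n (\<lambda>x y. f x y + g x y)"
proof -
  from assms(1) obtain t where t: "\<And>i. degree (t i) \<le> n"
    "\<And>x y. (x, y) \<in> curve b \<Longrightarrow> f x y = (\<Sum>i<CHAR('a). poly (t i) x * y ^ i)"
    unfolding reducible_fun_def by blast
  from assms(2) obtain u where u: "\<And>i. degree (u i) \<le> n"
    "\<And>x y. (x, y) \<in> curve b \<Longrightarrow> g x y = (\<Sum>i<CHAR('a). poly (u i) x * y ^ i)"
    unfolding reducible_fun_def by blast
  show ?thesis unfolding reducible_fun_def
    by (rule exI[of _ "\<lambda>i. t i + u i"])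
      (auto simp: t u distrib_right sum.distrib intro!: degree_add_le)
qed

lemma reducible_fun_poly_mult:
  fixes b :: "'a::{alg_closed_field,field_prime_char}"
  assumes "reducible_fun b n f" "degree h \<le> d"
  shows "reducible_fun b (n + d) (\<lambda>x y. poly h x * f x y)"
proof -
  from assms(1) obtain t where t: "\<And>i. degree (t i) \<le> n"
    "\<And>x y. (x, y) \<in> curve b \<Longrightarrow> f x y = (\<Sum>i<CHAR('a). poly (t i) x * y ^ i)"
    unfolding reducible_fun_def by blast
  have "degree (h * t i) \<le> n + d" for i
    using degree_mult_le[of h "t i"] t(1)[of i] assms(2) by linarith
  then show ?thesis unfolding reducible_fun_def
    by (intro exI[of _ "\<lambda>i. h * t i"]) (auto simp: t sum_distrib_left mult_ac)
qed

lemma reducible_fun_one: "reducible_fun (b::'a::{alg_closed_field,field_prime_char}) 0 (\<lambda>x y. 1)"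
proof -
  obtain m where m: "CHAR('a) = Suc m" using CHAR_pos[where 'a='a] gr0_conv_Suc by blast
  have "(\<Sum>i<CHAR('a). poly (if i = 0 then 1 else 0) x * y ^ i) = 1" for x y :: 'a
    unfolding m sum.lessThan_Suc_shift by simp
  then show ?thesis unfolding reducible_fun_def
    by (intro exI[of _ "\<lambda>i. if i = 0 then 1 else 0"]) simp
qed

text \<open>Multiplication by y moves the top term to degree p in y. The extra factor x clears the
  pole, and x y^p = x y + x^2 + b spreads that term over the degrees 1 and 0 in y. Each such step
  costs 2 in the degree in x.\<close>

lemma reducible_fun_xy:
  fixes b :: "'a::{alg_closed_field,field_prime_char}"
  assumes "reducible_fun b n f"
  shows "reducible_fun b (n + 2) (\<lambda>x y. x * y * f x y)"
proof -
  from assms(1) obtain t where t: "\<And>i. degree (t i) \<le> n"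
    "\<And>x y. (x, y) \<in> curve b \<Longrightarrow> f x y = (\<Sum>i<CHAR('a). poly (t i) x * y ^ i)"
    unfolding reducible_fun_def by blast
  obtain m where m: "CHAR('a) = Suc (Suc m)"
    using prime_ge_2_nat[OF prime_CHAR[where 'a = 'a]] by (metis Suc_le_D numeral_2_eq_2 Suc_le_mono)
  \<comment> \<open>The top coefficient \<open>t (Suc m)\<close> goes to degree 1 with the factor x
    and to degree 0 with the factor x^2 + b; all the others move up by one.\<close>
  define u where "u = (\<lambda>i. (if i = 0 then 0 else [:0, 1:] * t (i - 1)) +
      (if i = 1 then [:0, 1:] * t (Suc m) else 0) + (if i = 0 then [:b, 0, 1:] * t (Suc m) else 0))"
  have d1: "degree ([:0, 1:] * t i) \<le> n + 2" for i
    using degree_mult_le[of "[:0,1:]" "t i"] t(1)[of i] by simp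
  have d2: "degree ([:b, 0, 1:] * t i) \<le> n + 2" for i
    using degree_mult_le[of "[:b,0,1:]" "t i"] t(1)[of i] by simp
  have "degree (u i) \<le> n + 2" for i
    unfolding u_def by (intro degree_add_le) (use d1 d2 in auto)
  moreover have "x * y * f x y = (\<Sum>i<CHAR('a). poly (u i) x * y ^ i)" if xy: "(x, y) \<in> curve b" for x y
  proof -
    have "(\<Sum>i<CHAR('a). poly (u i) x * y ^ i)
      = (\<Sum>i<Suc (Suc m). (if i = 0 then 0 else x * poly (t (i - 1)) x * y ^ i)) +
        (\<Sum>i<Suc (Suc m). if i = 1 then x * poly (t (Suc m)) x * y ^ i else 0) +
        (\<Sum>i<Suc (Suc m). if i = 0 then (b + x * x) * poly (t (Suc m)) x * y ^ i else 0)"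
      unfolding m sum.distrib[symmetric] by (intro sum.cong) (auto simp: u_def algebra_simps)
    also have "(\<Sum>i<Suc (Suc m). if i = 1 then x * poly (t (Suc m)) x * y ^ i else 0)
        = x * poly (t (Suc m)) x * y"
      by (subst sum.delta) auto
    also have "(\<Sum>i<Suc (Suc m). if i = 0 then (b + x * x) * poly (t (Suc m)) x * y ^ i else 0)
        = (b + x * x) * poly (t (Suc m)) x"
      by (subst sum.delta) auto
    also have "(\<Sum>i<Suc (Suc m). (if i = 0 then 0 else x * poly (t (i - 1)) x * y ^ i))
        = (\<Sum>i<Suc m. x * poly (t i) x * y ^ Suc i)"
      by (subst sum.lessThan_Suc_shift) simp
    finally have "(\<Sum>i<CHAR('a). poly (u i) x * y ^ i)
      = (\<Sum>i<Suc m. x * poly (t i) x * y ^ Suc i) + poly (t (Suc m)) x * (x * y + x\<^sup>2 + b)"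
      by (simp add: algebra_simps power2_eq_square)
    also have "x * y + x\<^sup>2 + b = x * y ^ Suc (Suc m)" using curve_mult[OF xy] m by simp
    also have "(\<Sum>i<Suc m. x * poly (t i) x * y ^ Suc i) + poly (t (Suc m)) x * (x * y ^ Suc (Suc m))
      = x * y * (\<Sum>i<Suc (Suc m). poly (t i) x * y ^ i)"
      unfolding sum.lessThan_Suc[of _ "Suc m"] distrib_left sum_distrib_left by (simp add: mult_ac)
    finally show ?thesis using t(2)[OF xy] m by simp
  qed
  ultimately show ?thesis unfolding reducible_fun_def by blast
qed

lemma reducible_fun_x_shift:
  assumes "reducible_fun b n f"
  shows "reducible_fun b (n + 2) (\<lambda>x y. x * (y + c) * f x y)"
proof (rule reducible_fun_cong)
  show "reducible_fun b (n + 2) (\<lambda>x y. x * y * f x y + poly [:0, c:] x * f x y)"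
    by (intro reducible_fun_add reducible_fun_xy assms
        reducible_fun_mono[OF reducible_fun_poly_mult[OF assms, of _ 1]]) (auto)
qed (simp add: algebra_simps)

text \<open>On the curve y^(p^(k+1)) - y is the sum of the p^i-th powers of x + b / x over i \<le>
  k. Its pole at x = 0 has order p^k, so multiplication by x^(p^k) leaves a polynomial
  \<open>H\<close> in x.\<close>

lemma curve_frobenius_power:
  fixes b :: "'a::{alg_closed_field,field_prime_char}"
  shows "\<exists>H. degree H \<le> 2 * CHAR('a) ^ k \<and> (\<forall>(x, y)\<in>curve b.
      x ^ (CHAR('a) ^ k) * y ^ (CHAR('a) ^ Suc k) = x ^ (CHAR('a) ^ k) * y + poly H x)"
proof (induction k)
  case 0
  show ?case by (intro exI[of _ "[:b, 0, 1:]"]) (auto dest: curve_mult simp: power2_eq_square)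
next
  case (Suc k)
  define p where "p = CHAR('a)"
  have p: "prime p" "p \<ge> 1" using prime_CHAR[where 'a='a] prime_ge_1_nat unfolding p_def by auto
  from Suc obtain H where H: "degree H \<le> 2 * p ^ k"
    "\<And>x y. (x, y) \<in> curve b \<Longrightarrow> x ^ (p ^ k) * y ^ (p ^ Suc k) = x ^ (p ^ k) * y + poly H x"
    unfolding p_def by blast
  define r where "r = p ^ Suc k"
  have r: "r \<ge> 1" using p by (simp add: r_def)
  define H' where "H' = monom 1 (r + 1) + monom b (r - 1) + H ^ p"
  have "degree (H ^ p) \<le> 2 * r"
  proof -
    have "degree (H ^ p) \<le> degree H * p" by (rule degree_power_le)
    also have "\<dots> \<le> 2 * p ^ k * p" using H(1) by (rule mult_right_mono) simp
    finally show ?thesis by (simp add: r_def mult_ac)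
  qed
  then have "degree H' \<le> 2 * r" unfolding H'_def
    by (intro degree_add_le degree_monom_le[THEN order_trans]) (use r in auto)
  moreover have "x ^ r * y ^ (p ^ Suc (Suc k)) = x ^ r * y + poly H' x" if xy: "(x, y) \<in> curve b" for x y
  proof -
    have x0: "x \<noteq> 0" "y ^ p = y + x + b / x" using xy by (auto simp: curve_def p_def algebra_simps)
    have "x ^ r * y ^ (p ^ Suc (Suc k)) = (x ^ (p ^ k) * y ^ (p ^ Suc k)) ^ p"
      by (simp add: power_mult_distrib r_def power_mult[symmetric] mult_ac)
    also have "\<dots> = (x ^ (p ^ k) * y + poly H x) ^ p" using H(2)[OF xy] by simp
    also have "\<dots> = (x ^ (p ^ k) * y) ^ p + poly H x ^ p"
      using p by (intro freshmans_dream) (auto simp: p_def)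
    also have "(x ^ (p ^ k) * y) ^ p = x ^ r * (y + x + b / x)"
      by (simp add: power_mult_distrib r_def power_mult[symmetric] mult_ac x0)
    also have "\<dots> = x ^ r * y + x ^ (r + 1) + b * x ^ (r - 1)"
      using x0 r by (cases r) (auto simp: field_simps)
    finally show ?thesis by (simp add: H'_def poly_monom algebra_simps)
  qed
  ultimately show ?case unfolding r_def p_def by blast
qed

text \<open>A whole Frobenius power of y costs only 2 \<rho> in the degree, where p \<rho> single
  steps of \<open>reducible_fun_xy\<close> would cost 2 p \<rho>.\<close>

lemma reducible_fun_frobenius:
  fixes b :: "'a::{alg_closed_field,field_prime_char}" and k :: nat
  assumes "reducible_fun b n f"
  defines "\<rho> \<equiv> CHAR('a) ^ k"
  shows "reducible_fun b (n + 2 * \<rho>) (\<lambda>x y. x ^ \<rho> * y ^ (CHAR('a) * \<rho>) * f x y)"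
proof -
  obtain H where H: "degree H \<le> 2 * \<rho>"
    "\<And>x y. (x, y) \<in> curve b \<Longrightarrow> x ^ \<rho> * y ^ (CHAR('a) * \<rho>) = x ^ \<rho> * y + poly H x"
    using curve_frobenius_power[of k b] unfolding \<rho>_def by auto
  have \<rho>: "\<rho> \<ge> 1" unfolding \<rho>_def by (metis CHAR_pos One_nat_def Suc_leI zero_less_power)
  show ?thesis
  proof (rule reducible_fun_cong)
    have "reducible_fun b (n + 2 + (\<rho> - 1)) (\<lambda>x y. poly (monom 1 (\<rho> - 1)) x * (x * y * f x y))"
      by (intro reducible_fun_poly_mult reducible_fun_xy assms degree_monom_le)
    then show "reducible_fun b (n + 2 * \<rho>) (\<lambda>x y. poly (monom 1 (\<rho> - 1)) x * (x * y * f x y) + poly H x * f x y)"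
      by (intro reducible_fun_add reducible_fun_poly_mult[OF assms(1) H(1)]) (erule reducible_fun_mono, use \<rho> in simp)
    show "x ^ \<rho> * y ^ (CHAR('a) * \<rho>) * f x y = poly (monom 1 (\<rho> - 1)) x * (x * y * f x y) + poly H x * f x y"
      if "(x, y) \<in> curve b" for x y
      unfolding H(2)[OF that] using \<rho> by (cases \<rho>) (auto simp: poly_monom algebra_simps)
  qed
qed

text \<open>One power of x clears the poles for all exponents i, i' below p at once, so that the
  whole ansatz of \<open>frobenius_relation\<close> is reduced with a single factor and a degree
  bound independent of i and i'.\<close>

lemma reducible_fun_monomial:
  fixes b :: "'a::{alg_closed_field,field_prime_char}" and k :: nat
  defines "p \<equiv> CHAR('a)" and "\<rho> \<equiv> CHAR('a) ^ k"
  assumes "i < p" "i' < p"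
  shows "reducible_fun b (m + 2 * (\<rho> + 1) * (p - 1))
     (\<lambda>x y. x ^ ((\<rho> + 1) * (p - 1)) * (x ^ m * y ^ (i * p * \<rho>) * (y + c) ^ i'))"
proof -
  have 1: "reducible_fun b (2 * i') (\<lambda>x y. (x * (y + c)) ^ i')" for i'
  proof (induction i')
    case (Suc i')
    from reducible_fun_x_shift[OF this, of c] show ?case by (simp add: mult_ac)
  qed (simp add: reducible_fun_one)
  have 2: "reducible_fun b (2 * i' + 2 * \<rho> * i) (\<lambda>x y. (x ^ \<rho> * y ^ (p * \<rho>)) ^ i * (x * (y + c)) ^ i')" for i i'
  proof (induction i)
    case (Suc i)
    from reducible_fun_frobenius[OF this, of k] show ?case by (simp add: mult_ac p_def \<rho>_def add_ac)
  qed (simp add: 1)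
  \<comment> \<open>The power of x that is left after giving \<rho> factors to each of the i
    Frobenius powers and one factor to each y + c.\<close>
  define d where "d = m + (p - 1 - i') + \<rho> * (p - 1 - i)"
  have "reducible_fun b (2 * i' + 2 * \<rho> * i + d) (\<lambda>x y. poly (monom 1 d) x * ((x ^ \<rho> * y ^ (p * \<rho>)) ^ i * (x * (y + c)) ^ i'))"
    by (intro reducible_fun_poly_mult 2 degree_monom_le)
  then have 3: "reducible_fun b (2 * i' + 2 * \<rho> * i + d) (\<lambda>x y. x ^ ((\<rho> + 1) * (p - 1)) * (x ^ m * y ^ (i * p * \<rho>) * (y + c) ^ i'))"
  proof (rule reducible_fun_cong)
    fix x y :: 'a
    have "(\<rho> + 1) * (p - 1) + m = d + i' + \<rho> * i"
    proof -
      obtain u v where "p = Suc (i + u)" "p = Suc (i' + v)"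
        using assms(3,4) by (metis less_imp_Suc_add)
      moreover from this have "\<rho> * i + \<rho> * u = \<rho> * i' + \<rho> * v"
        by (simp flip: distrib_left)
      ultimately show ?thesis unfolding d_def by (simp add: algebra_simps)
    qed
    then have "x ^ ((\<rho> + 1) * (p - 1)) * x ^ m = x ^ d * (x ^ i' * (x ^ \<rho>) ^ i)"
      by (simp add: power_add[symmetric] power_mult[symmetric] add_ac)
    then show "x ^ ((\<rho> + 1) * (p - 1)) * (x ^ m * y ^ (i * p * \<rho>) * (y + c) ^ i') =
         poly (monom 1 d) x * ((x ^ \<rho> * y ^ (p * \<rho>)) ^ i * (x * (y + c)) ^ i')"
      by (simp add: poly_monom power_mult_distrib power_mult[symmetric] mult_ac)
  qed
  have "2 * i' + 2 * \<rho> * i + d \<le> m + 2 * (\<rho> + 1) * (p - 1)"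
  proof -
    have "2 * i' + (p - 1 - i') \<le> 2 * (p - 1)" using assms by linarith
    moreover have "2 * i + (p - 1 - i) \<le> 2 * (p - 1)" using assms by linarith
    then have "\<rho> * (2 * i + (p - 1 - i)) \<le> \<rho> * (2 * (p - 1))" by (rule mult_left_mono) simp
    ultimately show ?thesis unfolding d_def by (simp add: algebra_simps)
  qed
  with 3 show ?thesis by (rule reducible_fun_mono)
qed

section \<open>The norm from functions on the curve to polynomials in y\<close>

definition artin_schreier :: "'a::{alg_closed_field,field_prime_char} poly" where
  "artin_schreier = monom 1 CHAR('a) - [:0, 1:]"

lemma poly_artin_schreier: "poly artin_schreier (y::'a::{alg_closed_field,field_prime_char}) = y ^ CHAR('a) - y"
  by (simp add: artin_schreier_def poly_monom)

lemma CHAR_ge_2: "CHAR('a::field_prime_char) \<ge> 2"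
  using prime_ge_2_nat[OF prime_CHAR] .

lemma degree_artin_schreier_minus:
  "degree (artin_schreier - [:v:] :: 'a::{alg_closed_field,field_prime_char} poly) = CHAR('a)"
  and lead_coeff_artin_schreier:
  "coeff (artin_schreier :: 'a poly) CHAR('a) = 1"
  and degree_artin_schreier:
  "degree (artin_schreier :: 'a poly) = CHAR('a)"
proof -
  have p: "CHAR('a) \<ge> 2" by (rule CHAR_ge_2)
  have *: "degree (monom (1::'a) CHAR('a) - q) = CHAR('a)" if "degree q < CHAR('a)" for q :: "'a poly"
  proof -
    have "degree (monom (1::'a) CHAR('a) + (- q)) = degree (monom (1::'a) CHAR('a))"
      by (rule degree_add_eq_left) (use that in \<open>simp add: degree_monom_eq\<close>)
    then show ?thesis by (simp add: degree_monom_eq)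
  qed
  have "artin_schreier - [:v:] = monom (1::'a) CHAR('a) - [:v, 1:]"
    by (simp add: artin_schreier_def)
  then show "degree (artin_schreier - [:v:] :: 'a poly) = CHAR('a)"
    using *[of "[:v,1:]"] p by simp
  show "degree (artin_schreier :: 'a poly) = CHAR('a)"
    using *[of "[:0,1:]"] p by (simp add: artin_schreier_def)
  have "coeff [:0, 1::'a:] CHAR('a) = 0" by (rule coeff_eq_0) (use p in simp)
  then show "coeff (artin_schreier :: 'a poly) CHAR('a) = 1"
    by (simp add: artin_schreier_def)
qed

text \<open>On the curve, \<open>x\<^sup>2 = (y\<^sup>p - y) x - b\<close>. So each power of \<open>x\<close> is linear in \<open>x\<close> over the
  polynomials in \<open>y\<close>, with coefficients \<open>xU\<close> and \<open>xW\<close>.\<close>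

fun xW :: "'a::{alg_closed_field,field_prime_char} \<Rightarrow> nat \<Rightarrow> 'a poly" where
  "xW b 0 = 0"
| "xW b (Suc 0) = 1"
| "xW b (Suc (Suc n)) = artin_schreier * xW b (Suc n) - smult b (xW b n)"

definition xU :: "'a::{alg_closed_field,field_prime_char} \<Rightarrow> nat \<Rightarrow> 'a poly" where
  "xU b n = (case n of 0 \<Rightarrow> 1 | Suc m \<Rightarrow> - smult b (xW b m))"

lemma xU_0 [simp]: "xU b 0 = 1" and xU_Suc: "xU b (Suc n) = - smult b (xW b n)"
  by (simp_all add: xU_def)

lemma xW_Suc: "xW b (Suc n) = xU b n + artin_schreier * xW b n"
  by (cases n) (simp_all add: xU_def)

lemma xU_1: "xU b (Suc 0) = 0" by (simp add: xU_Suc)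

lemma power_eq_xU_xW:
  assumes "x\<^sup>2 = poly artin_schreier y * x - b"
  shows "x ^ n = poly (xU b n) y + poly (xW b n) y * x"
proof (induction n)
  case (Suc n)
  have "x ^ Suc n = poly (xU b n) y * x + poly (xW b n) y * x\<^sup>2"
    by (simp add: Suc power2_eq_square algebra_simps)
  then show ?case unfolding assms by (simp add: xW_Suc xU_Suc algebra_simps)
qed simp

text \<open>A bilinear form whose diagonal is the norm \<open>U\<^sup>2 + (y\<^sup>p - y) U W + b W\<^sup>2\<close> of \<open>U + W x\<close> over
  the polynomials in \<open>y\<close>. It is not symmetrised: this gives \<open>xH b m n\<close> a smaller degree for \<open>m > n\<close> than
  for \<open>m < n\<close>, which isolates a single leading term in \<open>norm_poly\<close>.\<close>

definition xH :: "'a::{alg_closed_field,field_prime_char} \<Rightarrow> nat \<Rightarrow> nat \<Rightarrow> 'a poly" where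
  "xH b m n = xU b m * xU b n + artin_schreier * xU b m * xW b n + smult b (xW b m * xW b n)"

text \<open>\<open>xH b m n\<close> is the part free of x in x^m (b / x)^n, written in the basis 1,
  x over the polynomials in y, where b / x = (y^p - y) - x is the conjugate of x. Raising both
  exponents by one multiplies this product by b.\<close>

lemma xH_Suc_Suc: "xH (b::'a::{alg_closed_field,field_prime_char}) (Suc m) (Suc n) = smult b (xH b m n)"
proof -
  define B where "B = [:b:]"
  have s: "smult b p = B * p" for p :: "'a poly" by (simp add: B_def)
  show ?thesis unfolding xH_def xW_Suc xU_Suc s by (simp add: algebra_simps)
qed

lemma xH_0_right: "xH b m 0 = xU b m" and xH_0_left: "xH b 0 n = xW b (Suc n)"
  by (simp_all add: xH_def xW_Suc)

lemma xW_monic: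
  fixes b :: "'a::{alg_closed_field,field_prime_char}"
  shows "degree (xW b (Suc n)) = CHAR('a) * n \<and> coeff (xW b (Suc n)) (CHAR('a) * n) = 1"
proof (induction n rule: less_induct)
  case (less n)
  show ?case
  proof (cases n)
    case (Suc m)
    have IH: "degree (xW b (Suc m)) = CHAR('a) * m" "coeff (xW b (Suc m)) (CHAR('a) * m) = 1"
      using less Suc by auto
    have small: "degree (smult b (xW b m)) < CHAR('a) * n"
    proof (cases m)
      case 0
      then show ?thesis using Suc by simp
    next
      case (Suc l)
      have "degree (xW b (Suc l)) = CHAR('a) * l" using less \<open>n = Suc m\<close> Suc by auto
      then show ?thesis using Suc \<open>n = Suc m\<close> CHAR_ge_2[where 'a='a]
        by (intro le_less_trans[OF degree_smult_le]) auto
    qed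
    have nz: "xW b (Suc m) \<noteq> 0" "artin_schreier \<noteq> (0::'a poly)" using IH(2) lead_coeff_artin_schreier[where 'a='a] by auto
    have deg: "degree (artin_schreier * xW b (Suc m)) = CHAR('a) * n"
      using nz IH by (simp add: degree_mult_eq degree_artin_schreier Suc)
    have "coeff (artin_schreier * xW b (Suc m)) (CHAR('a) * n) = 1"
      using coeff_mult_degree_sum[of artin_schreier "xW b (Suc m)"] IH
      by (simp add: degree_artin_schreier lead_coeff_artin_schreier Suc)
    moreover have "coeff (smult b (xW b m)) (CHAR('a) * n) = 0" using small by (rule coeff_eq_0)
    ultimately have c: "coeff (xW b (Suc n)) (CHAR('a) * n) = 1" using Suc by simp
    have "degree (xW b (Suc n)) \<le> CHAR('a) * n" using Suc deg small by (simp add: degree_diff_le)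
    moreover have "degree (xW b (Suc n)) \<ge> CHAR('a) * n" by (rule le_degree) (use c in simp)
    ultimately show ?thesis using c by simp
  qed simp
qed

text \<open>A common shift of the indices leaves \<open>xW\<close> when i \<le> j and
  \<open>xU\<close> when j < i. With d the distance of the indices, \<open>xW b (d + 1)\<close>
  attains degree p d, whereas \<open>xU b d\<close> is a multiple of \<open>xW b (d - 1)\<close> and
  falls short of it.\<close>

lemma coeff_xH:
  fixes b :: "'a::{alg_closed_field,field_prime_char}"
  shows "CHAR('a) * (i - j) + CHAR('a) * (j - i) < m \<Longrightarrow> coeff (xH b i j) m = 0"
    and "i \<le> j \<Longrightarrow> coeff (xH b i j) (CHAR('a) * (j - i)) = b ^ i"
    and "j < i \<Longrightarrow> CHAR('a) * (i - j) \<le> m \<Longrightarrow> coeff (xH b i j) m = 0"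
proof -
  have shift: "xH b (d + i) (d + j) = smult (b ^ d) (xH b i j)" for d i j
    by (induction d) (simp_all add: xH_Suc_Suc)
  have U: "coeff (xU b d) m = 0" if "0 < d" "CHAR('a) * d \<le> m" for d m
  proof -
    obtain e where e: "d = Suc e" using \<open>0 < d\<close> gr0_conv_Suc by blast
    show ?thesis
    proof (cases e)
      case 0
      then show ?thesis using e by (simp add: xU_1)
    next
      case (Suc f)
      have "degree (xU b d) \<le> CHAR('a) * f"
        using xW_monic[of b f] unfolding e xU_Suc Suc by (simp add: degree_smult_le)
      also have "\<dots> < m" using that CHAR_ge_2[where 'a='a] e Suc by auto
      finally show ?thesis by (rule coeff_eq_0)
    qed
  qed
  show 3: "coeff (xH b i j) m = 0" if "j < i" "CHAR('a) * (i - j) \<le> m" for i j m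
    using shift[of j "i - j" 0] that U[of "i - j" m] by (simp add: xH_0_right)
  show "coeff (xH b i j) (CHAR('a) * (j - i)) = b ^ i" if "i \<le> j" for i j
    using shift[of i 0 "j - i"] that xW_monic[of b "j - i"] by (simp add: xH_0_left)
  show "coeff (xH b i j) m = 0" if "CHAR('a) * (i - j) + CHAR('a) * (j - i) < m" for i j m
  proof (cases "i \<le> j")
    case True
    have "coeff (xW b (Suc (j - i))) m = 0"
      using xW_monic[of b "j - i"] that True by (intro coeff_eq_0) simp
    then show ?thesis using shift[of i 0 "j - i"] True by (simp add: xH_0_left)
  qed (use 3 that in auto)
qed

lemma norm_expand:
  fixes a c m n u v w z B Y :: "'r::comm_ring_1"
  shows "a * (m * u) * (c * (n * v)) + Y * (a * (m * u)) * (c * (n * z)) + B * (a * (m * w) * (c * (n * z)))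
    = a * c * (m * n * (u * v + Y * u * z + B * (w * z)))"
  by (simp add: algebra_simps)

text \<open>P + Q x stands for the sum of the \<open>\<alpha> e\<close> y^(K e) x^(A e). The curve
  has two places at infinity, over x = infinity and over x = 0, where x behaves like y^p and like
  y^(-p); the pole orders of y^K x^A there are K + p A and K - p A. As both are injective on
  \<open>E\<close>, each place has a unique dominant term. The degree of the norm is the sum of the
  two dominant orders, so the norm cannot vanish. This is carried out on coefficients.\<close>

lemma norm_poly:
  fixes b :: "'a::{alg_closed_field,field_prime_char}" and \<alpha> :: "'e \<Rightarrow> 'a" and A K :: "'e \<Rightarrow> nat"
  assumes fin: "finite E" and b: "b \<noteq> 0" and nz: "\<exists>e\<in>E. \<alpha> e \<noteq> 0"
    and inj1: "inj_on (\<lambda>e. K e + CHAR('a) * A e) E"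
    and inj2: "inj_on (\<lambda>e. int (K e) - int (CHAR('a) * A e)) E"
    and B1: "\<And>e. e \<in> E \<Longrightarrow> int (K e + CHAR('a) * A e) \<le> B1"
    and B2: "\<And>e. e \<in> E \<Longrightarrow> int (K e) - int (CHAR('a) * A e) \<le> B2"
  defines "P \<equiv> (\<Sum>e\<in>E. smult (\<alpha> e) (monom 1 (K e) * xU b (A e)))"
    and "Q \<equiv> (\<Sum>e\<in>E. smult (\<alpha> e) (monom 1 (K e) * xW b (A e)))"
  defines "N \<equiv> P * P + artin_schreier * P * Q + smult b (Q * Q)"
  shows "N \<noteq> 0" and "int (degree N) \<le> B1 + B2"
proof -
  let ?p = "CHAR('a)"
  define vp where "vp = (\<lambda>e. int (K e + ?p * A e))"
  define vm where "vm = (\<lambda>e. int (K e) - int (?p * A e))"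
  have N: "N = (\<Sum>(e, f)\<in>E \<times> E. smult (\<alpha> e * \<alpha> f) (monom 1 (K e + K f) * xH b (A e) (A f)))"
  proof -
    have mm: "monom 1 (m + n) = monom 1 m * monom (1::'a) n" for m n by (simp add: mult_monom)
    have s: "smult c p = [:c:] * p" for c and p :: "'a poly" by simp
    have c: "[:c * d:] = [:c:] * [:d:]" for c d :: 'a by simp
    define f where "f = (\<lambda>e. smult (\<alpha> e) (monom 1 (K e) * xU b (A e)))"
    define g where "g = (\<lambda>e. smult (\<alpha> e) (monom 1 (K e) * xW b (A e)))"
    have "N = (\<Sum>e\<in>E. \<Sum>h\<in>E. f e * f h + artin_schreier * (f e * g h) + smult b (g e * g h))"
      unfolding N_def P_def Q_def f_def[symmetric] g_def[symmetric] mult.assoc sum_product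
      by (simp only: sum_distrib_left smult_sum2 sum.distrib)
    also have "\<dots> = (\<Sum>e\<in>E. \<Sum>f\<in>E. 
       smult (\<alpha> e) (monom 1 (K e) * xU b (A e)) * smult (\<alpha> f) (monom 1 (K f) * xU b (A f)) +
       artin_schreier * smult (\<alpha> e) (monom 1 (K e) * xU b (A e)) * smult (\<alpha> f) (monom 1 (K f) * xW b (A f)) +
       smult b (smult (\<alpha> e) (monom 1 (K e) * xW b (A e)) * smult (\<alpha> f) (monom 1 (K f) * xW b (A f))))"
      unfolding f_def g_def by (simp only: mult.assoc)
    also have "\<dots> = (\<Sum>e\<in>E. \<Sum>f\<in>E. smult (\<alpha> e * \<alpha> f) (monom 1 (K e + K f) * xH b (A e) (A f)))"
    proof (intro sum.cong refl, goal_cases)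
      case (1 e f)
      show ?case unfolding xH_def mm unfolding s c by (rule norm_expand)
    qed
    finally show ?thesis by (simp add: sum.cartesian_product)
  qed
  have cN: "coeff N m = (\<Sum>(e, f)\<in>E \<times> E. \<alpha> e * \<alpha> f * (if m < K e + K f then 0 else coeff (xH b (A e) (A f)) (m - (K e + K f))))" for m
    unfolding N coeff_sum by (intro sum.cong) (auto simp: coeff_monom_mult)
  have "degree N \<le> nat (B1 + B2)"
  proof (rule degree_le, intro allI impI)
    fix m assume "nat (B1 + B2) < m"
    then have m: "B1 + B2 < int m" by linarith
    have "coeff (xH b (A e) (A f)) (m - (K e + K f)) = 0" if "e \<in> E" "f \<in> E" "K e + K f \<le> m" for e f
    proof (rule coeff_xH(1), cases "A e \<le> A f")
      case True
      have "vm e + vp f \<le> B1 + B2" using B1[OF that(2)] B2[OF that(1)] by (simp add: vm_def vp_def)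
      then have "int (?p * (A f - A e)) < int (m - (K e + K f))" using m True that
        by (simp add: vm_def vp_def of_nat_diff algebra_simps)
      then have "?p * (A f - A e) < m - (K e + K f)" unfolding of_nat_less_iff .
      then show "?p * (A e - A f) + ?p * (A f - A e) < m - (K e + K f)" using True by simp
    next
      case False
      have "vp e + vm f \<le> B1 + B2" using B1[OF that(1)] B2[OF that(2)] by (simp add: vm_def vp_def)
      then have "int (?p * (A e - A f)) < int (m - (K e + K f))" using m False that
        by (simp add: vm_def vp_def of_nat_diff algebra_simps)
      then have "?p * (A e - A f) < m - (K e + K f)" unfolding of_nat_less_iff .
      then show "?p * (A e - A f) + ?p * (A f - A e) < m - (K e + K f)" using False by simp
    qed
    then show "coeff N m = 0" unfolding cN by (intro sum.neutral) auto
  qed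
  \<comment> \<open>Only indices with nonzero coefficient can dominate: \<open>e2\<close> maximises
    the pole order over x = infinity, \<open>e1\<close> the one over x = 0.\<close>
  define S where "S = {e \<in> E. \<alpha> e \<noteq> 0}"
  have S: "finite S" "S \<noteq> {}" using fin nz by (auto simp: S_def)
  have "Max (vp ` S) \<in> vp ` S" using S by (intro Max_in) auto
  then obtain e2 where e2: "e2 \<in> S" "vp e2 = Max (vp ` S)" by fastforce
  have "Max (vm ` S) \<in> vm ` S" using S by (intro Max_in) auto
  then obtain e1 where e1: "e1 \<in> S" "vm e1 = Max (vm ` S)" by fastforce
  have le2: "vp e \<le> vp e2" if "e \<in> S" for e using that S e2(2) by simp
  have le1: "vm e \<le> vm e1" if "e \<in> S" for e using that S e1(2) by simp
  have eq2: "e = e2" if "e \<in> S" "vp e = vp e2" for e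
    using inj_onD[OF inj1, of e e2] that e2(1) by (auto simp: S_def vp_def simp flip: of_nat_mult of_nat_add)
  have eq1: "e = e1" if "e \<in> S" "vm e = vm e1" for e
    using inj_onD[OF inj2, of e e1] that e1(1) by (auto simp: S_def vm_def)
  have A12: "A e1 \<le> A e2"
  proof -
    have "int (?p * A e1) \<le> int (?p * A e2)"
      using le1[OF e2(1)] le2[OF e1(1)] unfolding vp_def vm_def by linarith
    then show ?thesis by simp
  qed
  define D where "D = K e1 + K e2 + ?p * (A e2 - A e1)"
  have D: "int D = vm e1 + vp e2" 
  proof -
    obtain d where "A e2 = A e1 + d" using A12 le_Suc_ex by blast
    then show ?thesis by (simp add: D_def vm_def vp_def algebra_simps)
  qed
  have "coeff N D = (\<Sum>(e, f)\<in>{(e1, e2)}. \<alpha> e * \<alpha> f * (if D < K e + K f then 0 else coeff (xH b (A e) (A f)) (D - (K e + K f))))"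
    unfolding cN
  proof (rule sum.mono_neutral_right)
    show "finite (E \<times> E)" using fin by simp
    show "{(e1, e2)} \<subseteq> E \<times> E" using e1 e2 by (auto simp: S_def)
    show "\<forall>x\<in>E \<times> E - {(e1, e2)}. (case x of (e, f) \<Rightarrow> \<alpha> e * \<alpha> f * (if D < K e + K f then 0 else coeff (xH b (A e) (A f)) (D - (K e + K f)))) = 0"
    proof
      fix x assume "x \<in> E \<times> E - {(e1, e2)}"
      then obtain e f where x: "x = (e, f)" and ef: "e \<in> E" "f \<in> E" "(e, f) \<noteq> (e1, e2)" by auto
      have "\<alpha> e * \<alpha> f * (if D < K e + K f then 0 else coeff (xH b (A e) (A f)) (D - (K e + K f))) = 0"
      proof (cases "e \<in> S \<and> f \<in> S \<and> K e + K f \<le> D")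
        case True
        have "coeff (xH b (A e) (A f)) (D - (K e + K f)) = 0"
        proof (cases "A e \<le> A f")
          case le: True
          have "vm e + vp f \<noteq> vm e1 + vp e2"
            using le1[of e] le2[of f] eq1[of e] eq2[of f] True ef(3) by force
          then have "vm e + vp f < int D" unfolding D using le1[of e] le2[of f] True by linarith
          then have "int (?p * (A f - A e)) < int (D - (K e + K f))" using le True
            by (simp add: vm_def vp_def of_nat_diff algebra_simps)
          then have "?p * (A f - A e) < D - (K e + K f)" unfolding of_nat_less_iff .
          then show ?thesis using le by (intro coeff_xH(1)) simp
        next
          case False
          \<comment> \<open>Here equality can occur, for instance for the swapped pair
            \<open>(e2, e1)\<close>; the coefficient still vanishes by the strict degree drop of
            \<open>xH\<close>.\<close>
          have "vp e + vm f \<le> int D" unfolding D using le1[of f] le2[of e] True by linarith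
          then have "int (?p * (A e - A f)) \<le> int (D - (K e + K f))" using False True
            by (simp add: vm_def vp_def of_nat_diff algebra_simps)
          then have "?p * (A e - A f) \<le> D - (K e + K f)" unfolding of_nat_le_iff .
          then show ?thesis using False by (intro coeff_xH(3)) simp_all
        qed
        then show ?thesis by simp
      next
        case False
        then have "\<alpha> e = 0 \<or> \<alpha> f = 0 \<or> D < K e + K f" using ef by (auto simp: S_def)
        then show ?thesis by auto
      qed
      then show "(case x of (e, f) \<Rightarrow> \<alpha> e * \<alpha> f * (if D < K e + K f then 0 else coeff (xH b (A e) (A f)) (D - (K e + K f)))) = 0"
        by (simp add: x)
    qed
  qed
  also have "\<dots> = \<alpha> e1 * \<alpha> e2 * b ^ A e1"
    using coeff_xH(2)[OF A12, of b] by (simp add: D_def)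
  also have "\<dots> \<noteq> 0" using b e1 e2 by (simp add: S_def)
  finally show "N \<noteq> 0" by auto
  have "0 \<le> int D" by simp
  also have "int D \<le> B1 + B2" unfolding D using B1[of e2] B2[of e1] e1 e2 by (simp add: S_def vp_def vm_def)
  finally show "int (degree N) \<le> B1 + B2" using \<open>degree N \<le> nat (B1 + B2)\<close> by linarith
qed

section \<open>The auxiliary function and the point count\<close>

lemma poly_altdef_le:
  fixes p :: "'a::comm_semiring_1 poly"
  assumes "degree p \<le> n"
  shows "poly p x = (\<Sum>i\<le>n. coeff p i * x ^ i)"
  unfolding poly_altdef using assms by (intro sum.mono_neutral_left) (auto simp: coeff_eq_0)

lemma mult_pred_add: "1 \<le> r \<Longrightarrow> p * (r - 1) + p = p * (r::nat)"
  by (cases r) auto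

lemma frobenius_fixed_power:
  assumes "(x::'a::monoid_mult) ^ p = x"
  shows "x ^ (p ^ n) = x"
  by (induction n) (simp_all add: assms power_mult)

lemma card_square_roots_le:
  "finite {x::'a::{alg_closed_field,field_prime_char}. x\<^sup>2 = v * x + u}" 
  "card {x::'a. x\<^sup>2 = v * x + u} \<le> 2"
proof -
  have eq: "{x::'a. x\<^sup>2 = v * x + u} = {x. poly [:-u, -v, 1:] x = 0}"
    by (auto simp: power2_eq_square algebra_simps)
  have nz: "[:-u, -v, 1:] \<noteq> 0" by simp
  show "finite {x::'a. x\<^sup>2 = v * x + u}" unfolding eq by (rule poly_roots_finite[OF nz])
  show "card {x::'a. x\<^sup>2 = v * x + u} \<le> 2"
    unfolding eq using card_poly_roots_bound[OF nz] by simp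
qed

lemma card_artin_schreier_le:
  "finite {y::'a::{alg_closed_field,field_prime_char}. y ^ CHAR('a) - y = v}" 
  "card {y::'a. y ^ CHAR('a) - y = v} \<le> CHAR('a)"
proof -
  have eq: "{y::'a. y ^ CHAR('a) - y = v} = {x. poly (artin_schreier - [:v:]) x = 0}"
    by (auto simp: poly_artin_schreier)
  have nz: "artin_schreier - [:v:] \<noteq> 0"
    using degree_artin_schreier_minus[of v] CHAR_ge_2[where 'a='a] by force
  show "finite {y::'a. y ^ CHAR('a) - y = v}" unfolding eq by (rule poly_roots_finite[OF nz])
  show "card {y::'a. y ^ CHAR('a) - y = v} \<le> CHAR('a)"
    unfolding eq using card_poly_roots_bound[OF nz] by (simp add: degree_artin_schreier_minus)
qed

text \<open>A dimension count. There are p^2 r (\<rho> + 1) = p (r^2 + p r) unknowns, and the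
  reduced functions have p (n + 1) coefficients, where n + 1 = r^2 + r - \<rho> + 2 p - 1 because r
  = p \<rho>. The power of x needed for the reduction does not vanish on the curve and
  cancels.\<close>

lemma frobenius_relation:
  fixes b c :: "'a::{alg_closed_field,field_prime_char}" and k :: nat
  defines "p \<equiv> CHAR('a)"
  defines "\<rho> \<equiv> p ^ k" and "r \<equiv> p ^ (k + 1)"
  defines "E \<equiv> {..<p} \<times> {..<r} \<times> {..<p} \<times> {..\<rho>}"
  assumes k: "k \<ge> 1"
  shows "\<exists>\<alpha>. (\<exists>e\<in>E. \<alpha> e \<noteq> 0) \<and> (\<forall>(x, y)\<in>curve b.
      (\<Sum>(i, j, i', j')\<in>E. \<alpha> (i, j, i', j') ^ r * (x ^ (j * r + j') * y ^ (i * r) * (y + c) ^ i')) = 0)"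
proof -
  have p: "p \<ge> 2" unfolding p_def by (rule CHAR_ge_2)
  have r: "r = p * \<rho>" by (simp add: r_def \<rho>_def)
  have pr: "p \<le> \<rho>" unfolding \<rho>_def using k p self_le_power[of p k] by simp
  define M where "M = (\<rho> + 1) * (p - 1)"
  define n where "n = (r - 1) * r + \<rho> + 2 * (\<rho> + 1) * (p - 1)"
  define F where "F = (\<lambda>(i, j, i', j') x y. x ^ M * (x ^ (j * r + j') * y ^ (i * r) * (y + c) ^ i'))"
  have red: "reducible_fun b n (F e)" if "e \<in> E" for e
  proof -
    obtain i j i' j' where e: "e = (i, j, i', j')" "i < p" "j < r" "i' < p" "j' \<le> \<rho>"
      using \<open>e \<in> E\<close> unfolding E_def by auto
    have "j * r \<le> (r - 1) * r" using e(3) by (intro mult_right_mono) auto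
    then have "j * r + j' + 2 * (\<rho> + 1) * (p - 1) \<le> n" using e(5) unfolding n_def by linarith
    with reducible_fun_monomial[of i i' b "j * r + j'" k c] e show ?thesis
      by (auto simp: F_def M_def \<rho>_def p_def r_def mult_ac intro: reducible_fun_mono)
  qed
  then have "\<exists>t. \<forall>e\<in>E. (\<forall>i. degree (t e i :: 'a poly) \<le> n) \<and>
     (\<forall>(x, y)\<in>curve b. F e x y = (\<Sum>i<p. poly (t e i) x * y ^ i))"
    unfolding reducible_fun_def p_def[symmetric] by (rule bchoice[rule_format])
  then obtain t where t: "\<And>e i. e \<in> E \<Longrightarrow> degree (t e i :: 'a poly) \<le> n"
    "\<And>e x y. e \<in> E \<Longrightarrow> (x, y) \<in> curve b \<Longrightarrow> F e x y = (\<Sum>i<p. poly (t e i) x * y ^ i)"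
    by blast
  have cE: "card E = p * (r * (p * (\<rho> + 1)))" unfolding E_def by (simp add: card_cartesian_product)
  have "n + 1 < r * (p * (\<rho> + 1))"
  proof -
    obtain P where P: "p = P + 2" using p by (metis add.commute le_Suc_ex)
    obtain R where R: "\<rho> = p + R" using pr le_Suc_ex by blast
    have rr: "(r - 1) * r + r = r * r" using mult_pred_add[of r r] r p pr by (simp add: mult.commute)
    have "n + 1 + r = r * r + \<rho> + 2 * (\<rho> + 1) * (p - 1) + 1" unfolding n_def using rr by linarith
    also have "\<dots> < r * (p * (\<rho> + 1)) + r"
      unfolding r R P by (simp add: algebra_simps)
    finally show ?thesis by simp
  qed
  then have "card ({..<p} \<times> {..n}) < card E"
    unfolding cE card_cartesian_product card_lessThan card_atMost Suc_eq_plus1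
    by (intro mult_strict_left_mono) (use p in auto)
  from homogeneous_system_nontrivial[OF _ _ this, of "\<lambda>e (i, m). coeff (t e i) m"]
  have "\<exists>\<beta>. (\<exists>e\<in>E. \<beta> e \<noteq> 0) \<and>
      (\<forall>x\<in>{..<p} \<times> {..n}. (\<Sum>e\<in>E. \<beta> e * (case x of (i, m) \<Rightarrow> coeff (t e i) m)) = 0)"
    by (simp add: E_def)
  then obtain \<beta> where \<beta>: "\<exists>e\<in>E. \<beta> e \<noteq> 0" and
      \<beta>': "\<forall>x\<in>{..<p} \<times> {..n}. (\<Sum>e\<in>E. \<beta> e * (case x of (i, m) \<Rightarrow> coeff (t e i) m)) = 0"
    by blast
  have \<beta>2: "(\<Sum>e\<in>E. \<beta> e * coeff (t e i) m) = 0" if "i < p" "m \<le> n" for i m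
    using \<beta>'[rule_format, of "(i, m)"] that by simp
  \<comment> \<open>Frobenius is surjective on an algebraically closed field, so the coefficients
    can be written as r-th powers; this lets the whole relation become an r-th power.\<close>
  have "\<exists>z. z ^ r = \<beta> e" for e by (rule nth_root_exists) (use r p pr in simp)
  then obtain \<alpha> where \<alpha>: "\<And>e. \<alpha> e ^ r = \<beta> e" by metis
  have "(\<Sum>(i, j, i', j')\<in>E. \<alpha> (i, j, i', j') ^ r * (x ^ (j * r + j') * y ^ (i * r) * (y + c) ^ i')) = 0"
    if xy: "(x, y) \<in> curve b" for x y
  proof -
    have "x ^ M * (\<Sum>(i, j, i', j')\<in>E. \<alpha> (i, j, i', j') ^ r * (x ^ (j * r + j') * y ^ (i * r) * (y + c) ^ i'))
       = (\<Sum>e\<in>E. \<beta> e * F e x y)"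
      unfolding sum_distrib_left by (intro sum.cong) (auto simp: F_def \<alpha> mult_ac)
    also have "\<dots> = (\<Sum>e\<in>E. \<beta> e * (\<Sum>i<p. (\<Sum>m\<le>n. coeff (t e i) m * x ^ m) * y ^ i))"
      by (intro sum.cong refl) (simp add: t(2)[OF _ xy] poly_altdef_le[OF t(1)])
    also have "\<dots> = (\<Sum>e\<in>E. \<Sum>i<p. \<Sum>m\<le>n. \<beta> e * coeff (t e i) m * (x ^ m * y ^ i))"
      by (simp add: sum_distrib_left sum_distrib_right mult_ac)
    also have "\<dots> = (\<Sum>i<p. \<Sum>e\<in>E. \<Sum>m\<le>n. \<beta> e * coeff (t e i) m * (x ^ m * y ^ i))"
      by (rule sum.swap)
    also have "\<dots> = (\<Sum>i<p. \<Sum>m\<le>n. \<Sum>e\<in>E. \<beta> e * coeff (t e i) m * (x ^ m * y ^ i))"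
      by (intro sum.cong refl sum.swap)
    also have "\<dots> = 0"
      unfolding sum_distrib_right[symmetric] by (intro sum.neutral ballI) (simp add: \<beta>2)
    finally show ?thesis using xy by (simp add: curve_def)
  qed
  moreover have "\<exists>e\<in>E. \<alpha> e \<noteq> 0"
  proof -
    obtain e where "e \<in> E" "\<beta> e \<noteq> 0" using \<beta> by blast
    moreover from this \<alpha>[of e] have "\<alpha> e \<noteq> 0" using r p pr by (cases "\<alpha> e = 0") (auto simp: power_0_left)
    ultimately show ?thesis by blast
  qed
  ultimately show ?thesis by blast
qed

lemma base_expansion_unique:
  fixes s u v u' v' :: int
  assumes "u + s * v = u' + s * v'" "\<bar>u - u'\<bar> < s"
  shows "u = u' \<and> v = v'"
proof -
  have "s * (v' - v) = u - u'" using assms(1) by (simp add: algebra_simps)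
  with assms(2) have "\<bar>s * (v' - v)\<bar> < s * 1" "s > 0" by auto
  then have "\<bar>v' - v\<bar> < 1" by (simp add: abs_mult)
  then show ?thesis using assms by simp
qed

text \<open>On \<open>Z\<close>, \<open>x = x\<^bsup>rs\<^esup>\<close> and \<open>y + c = y\<^bsup>rs\<^esup>\<close> turn the relation of \<open>frobenius_relation\<close> into an
  \<open>r\<close>-th power. Its root has a norm of low degree in \<open>y\<close>. As \<open>Z\<close> is stable under \<open>x \<mapsto> b / x\<close>, a point with \<open>x\<^sup>2 \<noteq> b\<close> gives
  a double zero of this norm.\<close>

lemma stepanov_bound:
  fixes b c :: "'a::{alg_closed_field,field_prime_char}" and k :: nat
  defines "p \<equiv> CHAR('a)"
  defines "q \<equiv> p ^ (2 * k + 3)"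
  assumes k: "k \<ge> 1" and b: "b \<noteq> 0" "b ^ p = b"
  defines "Z \<equiv> {(x, y) \<in> curve b. x ^ q = x \<and> y ^ q = y + c}"
  shows "finite Z" "card Z \<le> q + 3 * p ^ (k + 3)"
proof -
  define \<rho> where "\<rho> = p ^ k"
  define r where "r = p ^ (k + 1)"
  define s where "s = p ^ (k + 2)"
  define E where "E = {..<p} \<times> {..<r} \<times> {..<p} \<times> {..\<rho>}"
  have p: "p \<ge> 2" unfolding p_def by (rule CHAR_ge_2)
  have rs: "r = p * \<rho>" "s = p * r" by (simp_all add: r_def \<rho>_def s_def)
  have pos: "\<rho> \<ge> 1" "r \<ge> 1" "s \<ge> 1" using p by (simp_all add: \<rho>_def r_def s_def)
  have q: "q = r * s" unfolding q_def r_def s_def power_add[symmetric] by (rule arg_cong[where f = "\<lambda>n. p ^ n"]) simp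
  obtain \<alpha> where \<alpha>0: "\<exists>e\<in>E. \<alpha> e \<noteq> 0" and \<alpha>: "\<And>x y. (x, y) \<in> curve b \<Longrightarrow>
      (\<Sum>(i, j, i', j')\<in>E. \<alpha> (i, j, i', j') ^ r * (x ^ (j * r + j') * y ^ (i * r) * (y + c) ^ i')) = 0"
    using frobenius_relation[OF k, where b=b and c=c] unfolding E_def r_def \<rho>_def p_def by fast
  \<comment> \<open>As r s = q, the r-th powers of x^(j + s j') and y^(i + s i') are x^(j r + j')
    and y^(i r) (y + c)^i' at the points of \<open>Z\<close>.\<close>
  define A where "A = (\<lambda>(i::nat, j, i'::nat, j'). j + s * j')"
  define K where "K = (\<lambda>(i, j::nat, i', j'::nat). i + s * i')"
  define P where "P = (\<Sum>e\<in>E. smult (\<alpha> e) (monom 1 (K e) * xU b (A e)))"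
  define Q where "Q = (\<Sum>e\<in>E. smult (\<alpha> e) (monom 1 (K e) * xW b (A e)))"
  define N where "N = P * P + artin_schreier * P * Q + smult b (Q * Q)"
  have finE: "finite E" by (simp add: E_def)
  \<comment> \<open>K + p A has the nested expansion (i + p j) + s (i' + p j') with i + p j < s and
    i, i' < p.\<close>
  have inj1: "inj_on (\<lambda>e. K e + p * A e) E"
  proof (rule inj_onI)
    fix e f
    assume ef: "e \<in> E" "f \<in> E" "K e + p * A e = K f + p * A f"
    obtain i1 j1 i1' j1' where e1: "e = (i1, j1, i1', j1')" by (cases e)
    obtain i2 j2 i2' j2' where e2: "f = (i2, j2, i2', j2')" by (cases f)
    note e = ef[unfolded e1 e2]
    have less: "i + p * j < s" if "i < p" "j < r" for i j
    proof -
      have "p * j \<le> p * (r - 1)" using that by (intro mult_left_mono) auto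
      also have "p * (r - 1) + p = s" using mult_pred_add[of r p] pos rs by simp
      then have "p * (r - 1) = s - p" by simp
      finally show ?thesis using that \<open>p * (r - 1) + p = s\<close> by linarith
    qed
    have l: "i1 + p * j1 < s" "i2 + p * j2 < s" using less e by (auto simp: E_def)
    have "(i1 + p * j1) + s * (i1' + p * j1') = (i2 + p * j2) + s * (i2' + p * j2')"
      using e(3) by (simp add: K_def A_def algebra_simps)
    then have "int (i1 + p * j1) + int s * int (i1' + p * j1') = int (i2 + p * j2) + int s * int (i2' + p * j2')"
      by (metis of_nat_add of_nat_mult)
    then have "int (i1 + p * j1) = int (i2 + p * j2) \<and> int (i1' + p * j1') = int (i2' + p * j2')"
      by (rule base_expansion_unique) (use l in linarith)
    then have *: "int i1 + int p * int j1 = int i2 + int p * int j2" "int i1' + int p * int j1' = int i2' + int p * int j2'"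
      by simp_all
    have "int i1 = int i2 \<and> int j1 = int j2" by (rule base_expansion_unique[OF *(1)]) (use e in \<open>auto simp: E_def\<close>)
    moreover have "int i1' = int i2' \<and> int j1' = int j2'" by (rule base_expansion_unique[OF *(2)]) (use e in \<open>auto simp: E_def\<close>)
    ultimately show "e = f" by (simp add: e1 e2)
  qed
  \<comment> \<open>Now the lower digit is i - p j. As p r = s, it runs through s consecutive
    integers, so the expansion is still unique.\<close>
  have inj2: "inj_on (\<lambda>e. int (K e) - int (p * A e)) E"
  proof (rule inj_onI)
    fix e f
    assume ef: "e \<in> E" "f \<in> E" "int (K e) - int (p * A e) = int (K f) - int (p * A f)"
    obtain i1 j1 i1' j1' where e1: "e = (i1, j1, i1', j1')" by (cases e)
    obtain i2 j2 i2' j2' where e2: "f = (i2, j2, i2', j2')" by (cases f)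
    note e = ef[unfolded e1 e2]
    have "p * j < s - p + 1" if "j < r" for j
    proof -
      have "p * j \<le> p * (r - 1)" using that by (intro mult_left_mono) auto
      moreover have "p * (r - 1) + p = s" using mult_pred_add[of r p] pos rs by simp
      ultimately show ?thesis by linarith
    qed
    note less = this[of j1] this[of j2]
    have ps: "p \<le> s" using rs pos by simp
    have less': "p * j1 + p \<le> s" "p * j2 + p \<le> s" "i1 < p" "i2 < p" using less e ps by (auto simp: E_def)
    have "int (p * j1 + p) \<le> int s" "int (p * j2 + p) \<le> int s"
      using less' unfolding of_nat_le_iff by auto
    then have less'': "int (p * j1) + int p \<le> int s" "int (p * j2) + int p \<le> int s"
      unfolding of_nat_add by auto
    have "(int i1 - int (p * j1)) + int s * (int i1' - int p * int j1') = (int i2 - int (p * j2)) + int s * (int i2' - int p * int j2')"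
      using e(3) by (simp add: K_def A_def algebra_simps)
    then have "int i1 - int (p * j1) = int i2 - int (p * j2) \<and> int i1' - int p * int j1' = int i2' - int p * int j2'"
      by (rule base_expansion_unique) (use less'' less' in linarith)
    then have *: "int i1 + int p * (- int j1) = int i2 + int p * (- int j2)" "int i1' + int p * (- int j1') = int i2' + int p * (- int j2')"
      by simp_all
    have "int i1 = int i2 \<and> - int j1 = - int j2" by (rule base_expansion_unique[OF *(1)]) (use e in \<open>auto simp: E_def\<close>)
    moreover have "int i1' = int i2' \<and> - int j1' = - int j2'" by (rule base_expansion_unique[OF *(2)]) (use e in \<open>auto simp: E_def\<close>)
    ultimately show "e = f" by (simp add: e1 e2)
  qed
  have B2: "int (K e) - int (p * A e) \<le> int ((p - 1) * (1 + s))" if "e \<in> E" for e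
  proof -
    obtain i j i' j' where e: "e = (i, j, i', j')" "i < p" "i' < p" using \<open>e \<in> E\<close> unfolding E_def by auto
    have "s * i' \<le> s * (p - 1)" using e by (intro mult_left_mono) auto
    moreover have "(p - 1) * (1 + s) = (p - 1) + s * (p - 1)" by (simp only: distrib_left mult_1_right mult.commute)
    moreover have "K e = i + s * i'" by (simp add: K_def e)
    ultimately have "K e \<le> (p - 1) * (1 + s)" using e(2) by linarith
    then show ?thesis by linarith
  qed
  have B1: "int (K e + p * A e) \<le> int ((p - 1 + p * (r - 1)) + s * (p - 1 + p * \<rho>))" if "e \<in> E" for e
  proof -
    obtain i j i' j' where e: "e = (i, j, i', j')" "i < p" "i' < p" "j < r" "j' \<le> \<rho>" using \<open>e \<in> E\<close> unfolding E_def by auto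
    have "i + p * j \<le> p - 1 + p * (r - 1)" using e by (intro add_mono mult_left_mono) auto
    moreover have "s * (i' + p * j') \<le> s * (p - 1 + p * \<rho>)" using e by (intro mult_left_mono add_mono) auto
    ultimately have "K e + p * A e \<le> (p - 1 + p * (r - 1)) + s * (p - 1 + p * \<rho>)"
      by (simp add: e(1) K_def A_def algebra_simps)
    then show ?thesis by linarith
  qed
  note np = norm_poly[OF finE b(1) \<alpha>0 inj1[unfolded p_def] inj2[unfolded p_def] B1[unfolded p_def] B2[unfolded p_def],
     folded P_def Q_def, folded N_def, folded p_def]
  have N0: "N \<noteq> 0" by (rule np(1))
  \<comment> \<open>The main term is s p \<rho> = s r = q, from the largest j', and it occurs
    once.\<close>
  have degN: "degree N \<le> q + 2 * p ^ (k + 3)"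
  proof -
    have "degree N \<le> (p - 1 + p * (r - 1)) + s * (p - 1 + p * \<rho>) + (p - 1) * (1 + s)"
      using np(2) by linarith
    also have "\<dots> \<le> q + 2 * (p * s)"
    proof -
      have "p * (r - 1) + p = s" using mult_pred_add[of r p] pos rs by simp
      moreover have "s * (p - 1 + p * \<rho>) + s = s * p + q" using p by (cases p) (auto simp: q rs algebra_simps)
      moreover have "(p - 1) * (1 + s) + (1 + s) = p + p * s" using p by (cases p) (auto simp: algebra_simps)
      moreover have "p \<le> s" using rs pos by simp
      ultimately show ?thesis using p by (simp add: mult.commute)
    qed
    also have "p * s = p ^ (k + 3)" by (simp add: s_def power_add power3_eq_cube power2_eq_square)
    finally show ?thesis .
  qed
  have prime: "prime CHAR('a)" by (rule prime_CHAR)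
  have eval: "(\<Sum>e\<in>E. \<alpha> e * (x ^ A e * y ^ K e)) = poly P y + poly Q y * x" if "(x, y) \<in> curve b" for x y
  proof -
    have "x\<^sup>2 = poly artin_schreier y * x - b"
      using that by (auto simp: curve_def poly_artin_schreier field_simps power2_eq_square)
    then have pw: "x ^ n = poly (xU b n) y + poly (xW b n) y * x" for n by (rule power_eq_xU_xW)
    show ?thesis unfolding P_def Q_def poly_sum sum_distrib_right sum.distrib[symmetric]
      by (intro sum.cong refl) (subst pw, simp add: poly_monom algebra_simps)
  qed
  have zero: "poly P y + poly Q y * x = 0" if "(x, y) \<in> Z" for x y
  proof -
    from that have xy: "(x, y) \<in> curve b" "x ^ q = x" "y ^ q = y + c" by (auto simp: Z_def)
    have "(\<Sum>e\<in>E. \<alpha> e * (x ^ A e * y ^ K e)) ^ r = (\<Sum>e\<in>E. (\<alpha> e * (x ^ A e * y ^ K e)) ^ r)"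
      using freshmans_dream_sum'[of r "k + 1" "\<lambda>e. \<alpha> e * (x ^ A e * y ^ K e)" E] prime
      by (simp add: r_def p_def)
    also have "\<dots> = (\<Sum>(i, j, i', j')\<in>E. \<alpha> (i, j, i', j') ^ r * (x ^ (j * r + j') * y ^ (i * r) * (y + c) ^ i'))"
    proof (intro sum.cong refl, clarify)
      fix i j i' j'
      have "(x ^ A (i, j, i', j')) ^ r = x ^ (j * r) * (x ^ q) ^ j'"
        by (simp add: A_def q algebra_simps flip: power_add power_mult)
      moreover have "(y ^ K (i, j, i', j')) ^ r = y ^ (i * r) * (y ^ q) ^ i'"
        by (simp add: K_def q algebra_simps flip: power_add power_mult)
      ultimately show "(\<alpha> (i, j, i', j') * (x ^ A (i, j, i', j') * y ^ K (i, j, i', j'))) ^ r =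
         \<alpha> (i, j, i', j') ^ r * (x ^ (j * r + j') * y ^ (i * r) * (y + c) ^ i')"
        by (simp add: power_mult_distrib xy power_add mult_ac)
    qed
    also have "\<dots> = 0" by (rule \<alpha>[OF xy(1)])
    finally show ?thesis using eval[OF xy(1)] pos by simp
  qed
  have bq: "b ^ q = b" unfolding q_def by (rule frobenius_fixed_power[OF b(2)])
  have inv: "(b / x, y) \<in> Z" if "(x, y) \<in> Z" for x y
    using that b bq by (auto simp: Z_def curve_def power_divide add.commute)
  define Z1 where "Z1 = {(x, y) \<in> Z. x\<^sup>2 \<noteq> b}"
  define Y where "Y = snd ` Z1"
  have root: "[:-y, 1:] ^ 2 dvd N" if "y \<in> Y" for y
  proof -
    obtain x where xy: "(x, y) \<in> Z" "x\<^sup>2 \<noteq> b" using \<open>y \<in> Y\<close> by (auto simp: Y_def Z1_def)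
    have x0: "x \<noteq> 0" using xy by (auto simp: Z_def curve_def)
    \<comment> \<open>P + Q x vanishes at x and at b / x, which differ, so P and Q both vanish at
      y.\<close>
    have "poly Q y * (x - b / x) = 0" using zero[OF xy(1)] zero[OF inv[OF xy(1)]] by (simp add: algebra_simps add_eq_0_iff2)
    moreover have "x - b / x \<noteq> 0" using xy(2) x0 by (simp add: field_simps power2_eq_square)
    ultimately have "poly Q y = 0" by simp
    moreover from this have "poly P y = 0" using zero[OF xy(1)] by simp
    ultimately have "[:-y, 1:] dvd P" "[:-y, 1:] dvd Q" by (simp_all add: poly_eq_0_iff_dvd)
    then obtain P' Q' where P': "P = [:-y, 1:] * P'" and Q': "Q = [:-y, 1:] * Q'" by (elim dvdE) blast
    define l where "l = [:-y, 1:]"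
    define B where "B = [:b:]"
    have B: "smult b h = B * h" for h by (simp add: B_def)
    have "N = l\<^sup>2 * (P' * P' + artin_schreier * P' * Q' + B * (Q' * Q'))"
      unfolding N_def P' Q' l_def[symmetric] B by (simp add: algebra_simps power2_eq_square)
    then have "N = [:-y, 1:]\<^sup>2 * (P' * P' + artin_schreier * P' * Q' + B * (Q' * Q'))"
      unfolding l_def .
    then show ?thesis by (rule dvdI)
  qed
  have ord: "order y N \<ge> 2" if "y \<in> Y" for y
    using root[OF that] N0 order_max by blast
  have Yroots: "Y \<subseteq> {y. poly N y = 0}"
  proof
    fix y assume "y \<in> Y"
    then have "[:-y, 1:] dvd N" using root[of y] unfolding power2_eq_square by (rule_tac dvd_mult_left)
    then show "y \<in> {y. poly N y = 0}" by (simp add: poly_eq_0_iff_dvd)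
  qed
  have finY: "finite Y" using Yroots poly_roots_finite[OF N0] finite_subset by blast
  \<comment> \<open>Every y in \<open>Y\<close> takes two from the degree of \<open>N\<close> and
    carries at most two points. The factors cancel, which keeps the main term at exactly q; a larger
    multiple would be useless in \<open>kloosterman_ext_bound\<close>.\<close>
  have "2 * card Y = (\<Sum>y\<in>Y. 2)" by simp
  also have "\<dots> \<le> (\<Sum>y\<in>Y. order y N)" using ord by (intro sum_mono) auto
  also have "\<dots> \<le> (\<Sum>y | poly N y = 0. order y N)"
    using Yroots poly_roots_finite[OF N0] by (intro sum_mono2) auto
  also have "\<dots> \<le> degree N" by (rule sum_order_le_degree[OF N0])
  finally have cardY: "2 * card Y \<le> degree N" .
  define S1 where "S1 = (SIGMA y:Y. {x. x\<^sup>2 = (y ^ p - y) * x + (- b)})"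
  have finS1: "finite S1" unfolding S1_def by (intro finite_SigmaI finY card_square_roots_le(1))
  have sub1: "Z1 \<subseteq> (\<lambda>(y, x). (x, y)) ` S1"
  proof clarify
    fix x y assume "(x, y) \<in> Z1"
    then have xy: "y \<in> Y" "x \<noteq> 0" "x + b / x = y ^ p - y" by (force simp: Y_def Z1_def Z_def curve_def p_def)+
    have "(y ^ p - y) * x = x * x + b" unfolding xy(3)[symmetric] using xy(2) by (simp add: field_simps)
    then have "(y, x) \<in> S1" using xy(1) by (simp add: S1_def power2_eq_square)
    then show "(x, y) \<in> (\<lambda>(y, x). (x, y)) ` S1" by force
  qed
  have "card S1 = (\<Sum>y\<in>Y. card {x. x\<^sup>2 = (y ^ p - y) * x + (- b)})"
    unfolding S1_def by (rule card_SigmaI[OF finY]) (intro ballI card_square_roots_le(1))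
  also have "\<dots> \<le> (\<Sum>y\<in>Y. 2)" by (intro sum_mono card_square_roots_le)
  finally have cS1: "card S1 \<le> 2 * card Y" by simp
  have c1: "card Z1 \<le> degree N" "finite Z1"
    using card_mono[OF finite_imageI[OF finS1] sub1] card_image_le[OF finS1, of "\<lambda>(y, x). (x, y)"] cS1 cardY
      finite_subset[OF sub1 finite_imageI[OF finS1]] by auto
  \<comment> \<open>The fixed points of x \<mapsto> b / x yield no double zero, but at most 2 p
    points lie above them.\<close>
  define S2 where "S2 = (SIGMA x:{x. x\<^sup>2 = 0 * x + b}. {y. y ^ CHAR('a) - y = x + b / x})"
  have finS2: "finite S2" unfolding S2_def by (intro finite_SigmaI card_artin_schreier_le(1) card_square_roots_le(1))
  have "card S2 = (\<Sum>x\<in>{x. x\<^sup>2 = 0 * x + b}. card {y. y ^ CHAR('a) - y = x + b / x})"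
    unfolding S2_def by (rule card_SigmaI[OF card_square_roots_le(1)]) (intro ballI card_artin_schreier_le(1))
  also have "\<dots> \<le> (\<Sum>x\<in>{x. x\<^sup>2 = 0 * x + b}. p)" unfolding p_def by (intro sum_mono card_artin_schreier_le)
  also have "\<dots> \<le> 2 * p" using card_square_roots_le(2)[of 0 b] by simp
  finally have cS2: "card S2 \<le> 2 * p" .
  have Z: "Z \<subseteq> Z1 \<union> S2" by (auto simp: Z1_def S2_def Z_def curve_def)
  show "finite Z" using Z c1(2) finS2 finite_subset by blast
  have "card Z \<le> card (Z1 \<union> S2)" using Z c1(2) finS2 by (intro card_mono) auto
  also have "\<dots> \<le> card Z1 + card S2" by (rule card_Un_le)
  also have "\<dots> \<le> q + 2 * p ^ (k + 3) + 2 * p" using c1 cS2 degN by linarith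
  also have "2 * p \<le> p ^ (k + 3)"
  proof -
    have "2 * p \<le> p * p" using p by simp
    also have "\<dots> = p ^ 2" by (simp add: power2_eq_square)
    also have "\<dots> \<le> p ^ (k + 3)" using p by (intro power_increasing) auto
    finally show ?thesis .
  qed
  finally show "card Z \<le> q + 3 * p ^ (k + 3)" by simp
qed

section \<open>Finite fields inside an algebraically closed field, traces and characters\<close>

definition frob_fixed :: "nat \<Rightarrow> 'a::{alg_closed_field,field_prime_char} set" where
  "frob_fixed n = {x. x ^ (CHAR('a) ^ n) = x}"

text \<open>On \<open>frob_fixed n\<close>, the field with p^n elements for n \<ge> 1, this is the
  trace to the prime field. Fixed points of Frobenius keep all the extensions inside one
  type.\<close>

definition frob_trace :: "nat \<Rightarrow> 'a::{alg_closed_field,field_prime_char} \<Rightarrow> 'a" where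
  "frob_trace n v = (\<Sum>i<n. v ^ (CHAR('a) ^ i))"

lemma frobenius_add: "((x::'a::field_prime_char) + y) ^ (CHAR('a) ^ n) = x ^ (CHAR('a) ^ n) + y ^ (CHAR('a) ^ n)"
  by (rule freshmans_dream'[OF prime_CHAR refl])

lemma frobenius_diff: "((x::'a::field_prime_char) - y) ^ (CHAR('a) ^ n) = x ^ (CHAR('a) ^ n) - y ^ (CHAR('a) ^ n)"
  using frobenius_add[of "x - y" y n] by simp

lemma frobenius_inj: "(x::'a::field_prime_char) ^ (CHAR('a) ^ n) = y ^ (CHAR('a) ^ n) \<Longrightarrow> x = y"
  using frobenius_diff[of x y n] by simp

lemma frob_fixed_arith:
  fixes x y :: "'a::{alg_closed_field,field_prime_char}"
  shows
  "x \<in> frob_fixed n \<Longrightarrow> y \<in> frob_fixed n \<Longrightarrow> x + y \<in> frob_fixed n"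
  "x \<in> frob_fixed n \<Longrightarrow> y \<in> frob_fixed n \<Longrightarrow> x * y \<in> frob_fixed n"
  "x \<in> frob_fixed n \<Longrightarrow> y \<in> frob_fixed n \<Longrightarrow> x / y \<in> frob_fixed n"
  "x \<in> frob_fixed n \<Longrightarrow> y \<in> frob_fixed n \<Longrightarrow> x - y \<in> frob_fixed n"
  "x \<in> frob_fixed n \<Longrightarrow> - x \<in> frob_fixed n"
  "(0::'a) \<in> frob_fixed n" "(1::'a) \<in> frob_fixed n"
  "x \<in> frob_fixed 1 \<Longrightarrow> x \<in> frob_fixed n"
  using frobenius_diff[of 0 x n]
  by (auto simp: frob_fixed_def frobenius_add frobenius_diff power_mult_distrib power_divide frobenius_fixed_power power_0_left)

lemma proots_linear_prod: "proots (\<Prod>x\<in>#A. [:-x, 1::'a::idom:]) = A"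
proof (induction A)
  case (add x A)
  have "(\<Prod>x\<in>#A. [:-x, 1:]) \<noteq> 0" by (auto simp: prod_mset_zero_iff)
  then show ?case by (simp only: image_mset_add_mset prod_mset.add_mset, subst proots_mult) (auto simp: add)
qed simp

text \<open>The derivative of X^q - X is the constant -1, because q vanishes in the field; so all q
  roots are simple.\<close>

lemma card_frob_fixed:
  assumes "n \<ge> 1"
  shows "finite (frob_fixed n :: 'a::{alg_closed_field,field_prime_char} set)"
    and "card (frob_fixed n :: 'a set) = CHAR('a) ^ n"
proof -
  define q where "q = CHAR('a) ^ n"
  define P where "P = monom (1::'a) q - [:0, 1:]"
  have q: "q \<ge> 2" using self_le_power[of "CHAR('a)" n] CHAR_ge_2[where 'a='a] assms unfolding q_def by linarith
  define D where "D = [:0, 1::'a:]"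
  have "degree (monom (1::'a) q + (- D)) = degree (monom (1::'a) q)"
    by (rule degree_add_eq_left) (use q in \<open>simp add: degree_monom_eq D_def\<close>)
  then have deg: "degree P = q" by (simp add: P_def degree_monom_eq flip: D_def)
  then have nz: "P \<noteq> 0" using q by auto
  have eq: "frob_fixed n = {x. poly P x = 0}"
    by (auto simp: frob_fixed_def P_def poly_monom q_def)
  show "finite (frob_fixed n :: 'a set)" unfolding eq by (rule poly_roots_finite[OF nz])
  have "(of_nat q :: 'a) = 0" using assms by (simp add: q_def power_0_left)
  then have "poly (pderiv P) x = - 1" for x
    by (simp add: P_def pderiv_diff pderiv_monom pderiv_pCons)
  then have ord: "order x P < 2" for x
  proof (rule_tac ccontr)
    assume "\<not> order x P < 2"
    then have "[:-x, 1:]\<^sup>2 dvd P" using nz by (simp add: order_divides)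
    then obtain h where "P = [:-x, 1:]\<^sup>2 * h" by (rule dvdE)
    moreover define l where "l = [:-x, 1:]"
    ultimately have "P = l * (l * h)" by (simp only: power2_eq_square mult.assoc)
    moreover have "poly l x = 0" by (simp add: l_def)
    ultimately have "poly (pderiv P) x = 0" by (simp add: pderiv_mult)
    with \<open>\<And>x. poly (pderiv P) x = - 1\<close> show False by simp
  qed
  obtain A where A: "size A = degree P" "P = smult (lead_coeff P) (\<Prod>x\<in>#A. [:-x, 1:])"
    using alg_closed_imp_factorization[OF nz] by blast
  have pr: "proots P = A" using nz by (subst A(2), subst proots_smult) (auto simp: proots_linear_prod)
  have cnt: "count A x \<le> 1" for x
    using ord[of x] nz unfolding pr[symmetric] by simp
  have "size A = (\<Sum>x\<in>set_mset A. count A x)" by (rule size_multiset_overloaded_eq)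
  also have "\<dots> \<le> (\<Sum>x\<in>set_mset A. 1)" by (intro sum_mono cnt)
  finally have "q \<le> card {x. poly P x = 0}" using A(1) deg pr nz by (metis card_eq_sum set_count_proots)
  moreover have "card {x. poly P x = 0} \<le> q" using card_poly_roots_bound[OF nz] deg by simp
  ultimately show "card (frob_fixed n :: 'a set) = CHAR('a) ^ n" unfolding eq q_def by simp
qed

lemma frob_trace_telescope:
  fixes y :: "'a::{alg_closed_field,field_prime_char}"
  shows "frob_trace n (y ^ CHAR('a) - y) = y ^ (CHAR('a) ^ n) - y"
proof -
  have "frob_trace n (y ^ CHAR('a) - y) = (\<Sum>i<n. y ^ (CHAR('a) ^ Suc i) - y ^ (CHAR('a) ^ i))"
    unfolding frob_trace_def by (intro sum.cong) (simp_all add: frobenius_diff flip: power_mult)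
  then show ?thesis using sum_lessThan_telescope[of "\<lambda>i. y ^ (CHAR('a) ^ i)" n] by simp
qed

lemma frob_trace_in_prime_field:
  fixes v :: "'a::{alg_closed_field,field_prime_char}"
  assumes "v \<in> frob_fixed n"
  shows "frob_trace n v \<in> frob_fixed 1"
proof -
  have "frob_trace n v ^ CHAR('a) = (\<Sum>i<n. (v ^ (CHAR('a) ^ i)) ^ CHAR('a))"
    unfolding frob_trace_def by (rule freshmans_dream_sum[OF prime_CHAR refl])
  also have "\<dots> - frob_trace n v = (\<Sum>i<n. v ^ (CHAR('a) ^ Suc i) - v ^ (CHAR('a) ^ i))"
    unfolding frob_trace_def sum_subtractf[symmetric]
    by (intro sum.cong) (simp_all add: mult.commute flip: power_mult)
  also have "\<dots> = 0" using sum_lessThan_telescope[of "\<lambda>i. v ^ (CHAR('a) ^ i)" n] assms by (simp add: frob_fixed_def)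
  finally show ?thesis by (simp add: frob_fixed_def)
qed

text \<open>Only the values on the prime field are constrained, since the character is evaluated at
  traces, which lie there.\<close>

definition add_char :: "('a::{alg_closed_field,field_prime_char} \<Rightarrow> complex) \<Rightarrow> bool" where
  "add_char \<psi> \<longleftrightarrow> (\<forall>x\<in>frob_fixed 1. \<forall>y\<in>frob_fixed 1. \<psi> (x + y) = \<psi> x * \<psi> y) \<and>
     (\<forall>x\<in>frob_fixed 1. norm (\<psi> x) = 1) \<and> (\<exists>x\<in>frob_fixed 1. \<psi> x \<noteq> 1)"

lemma add_char_sum_zero:
  assumes "add_char \<psi>" "c \<in> frob_fixed 1" "c \<noteq> 0"
  shows "(\<Sum>x\<in>frob_fixed 1. \<psi> (c * x)) = 0"
proof -
  from assms obtain z where z: "z \<in> frob_fixed 1" "\<psi> z \<noteq> 1" by (auto simp: add_char_def)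
  define y where "y = z / c"
  have y: "y \<in> frob_fixed 1" "c * y = z" using z assms frob_fixed_arith by (auto simp: y_def)
  have "(\<Sum>x\<in>frob_fixed 1. \<psi> (c * x)) = (\<Sum>x\<in>frob_fixed 1. \<psi> (c * (x + y)))"
    by (rule sum.reindex_bij_witness[of _ "\<lambda>x. x + y" "\<lambda>x. x - y"]) (use y frob_fixed_arith in auto)
  also have "\<dots> = (\<Sum>x\<in>frob_fixed 1. \<psi> (c * x) * \<psi> z)"
  proof (intro sum.cong refl)
    fix x :: 'a assume "x \<in> frob_fixed 1"
    then have "c * x \<in> frob_fixed 1" using assms(2) by (rule frob_fixed_arith(2)[rotated])
    then show "\<psi> (c * (x + y)) = \<psi> (c * x) * \<psi> z"
      using assms(1) z(1) unfolding add_char_def distrib_left y(2) by blast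
  qed
  also have "\<dots> = (\<Sum>x\<in>frob_fixed 1. \<psi> (c * x)) * \<psi> z" by (simp add: sum_distrib_right)
  finally show ?thesis using z by simp
qed

lemma add_char_0:
  assumes "add_char \<psi>"
  shows "\<psi> 0 = 1"
proof -
  have "\<psi> (0 + 0) = \<psi> 0 * \<psi> 0" "norm (\<psi> 0) = 1" using assms frob_fixed_arith(6)[of 1] unfolding add_char_def by blast+
  then show ?thesis by auto
qed

definition kloosterman_ext :: "('a::{alg_closed_field,field_prime_char} \<Rightarrow> complex) \<Rightarrow> 'a \<Rightarrow> nat \<Rightarrow> complex" where
  "kloosterman_ext \<psi> b n = (\<Sum>x\<in>frob_fixed n - {0}. \<psi> (frob_trace n (x + b / x)))"

text \<open>Over each x of the fibre lie the p points (x, y0 + t) with t in the prime field, and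
  telescoping the trace gives y^(p^n) = y + c for all of them. So p copies of the fibre embed into
  the set of \<open>stepanov_bound\<close>.\<close>

lemma card_trace_fibre_le:
  fixes b c :: "'a::{alg_closed_field,field_prime_char}" and k :: nat
  defines "p \<equiv> CHAR('a)" and "n \<equiv> 2 * k + 3"
  assumes "k \<ge> 1" "b \<noteq> 0" "b \<in> frob_fixed 1"
  shows "p * card {x \<in> frob_fixed n - {0}. frob_trace n (x + b / x) = c} \<le> p ^ n + 3 * p ^ (k + 3)"
proof -
  define D where "D = {x \<in> frob_fixed n - {0}. frob_trace n (x + b / x) = c}"
  define Z where "Z = {(x, y) \<in> curve b. x ^ (p ^ n) = x \<and> y ^ (p ^ n) = y + c}"
  have bp: "b ^ p = b" using assms by (simp add: frob_fixed_def)
  have Z: "finite Z" "card Z \<le> p ^ n + 3 * p ^ (k + 3)"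
    using stepanov_bound[of k b c] assms bp unfolding Z_def n_def p_def by auto
  have "\<exists>y. y ^ p - y = x + b / x" for x
  proof -
    have "degree (artin_schreier - [:x + b / x:]) > 0"
      using CHAR_ge_2[where 'a='a] by (simp only: degree_artin_schreier_minus)
    then obtain y where "poly (artin_schreier - [:x + b / x:]) y = 0"
      using alg_closed_imp_poly_has_root by blast
    then show ?thesis by (auto simp: poly_artin_schreier p_def)
  qed
  then obtain y0 where y0: "\<And>x. y0 x ^ p - y0 x = x + b / x" by metis
  define f where "f = (\<lambda>(x, t::'a). (x, y0 x + t))"
  have "inj_on f (D \<times> frob_fixed 1)" by (auto simp: inj_on_def f_def)
  moreover have "f ` (D \<times> frob_fixed 1) \<subseteq> Z"
  proof
    fix z assume "z \<in> f ` (D \<times> frob_fixed 1)"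
    then obtain x t where z: "z = f (x, t)" and "x \<in> D" "t \<in> frob_fixed 1" by auto
    then have xt: "x \<noteq> 0" "x ^ (p ^ n) = x" "frob_trace n (x + b / x) = c" "t ^ p = t" "t ^ (p ^ n) = t"
      using frob_fixed_arith(8)[of t n] by (auto simp: D_def frob_fixed_def p_def)
    have "(y0 x + t) ^ p - (y0 x + t) = x + b / x"
      using frobenius_add[of "y0 x" t 1] y0[of x] xt by (simp add: p_def)
    moreover have "y0 x ^ (p ^ n) - y0 x = c"
      using frob_trace_telescope[of n "y0 x"] y0[of x] xt by (simp add: p_def)
    then have "(y0 x + t) ^ (p ^ n) = y0 x + t + c"
      using frobenius_add[of "y0 x" t n] xt by (simp add: p_def algebra_simps)
    ultimately show "z \<in> Z" unfolding z using xt by (simp add: f_def Z_def curve_def p_def)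
  qed
  ultimately have "card (D \<times> (frob_fixed 1 :: 'a set)) \<le> card Z" using Z(1) by (metis card_inj_on_le)
  moreover have "card (frob_fixed 1 :: 'a set) = p" using card_frob_fixed(2)[where 'a='a and n=1] by (simp add: p_def)
  ultimately have "card D * p \<le> card Z" by (simp only: card_cartesian_product)
  then show ?thesis using Z(2) unfolding D_def by (simp only: mult.commute)
qed

text \<open>An upper bound M for each fibre is enough. As \<open>\<psi>\<close> sums to zero over
  the prime field, M can be subtracted from all the fibre sizes; the differences have constant sign
  and their absolute values add up to p M - (p^n - 1), where p^n cancels.\<close>

lemma kloosterman_ext_bound:
  fixes b :: "'a::{alg_closed_field,field_prime_char}" and k :: nat
  defines "p \<equiv> CHAR('a)" and "n \<equiv> 2 * k + 3"
  assumes "k \<ge> 1" "b \<noteq> 0" "b \<in> frob_fixed 1" "add_char \<psi>"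
  shows "norm (kloosterman_ext \<psi> b n) \<le> 3 * p ^ (k + 3) + 1"
proof -
  define D where "D = (\<lambda>c. {x \<in> frob_fixed n - {0}. frob_trace n (x + b / x) = c})"
  have n: "n \<ge> 1" by (simp add: n_def)
  have p: "real p > 0" by (simp add: p_def)
  define M where "M = (real p ^ n + 3 * real p ^ (k + 3)) / real p"
  have XM: "real (card (D c)) \<le> M" for c
  proof -
    have "p * card (D c) \<le> p ^ n + 3 * p ^ (k + 3)"
      using card_trace_fibre_le[of k b c] assms unfolding D_def n_def p_def by blast
    then have "real (p * card (D c)) \<le> real (p ^ n + 3 * p ^ (k + 3))" unfolding of_nat_le_iff .
    then show ?thesis unfolding M_def using p by (simp add: field_simps)
  qed
  have fin: "finite (frob_fixed n - {0::'a})" "finite (frob_fixed 1 :: 'a set)"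
    using card_frob_fixed(1)[OF n] card_frob_fixed(1)[of 1] by auto
  have img: "(\<lambda>x. frob_trace n (x + b / x)) ` (frob_fixed n - {0}) \<subseteq> frob_fixed 1"
  proof
    fix z assume "z \<in> (\<lambda>x. frob_trace n (x + b / x)) ` (frob_fixed n - {0})"
    then obtain x where z: "z = frob_trace n (x + b / x)" and "x \<in> frob_fixed n" by auto
    moreover have "b \<in> frob_fixed n" by (rule frob_fixed_arith(8)[OF assms(5)])
    ultimately show "z \<in> frob_fixed 1" unfolding z
      by (intro frob_trace_in_prime_field frob_fixed_arith(1,3))
  qed
  have grp: "(\<Sum>x\<in>frob_fixed n - {0}. g (frob_trace n (x + b / x))) = (\<Sum>c\<in>frob_fixed 1. of_nat (card (D c)) * g c)"
    for g :: "'a \<Rightarrow> complex"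
    unfolding sum.group[OF fin(1) fin(2) img, symmetric, of "\<lambda>x. g (frob_trace n (x + b / x))"]
    by (intro sum.cong refl) (simp add: D_def)
  have "card (frob_fixed n - {0::'a}) = p ^ n - 1"
    by (subst card_Diff_singleton[OF frob_fixed_arith(6)]) (simp add: card_frob_fixed[OF n] p_def)
  then have "complex_of_real (\<Sum>c\<in>frob_fixed 1. real (card (D c))) = of_nat (p ^ n - 1)"
    using grp[of "\<lambda>_. 1"] by simp
  then have tot: "(\<Sum>c\<in>frob_fixed 1. real (card (D c))) = real (p ^ n - 1)"
    by (metis of_real_eq_iff of_real_of_nat_eq)
  have cF: "card (frob_fixed 1 :: 'a set) = p" using card_frob_fixed(2)[where 'a='a and n=1] by (simp add: p_def)
  have "kloosterman_ext \<psi> b n = (\<Sum>c\<in>frob_fixed 1. of_nat (card (D c)) * \<psi> c)"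
    unfolding kloosterman_ext_def by (rule grp)
  also have "\<dots> = (\<Sum>c\<in>frob_fixed 1. of_nat (card (D c)) * \<psi> c) - of_real M * (\<Sum>c\<in>frob_fixed 1. \<psi> c)"
    using add_char_sum_zero[OF assms(6) frob_fixed_arith(7)] by simp
  also have "\<dots> = (\<Sum>c\<in>frob_fixed 1. of_real (real (card (D c)) - M) * \<psi> c)"
    by (simp add: sum_distrib_left sum_subtractf left_diff_distrib)
  finally have "norm (kloosterman_ext \<psi> b n) \<le> (\<Sum>c\<in>frob_fixed 1. norm (of_real (real (card (D c)) - M) * \<psi> c))"
    by (metis norm_sum)
  also have "\<dots> = (\<Sum>c\<in>frob_fixed 1. M - real (card (D c)))"
    using assms(6) XM by (intro sum.cong refl) (auto simp: norm_mult add_char_def simp flip: of_real_diff)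
  also have "\<dots> = real p * M - real (p ^ n - 1)" by (simp add: sum_subtractf tot cF del: One_nat_def)
  also have "\<dots> = 3 * real p ^ (k + 3) + 1" 
  proof -
    have "1 \<le> p ^ n" unfolding p_def by (metis CHAR_pos One_nat_def Suc_leI zero_less_power)
    then have "real (p ^ n - 1) = real p ^ n - 1" by (simp add: of_nat_diff)
    then show ?thesis using p by (simp add: M_def)
  qed
  finally show ?thesis by simp
qed

section \<open>The \<open>L\<close>-function of Kloosterman sums\<close>

definition orbit_mset :: "('a \<Rightarrow> 'a) \<Rightarrow> nat \<Rightarrow> 'a \<Rightarrow> 'a multiset" where
  "orbit_mset f n x = image_mset (\<lambda>i. (f ^^ i) x) (mset_set {..<n})"

lemma orbit_mset_0 [simp]: "orbit_mset f 0 x = {#}"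
  by (simp add: orbit_mset_def)

lemma orbit_mset_Suc: "orbit_mset f (Suc n) x = add_mset ((f ^^ n) x) (orbit_mset f n x)"
  by (simp add: orbit_mset_def lessThan_Suc)

lemma size_orbit_mset [simp]: "size (orbit_mset f n x) = n"
  by (simp add: orbit_mset_def)

lemma orbit_mset_Suc': "orbit_mset f (Suc n) x = add_mset x (image_mset f (orbit_mset f n x))"
proof (induction n)
  case (Suc n)
  show ?case by (subst orbit_mset_Suc, subst Suc) (simp add: orbit_mset_Suc)
qed (simp add: orbit_mset_Suc)

lemma image_orbit_mset:
  assumes "(f ^^ n) x = x"
  shows "image_mset f (orbit_mset f n x) = orbit_mset f n x"
  using orbit_mset_Suc[of f n x] orbit_mset_Suc'[of f n x] assms by simp

lemma orbit_mset_add: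
  assumes "(f ^^ e) x = x"
  shows "orbit_mset f (n + e) x = orbit_mset f n x + orbit_mset f e x"
proof (induction n)
  case (Suc n)
  have "(f ^^ (n + e)) x = (f ^^ n) x" using assms by (simp add: funpow_add)
  then show ?case using Suc by (simp add: orbit_mset_Suc)
qed simp

lemma funpow_fixed_mult: "(f ^^ e) x = x \<Longrightarrow> (f ^^ (e * j)) x = x"
  by (induction j) (simp_all add: funpow_add)

lemma orbit_mset_mult:
  assumes "(f ^^ e) x = x"
  shows "orbit_mset f (e * j) x = repeat_mset j (orbit_mset f e x)"
proof (induction j)
  case (Suc j)
  have "orbit_mset f (e * Suc j) x = orbit_mset f (e * j + e) x" by (simp add: add.commute)
  then show ?case using Suc orbit_mset_add[OF assms, of "e * j"] by simp
qed simp

lemma count_image_mset_inj: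
  assumes "inj f"
  shows "count (image_mset f A) (f x) = count A x"
  by (induction A) (auto simp: inj_eq[OF assms])

text \<open>The admissible n are multiples e j of the period e of x. The orbit multiset of length e
  j repeats the cycle j times and, as \<open>A\<close> has constant multiplicity along the cycle,
  fits into \<open>A\<close> exactly when j \<le> count A x.\<close>

lemma card_stable_orbits:
  fixes f :: "'a \<Rightarrow> 'a"
  assumes inj: "inj f" and A: "image_mset f A = A" and x: "x \<in># A"
  shows "card {n. n \<ge> 1 \<and> (f ^^ n) x = x \<and> orbit_mset f n x \<subseteq># A} = count A x"
    and "finite {n. n \<ge> 1 \<and> (f ^^ n) x = x \<and> orbit_mset f n x \<subseteq># A}"
proof -
  have cnt1: "count A (f y) = count A y" for y
    using A count_image_mset_inj[OF inj, of A y] by simp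
  have cnt: "count A ((f ^^ i) y) = count A y" for i y
    by (induction i) (simp_all add: cnt1)
  have in_A: "(f ^^ i) x \<in># A" for i using cnt[of i x] x by (simp flip: count_greater_zero_iff)
  have "\<not> inj (\<lambda>i. (f ^^ i) x)"
    using finite_subset[of "range (\<lambda>i. (f ^^ i) x)" "set_mset A"] in_A finite_imageD[of "\<lambda>i. (f ^^ i) x" UNIV] by auto
  then obtain i j where ij: "i < j" "(f ^^ i) x = (f ^^ j) x"
    unfolding inj_def by (metis linorder_neqE_nat)
  have cancel: "(f ^^ (j - i)) x = x" if "i < j" "(f ^^ i) x = (f ^^ j) x" for i j
  proof -
    have "(f ^^ i) ((f ^^ (j - i)) x) = (f ^^ i) x"
      using that by (metis funpow_add le_add_diff_inverse less_imp_le_nat o_apply)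
    then show ?thesis using inj_fn[OF inj, of i] by (simp add: inj_eq)
  qed
  define e where "e = (LEAST e. e \<ge> 1 \<and> (f ^^ e) x = x)"
  have "j - i \<ge> 1 \<and> (f ^^ (j - i)) x = x" using cancel[OF ij] ij by simp
  then have e: "e \<ge> 1 \<and> (f ^^ e) x = x" unfolding e_def by (rule LeastI)
  have min: "\<not> (i \<ge> 1 \<and> (f ^^ i) x = x)" if "i < e" for i using that unfolding e_def by (rule not_less_Least)
  have dvd: "e dvd n" if "(f ^^ n) x = x" for n
  proof -
    have "n = n mod e + e * (n div e)" by simp
    then have "(f ^^ n) x = (f ^^ (n mod e)) ((f ^^ (e * (n div e))) x)" by (metis funpow_add o_apply)
    then have "(f ^^ (n mod e)) x = x" using that e by (simp add: funpow_fixed_mult)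
    then have "n mod e = 0" using min[of "n mod e"] e by (metis One_nat_def Suc_leI gr0I mod_less_divisor not_one_le_zero)
    then show ?thesis by auto
  qed
  have inj_e: "inj_on (\<lambda>i. (f ^^ i) x) {..<e}"
  proof (rule linorder_inj_onI)
    fix i j assume "i < j" "j \<in> {..<e}"
    then show "(f ^^ i) x \<noteq> (f ^^ j) x" using cancel[of i j] min[of "j - i"] by auto
  qed auto
  have orb: "orbit_mset f e x = mset_set ((\<lambda>i. (f ^^ i) x) ` {..<e})"
    unfolding orbit_mset_def by (rule image_mset_mset_set[OF inj_e])
  have sub: "orbit_mset f (e * j) x \<subseteq># A \<longleftrightarrow> j \<le> count A x" for j
  proof
    assume "orbit_mset f (e * j) x \<subseteq># A"
    then have "count (orbit_mset f (e * j) x) x \<le> count A x" by (simp add: mset_subset_eq_count)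
    moreover have "x \<in> (\<lambda>i. (f ^^ i) x) ` {..<e}" using e by (intro image_eqI[of _ _ 0]) auto
    ultimately show "j \<le> count A x" using e by (simp add: orbit_mset_mult orb)
  next
    assume "j \<le> count A x"
    then show "orbit_mset f (e * j) x \<subseteq># A" using e
      by (intro mset_subset_eqI) (auto simp: orbit_mset_mult orb count_mset_set' cnt)
  qed
  have eq: "{n. n \<ge> 1 \<and> (f ^^ n) x = x \<and> orbit_mset f n x \<subseteq># A} = (\<lambda>j. e * j) ` {1..count A x}"
  proof (intro equalityI subsetI)
    fix n assume n: "n \<in> {n. n \<ge> 1 \<and> (f ^^ n) x = x \<and> orbit_mset f n x \<subseteq># A}"
    then obtain j where j: "n = e * j" using dvd by (auto elim!: dvdE)
    then have "j \<ge> 1" "j \<le> count A x" using n sub[of j] by (auto simp: Suc_le_eq intro!: gr0I)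
    then show "n \<in> (\<lambda>j. e * j) ` {1..count A x}" using j by auto
  next
    fix n assume "n \<in> (\<lambda>j. e * j) ` {1..count A x}"
    then obtain j where "n = e * j" "j \<in> {1..count A x}" by (rule imageE)
    then show "n \<in> {n. n \<ge> 1 \<and> (f ^^ n) x = x \<and> orbit_mset f n x \<subseteq># A}"
      using e sub[of j] funpow_fixed_mult[of e f x j] by auto
  qed
  show "finite {n. n \<ge> 1 \<and> (f ^^ n) x = x \<and> orbit_mset f n x \<subseteq># A}" unfolding eq by simp
  have "inj_on (\<lambda>j. e * j) {1..count A x}" using e by (auto simp: inj_on_def)
  then show "card {n. n \<ge> 1 \<and> (f ^^ n) x = x \<and> orbit_mset f n x \<subseteq># A} = count A x"
    unfolding eq by (simp add: card_image)
qed

definition stable_msets :: "('a::zero \<Rightarrow> 'a) \<Rightarrow> nat \<Rightarrow> 'a multiset set" where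
  "stable_msets f d = {A. size A = d \<and> 0 \<notin># A \<and> image_mset f A = A}"

text \<open>In terms of generating functions, the series of the sums of \<open>w\<close> over stable
  multisets is the exponential of the sum of S_n T^n / n, and this is its logarithmic derivative.
  The proof is a double count of stable multisets \<open>A\<close> with a marked closed orbit
  inside.\<close>

lemma newton_identity:
  fixes f :: "'a::zero \<Rightarrow> 'a" and w :: "'a multiset \<Rightarrow> complex" and F :: "nat \<Rightarrow> 'a set"
  assumes inj: "inj f" and f0: "f 0 = 0"
    and fin: "\<And>d. finite (stable_msets f d)" 
    and F: "\<And>n. n \<ge> 1 \<Longrightarrow> F n = {x. (f ^^ n) x = x}" and finF: "\<And>n. n \<ge> 1 \<Longrightarrow> finite (F n)"
    and mult: "\<And>A B. 0 \<notin># A \<Longrightarrow> 0 \<notin># B \<Longrightarrow> image_mset f A = A \<Longrightarrow> image_mset f B = B \<Longrightarrow> w (A + B) = w A * w B"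
  shows "of_nat d * (\<Sum>A\<in>stable_msets f d. w A) =
    (\<Sum>n=1..d. (\<Sum>x\<in>F n - {0}. w (orbit_mset f n x)) * (\<Sum>A\<in>stable_msets f (d - n). w A))"
proof -
  have f0': "(f ^^ n) 0 = 0" for n by (induction n) (simp_all add: f0)
  have orb0: "0 \<notin># orbit_mset f n x" if "x \<noteq> 0" for n x
  proof -
    have "(f ^^ i) x \<noteq> 0" for i using that f0'[of i] inj_fn[OF inj, of i] by (metis injD)
    then show ?thesis by (auto simp: orbit_mset_def)
  qed
  \<comment> \<open>By \<open>card_stable_orbits\<close> every x in \<open>A\<close> admits as many
    lengths n as its multiplicity, so \<open>A\<close> is counted d times in all.\<close>
  have count: "card (SIGMA n:{1..d}. {x \<in> F n - {0}. orbit_mset f n x \<subseteq># A}) = d" if A: "A \<in> stable_msets f d" for A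
  proof -
    define N where "N = (\<lambda>x. {n. n \<ge> 1 \<and> (f ^^ n) x = x \<and> orbit_mset f n x \<subseteq># A})"
    have As: "size A = d" "0 \<notin># A" "image_mset f A = A" using A by (auto simp: stable_msets_def)
    have finN: "finite (N x)" and cN: "card (N x) = count A x" if "x \<in># A" for x
      unfolding N_def using card_stable_orbits[OF inj As(3) that] by auto
    have "(SIGMA n:{1..d}. {x \<in> F n - {0}. orbit_mset f n x \<subseteq># A}) = (\<lambda>(x, n). (n, x)) ` (SIGMA x:set_mset A. N x)"
    proof (intro equalityI subsetI)
      fix z assume "z \<in> (SIGMA n:{1..d}. {x \<in> F n - {0}. orbit_mset f n x \<subseteq># A})"
      then obtain n x where z: "z = (n, x)" "1 \<le> n" "n \<le> d" "x \<in> F n" "x \<noteq> 0" "orbit_mset f n x \<subseteq># A" by auto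
      have "x \<in># orbit_mset f n x" using z by (auto simp: orbit_mset_def intro!: image_eqI[of _ _ 0])
      then have "x \<in># A" using z by (meson mset_subset_eqD)
      then show "z \<in> (\<lambda>(x, n). (n, x)) ` (SIGMA x:set_mset A. N x)" using z F[of n] by (force simp: N_def)
    next
      fix z assume "z \<in> (\<lambda>(x, n). (n, x)) ` (SIGMA x:set_mset A. N x)"
      then obtain n x where z: "z = (n, x)" "x \<in># A" "1 \<le> n" "(f ^^ n) x = x" "orbit_mset f n x \<subseteq># A" by (auto simp: N_def)
      have "n \<le> d" using size_mset_mono[OF z(5)] As(1) by simp
      moreover have "x \<noteq> 0" using z As by auto
      ultimately show "z \<in> (SIGMA n:{1..d}. {x \<in> F n - {0}. orbit_mset f n x \<subseteq># A})" using z F[of n] by auto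
    qed
    moreover have "inj_on (\<lambda>(x, n). (n, x)) (SIGMA x:set_mset A. N x)" by (auto simp: inj_on_def)
    ultimately have "card (SIGMA n:{1..d}. {x \<in> F n - {0}. orbit_mset f n x \<subseteq># A}) = card (SIGMA x:set_mset A. N x)"
      by (simp add: card_image)
    also have "\<dots> = (\<Sum>x\<in>set_mset A. card (N x))" by (rule card_SigmaI) (use finN in auto)
    also have "\<dots> = (\<Sum>x\<in>set_mset A. count A x)" by (intro sum.cong refl cN)
    also have "\<dots> = d" using As(1) by (simp add: size_multiset_overloaded_eq)
    finally show ?thesis .
  qed
  \<comment> \<open>Removing the marked orbit from \<open>A\<close> leaves an arbitrary stable
    multiset of size d - n.\<close>
  have shift: "(\<Sum>A\<in>{A \<in> stable_msets f d. orbit_mset f n x \<subseteq># A}. w A) =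
      w (orbit_mset f n x) * (\<Sum>A\<in>stable_msets f (d - n). w A)" if n: "1 \<le> n" "n \<le> d" and x: "x \<in> F n - {0}" for n x
  proof -
    have fx: "(f ^^ n) x = x" "x \<noteq> 0" using x F[OF n(1)] by auto
    note im = image_orbit_mset[OF fx(1)]
    have "(\<Sum>A\<in>{A \<in> stable_msets f d. orbit_mset f n x \<subseteq># A}. w A) = (\<Sum>B\<in>stable_msets f (d - n). w (orbit_mset f n x + B))"
    proof (rule sum.reindex_bij_witness[of _ "\<lambda>B. orbit_mset f n x + B" "\<lambda>A. A - orbit_mset f n x"], goal_cases)
      case (1 A)
      then show ?case by simp
    next
      case (2 A)
      then obtain B where B: "A = orbit_mset f n x + B" by (auto simp: mset_subset_eq_exists_conv)
      then show ?case using 2 im by (auto simp: stable_msets_def)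
    next
      case (3 B)
      then show ?case by simp
    next
      case (4 B)
      then show ?case using im n orb0[OF fx(2)] by (auto simp: stable_msets_def)
    qed simp_all
    also have "\<dots> = (\<Sum>B\<in>stable_msets f (d - n). w (orbit_mset f n x) * w B)"
      by (intro sum.cong refl mult) (use orb0[OF fx(2)] im in \<open>auto simp: stable_msets_def\<close>)
    finally show ?thesis by (simp add: sum_distrib_left)
  qed
  have "of_nat d * (\<Sum>A\<in>stable_msets f d. w A)
      = (\<Sum>A\<in>stable_msets f d. of_nat (card (SIGMA n:{1..d}. {x \<in> F n - {0}. orbit_mset f n x \<subseteq># A})) * w A)"
    unfolding sum_distrib_left by (intro sum.cong refl) (simp only: count)
  also have "\<dots> = (\<Sum>A\<in>stable_msets f d. \<Sum>n=1..d. \<Sum>x\<in>{x \<in> F n - {0}. orbit_mset f n x \<subseteq># A}. w A)"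
    using finF by (intro sum.cong refl) (simp add: card_SigmaI sum_distrib_right)
  also have "\<dots> = (\<Sum>A\<in>stable_msets f d. \<Sum>n=1..d. \<Sum>x\<in>F n - {0}. if orbit_mset f n x \<subseteq># A then w A else 0)"
    by (intro sum.cong refl sum.inter_filter) (use finF in auto)
  also have "\<dots> = (\<Sum>n=1..d. \<Sum>A\<in>stable_msets f d. \<Sum>x\<in>F n - {0}. if orbit_mset f n x \<subseteq># A then w A else 0)"
    by (rule sum.swap)
  also have "\<dots> = (\<Sum>n=1..d. \<Sum>x\<in>F n - {0}. \<Sum>A\<in>stable_msets f d. if orbit_mset f n x \<subseteq># A then w A else 0)"
    by (intro sum.cong refl sum.swap)
  also have "\<dots> = (\<Sum>n=1..d. \<Sum>x\<in>F n - {0}. \<Sum>A\<in>{A \<in> stable_msets f d. orbit_mset f n x \<subseteq># A}. w A)"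
    by (intro sum.cong refl sum.inter_filter[symmetric] fin)
  also have "\<dots> = (\<Sum>n=1..d. \<Sum>x\<in>F n - {0}. w (orbit_mset f n x) * (\<Sum>A\<in>stable_msets f (d - n). w A))"
    by (intro sum.cong refl shift) auto
  finally show ?thesis by (simp add: sum_distrib_right)
qed

section \<open>Frobenius-stable multisets as polynomials over the prime field\<close>

interpretation frobenius: comm_ring_hom "\<lambda>x::'a::{alg_closed_field,field_prime_char}. x ^ CHAR('a)"
  by unfold_locales (simp_all add: power_mult_distrib freshmans_dream[OF prime_CHAR refl] power_0_left)

abbreviation (input) linear_prod :: "'a::{alg_closed_field,field_prime_char} multiset \<Rightarrow> 'a poly" where
  "linear_prod A \<equiv> (\<Prod>x\<in>#A. [:-x, 1:])"

abbreviation (input) frob :: "'a::{alg_closed_field,field_prime_char} \<Rightarrow> 'a" where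
  "frob \<equiv> (\<lambda>x. x ^ CHAR('a))"

lemma map_frob_linear_prod:
  "map_poly frob (linear_prod (A :: 'a::{alg_closed_field,field_prime_char} multiset)) = linear_prod (image_mset frob A)"
proof (induction A)
  case (add x A)
  interpret mp: map_poly_comm_ring_hom "\<lambda>x::'a. x ^ CHAR('a)" ..
  have "(- x) ^ CHAR('a) = - (x ^ CHAR('a))" by (rule frobenius.hom_uminus)
  then have "map_poly frob [:-x, 1:] = [:-(x ^ CHAR('a)), 1:]" by (simp add: map_poly_pCons)
  then show ?case using add mp.hom_mult[of "[:-x, 1:]" "linear_prod A"] by simp
qed simp

lemma linear_prod_props:
  "linear_prod A \<noteq> 0" "degree (linear_prod A) = size A" "coeff (linear_prod A) (size A) = 1"
proof -
  show nz: "linear_prod A \<noteq> 0" for A :: "'a multiset" by (auto simp: prod_mset_zero_iff)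
  show deg: "degree (linear_prod A) = size A" for A :: "'a multiset"
  proof (induction A)
    case (add x A)
    have "degree ([:-x, 1:] * linear_prod A) = 1 + size A"
      by (subst degree_mult_eq) (use nz[of A] add in auto)
    then show ?case by (simp only: image_mset_add_mset prod_mset.add_mset size_add_mset)
  qed simp
  show "coeff (linear_prod A) (size A) = 1"
  proof (induction A)
    case (add x A)
    have "coeff ([:-x, 1:] * linear_prod A) (Suc (size A)) = 1"
      using add deg[of A] by (simp add: coeff_eq_0)
    then show ?case by (simp only: image_mset_add_mset prod_mset.add_mset size_add_mset)
  qed simp
qed

lemma coeff_linear_prod_0: "coeff (linear_prod A) 0 \<noteq> 0 \<longleftrightarrow> 0 \<notin># A"
proof (induction A)
  case (add x A)
  have "coeff ([:-x, 1:] * linear_prod A) 0 = - x * coeff (linear_prod A) 0" by simp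
  then show ?case using add by (simp only: image_mset_add_mset prod_mset.add_mset) auto
qed simp

lemma monic_eq_linear_prod:
  assumes "lead_coeff P = (1::'a::{alg_closed_field,field_prime_char})"
  shows "linear_prod (proots P) = P"
proof -
  have "P \<noteq> 0" using assms by auto
  from alg_closed_imp_factorization[OF this] assms obtain A where A: "P = linear_prod A" by auto
  then show ?thesis by (simp add: proots_linear_prod)
qed

text \<open>The logarithmic derivative at 0 of a product of linear factors.\<close>

lemma vieta_0:
  assumes "0 \<notin># A"
  shows "coeff (linear_prod A) 1 / coeff (linear_prod A) 0 = - (\<Sum>x\<in>#A. 1 / x)"
  using assms
proof (induction A)
  case (add x A)
  define P where "P = linear_prod A"
  have IH: "coeff P 1 / coeff P 0 = - (\<Sum>x\<in>#A. 1 / x)" and x: "x \<noteq> 0" using add by (auto simp: P_def)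
  have "coeff P 0 \<noteq> 0" using coeff_linear_prod_0[of A] add by (auto simp: P_def)
  then have "coeff ([:-x, 1:] * P) 1 / coeff ([:-x, 1:] * P) 0 = - (1 / x) + coeff P 1 / coeff P 0"
    using x by (simp add: field_simps)
  then show ?case unfolding IH by (simp only: image_mset_add_mset prod_mset.add_mset P_def sum_mset.add_mset minus_add_distrib)
qed simp

lemma vieta_top:
  assumes "size A = Suc m"
  shows "coeff (linear_prod A) m = - (\<Sum>x\<in>#A. x)"
  using assms
proof (induction A arbitrary: m)
  case (add x A)
  define P where "P = linear_prod A"
  have m: "size A = m" using add by simp
  have lc: "coeff P m = 1" using linear_prod_props(3)[of A] m by (simp add: P_def)
  have "coeff ([:-x, 1:] * P) m = - x - (\<Sum>x\<in>#A. x)"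
  proof (cases m)
    case 0
    then show ?thesis using lc m by simp
  next
    case (Suc m')
    then have "coeff P m' = - (\<Sum>x\<in>#A. x)" using add.IH[of m'] m by (simp add: P_def)
    then show ?thesis using lc Suc by simp
  qed
  then show ?case by (simp only: image_mset_add_mset prod_mset.add_mset P_def sum_mset.add_mset) simp
qed simp

text \<open>Frobenius acts on the coefficients of the monic polynomial as it does on the roots, and
  polynomial and roots determine each other.\<close>

lemma frob_stable_iff:
  fixes A :: "'a::{alg_closed_field,field_prime_char} multiset"
  shows "image_mset frob A = A \<longleftrightarrow> (\<forall>i. coeff (linear_prod A) i \<in> frob_fixed 1)"
proof
  assume "image_mset frob A = A"
  then have "map_poly frob (linear_prod A) = linear_prod A" using map_frob_linear_prod[of A] by simp
  then have "coeff (linear_prod A) i ^ CHAR('a) = coeff (linear_prod A) i" for i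
    using frobenius.coeff_map_poly_hom[of "linear_prod A" i] by simp
  then show "\<forall>i. coeff (linear_prod A) i \<in> frob_fixed 1" by (simp add: frob_fixed_def)
next
  assume "\<forall>i. coeff (linear_prod A) i \<in> frob_fixed 1"
  then have "map_poly frob (linear_prod A) = linear_prod A" 
    by (intro poly_eqI) (simp add: frob_fixed_def frobenius.coeff_map_poly_hom)
  then have "linear_prod (image_mset frob A) = linear_prod A" using map_frob_linear_prod[of A] by simp
  then have "proots (linear_prod (image_mset frob A)) = proots (linear_prod A)" by simp
  then show "image_mset frob A = A" by (simp only: proots_linear_prod)
qed

definition rational_monic :: "nat \<Rightarrow> 'a::{alg_closed_field,field_prime_char} poly set" where
  "rational_monic d = {P. degree P = d \<and> coeff P d = 1 \<and> coeff P 0 \<noteq> 0 \<and> (\<forall>i. coeff P i \<in> frob_fixed 1)}"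

lemma linear_prod_bij:
  "bij_betw linear_prod (stable_msets frob d) (rational_monic d :: 'a::{alg_closed_field,field_prime_char} poly set)"
proof (rule bij_betw_byWitness[of _ proots])
  show "\<forall>A\<in>stable_msets frob d. proots (linear_prod A) = A" by (simp add: proots_linear_prod)
  show "\<forall>P\<in>rational_monic d. linear_prod (proots P) = P"
    by (auto simp: rational_monic_def intro!: monic_eq_linear_prod)
  show "linear_prod ` stable_msets frob d \<subseteq> (rational_monic d :: 'a poly set)"
  proof (rule subsetI)
    fix P :: "'a poly" assume "P \<in> linear_prod ` stable_msets frob d"
    then obtain A where A: "P = linear_prod A" "size A = d" "0 \<notin># A" "image_mset frob A = A"
      by (auto simp: stable_msets_def)
    show "P \<in> rational_monic d"
      using linear_prod_props[of A] coeff_linear_prod_0[of A] frob_stable_iff[of A] A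
      by (simp add: rational_monic_def)
  qed
  show "proots ` (rational_monic d :: 'a poly set) \<subseteq> stable_msets frob d"
  proof (rule subsetI)
    fix A :: "'a multiset" assume "A \<in> proots ` rational_monic d"
    then obtain P where P: "A = proots P" "P \<in> rational_monic d" by auto
    then have "linear_prod A = P" using monic_eq_linear_prod[of P] by (auto simp: rational_monic_def)
    then show "A \<in> stable_msets frob d"
      using linear_prod_props[of A] coeff_linear_prod_0[of A] frob_stable_iff[of A] P
      by (simp add: rational_monic_def stable_msets_def)
  qed
qed

lemma finite_rational_monic: "finite (rational_monic d :: 'a::{alg_closed_field,field_prime_char} poly set)"
proof (rule finite_subset)
  show "finite (Poly ` {cs. set cs \<subseteq> (frob_fixed 1 :: 'a set) \<and> length cs = Suc d})"
    by (intro finite_imageI finite_lists_length_eq card_frob_fixed) simp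
  show "rational_monic d \<subseteq> Poly ` {cs. set cs \<subseteq> (frob_fixed 1 :: 'a set) \<and> length cs = Suc d}"
  proof
    fix P :: "'a poly" assume P: "P \<in> rational_monic d"
    then have "P \<noteq> 0" by (auto simp: rational_monic_def)
    then have "length (coeffs P) = Suc d" using P by (simp add: length_coeffs_degree rational_monic_def)
    moreover have "set (coeffs P) \<subseteq> frob_fixed 1" 
    proof -
      have "set (coeffs P) \<subseteq> range (coeff P)" unfolding coeffs_def by auto
      moreover have "range (coeff P) \<subseteq> frob_fixed 1" using P unfolding rational_monic_def by blast
      ultimately show ?thesis by blast
    qed
    ultimately show "P \<in> Poly ` {cs. set cs \<subseteq> frob_fixed 1 \<and> length cs = Suc d}"
      by (intro image_eqI[of _ _ "coeffs P"]) auto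
  qed
qed

section \<open>The coefficients of the L-function\<close>

definition mset_weight :: "('a::{alg_closed_field,field_prime_char} \<Rightarrow> complex) \<Rightarrow> 'a \<Rightarrow> 'a multiset \<Rightarrow> complex" where
  "mset_weight \<psi> b A = \<psi> (\<Sum>x\<in>#A. x + b / x)"

text \<open>The \<open>L\<close>-function is a sum over the monic polynomials over the prime field with nonzero constant
  coefficient, here encoded by their multisets of roots.\<close>

definition L_coeff :: "('a::{alg_closed_field,field_prime_char} \<Rightarrow> complex) \<Rightarrow> 'a \<Rightarrow> nat \<Rightarrow> complex" where
  "L_coeff \<psi> b d = (\<Sum>A\<in>stable_msets frob d. mset_weight \<psi> b A)"

lemma L_coeff_0:
  fixes b :: "'a::{alg_closed_field,field_prime_char}"
  assumes "add_char \<psi>"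
  shows "L_coeff \<psi> b 0 = 1"
proof -
  have "stable_msets (frob :: 'a \<Rightarrow> 'a) 0 = {{#}}" by (auto simp: stable_msets_def)
  then show ?thesis
    unfolding L_coeff_def by (simp add: mset_weight_def add_char_0[OF assms])
qed

text \<open>By Vieta the weight of a polynomial sees only its second highest and its two lowest
  coefficients; \<open>L_coeff_ge_3\<close> and \<open>L_coeff_2\<close> rest on this.\<close>

lemma L_coeff_eq:
  fixes b :: "'a::{alg_closed_field,field_prime_char}"
  shows
  "L_coeff \<psi> b (Suc m) = (\<Sum>P\<in>rational_monic (Suc m). \<psi> (- coeff P m - b * (coeff P 1 / coeff P 0)))"
proof -
  have "L_coeff \<psi> b (Suc m) = (\<Sum>A\<in>stable_msets frob (Suc m). \<psi> (- coeff (linear_prod A) m - b * (coeff (linear_prod A) 1 / coeff (linear_prod A) 0)))"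
    unfolding L_coeff_def
  proof (intro sum.cong refl)
    fix A :: "'a multiset" assume "A \<in> stable_msets frob (Suc m)"
    then have A: "size A = Suc m" "0 \<notin># A" by (auto simp: stable_msets_def)
    have "- coeff (linear_prod A) m - b * (coeff (linear_prod A) 1 / coeff (linear_prod A) 0)
      = (\<Sum>x\<in>#A. x) + b * (\<Sum>x\<in>#A. 1 / x)"
      unfolding vieta_0[OF A(2)] vieta_top[OF A(1)] by simp
    also have "\<dots> = (\<Sum>x\<in>#A. x + b / x)"
      by (induction A) (simp_all add: algebra_simps)
    finally show "mset_weight \<psi> b A = \<psi> (- coeff (linear_prod A) m - b * (coeff (linear_prod A) 1 / coeff (linear_prod A) 0))"
      by (simp add: mset_weight_def)
  qed
  then show ?thesis using sum.reindex_bij_betw[OF linear_prod_bij] by simp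
qed

text \<open>From degree 3 on, the second highest coefficient is distinct from the two lowest ones.
  Translating it permutes the polynomials and multiplies the whole sum by a character value other
  than 1.\<close>

lemma L_coeff_ge_3:
  fixes b :: "'a::{alg_closed_field,field_prime_char}"
  assumes \<psi>: "add_char \<psi>" and b: "b \<in> frob_fixed 1"
  shows "L_coeff \<psi> b (Suc (Suc (Suc m))) = 0"
proof -
  let ?d = "Suc (Suc m)"
  from \<psi> obtain u where u: "u \<in> frob_fixed 1" "\<psi> u \<noteq> 1" by (auto simp: add_char_def)
  define g where "g = (\<lambda>P. - coeff P ?d - b * (coeff P 1 / coeff P 0) :: 'a)"
  have mem: "P + monom v ?d \<in> rational_monic (Suc ?d)" if "P \<in> rational_monic (Suc ?d)" "v \<in> frob_fixed 1" for P :: "'a poly" and v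
  proof -
    have P: "degree P = Suc ?d" "coeff P (Suc ?d) = 1" "coeff P 0 \<noteq> 0" "\<And>i. coeff P i \<in> frob_fixed 1"
      using that by (auto simp: rational_monic_def)
    have "degree (P + monom v ?d) = degree P"
      by (rule degree_add_eq_left) (use P degree_monom_le[of v ?d] in simp)
    moreover have "coeff (P + monom v ?d) i \<in> frob_fixed 1" for i
      using P(4)[of i] that frob_fixed_arith(1) by (cases "i = ?d") auto
    ultimately show ?thesis using P by (simp add: rational_monic_def)
  qed
  have eq: "L_coeff \<psi> b (Suc ?d) = (\<Sum>P\<in>rational_monic (Suc ?d). \<psi> (g P))"
    unfolding L_coeff_eq g_def ..
  also have "\<dots> = (\<Sum>P\<in>rational_monic (Suc ?d). \<psi> (g (P + monom (- u) ?d)))"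
    by (rule sum.reindex_bij_witness[of _ "\<lambda>P. P + monom (- u) ?d" "\<lambda>P. P + monom u ?d"])
      (auto intro!: mem u frob_fixed_arith(5) simp: add.assoc add_monom)
  also have "\<dots> = (\<Sum>P\<in>rational_monic (Suc ?d). \<psi> (g P) * \<psi> u)"
  proof (intro sum.cong refl)
    fix P :: "'a poly" assume P: "P \<in> rational_monic (Suc ?d)"
    have "g (P + monom (- u) ?d) = g P + u" by (simp add: g_def)
    moreover have "g P \<in> frob_fixed 1" using P b unfolding g_def
      by (intro frob_fixed_arith(2-5)) (auto simp: rational_monic_def)
    ultimately show "\<psi> (g (P + monom (- u) ?d)) = \<psi> (g P) * \<psi> u"
      using \<psi> u by (simp add: add_char_def)
  qed
  also have "\<dots> = L_coeff \<psi> b (Suc ?d) * \<psi> u" unfolding eq by (simp add: sum_distrib_right)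
  finally show ?thesis using u by simp
qed

text \<open>In degree 2 the second highest and second lowest coefficients coincide: X^2 + v X + u
  has weight \<psi>(- v (1 + b / u)). The sum over v vanishes unless u = - b, where it has p terms
  equal to 1.\<close>

lemma L_coeff_2:
  fixes b :: "'a::{alg_closed_field,field_prime_char}"
  assumes \<psi>: "add_char \<psi>" and b: "b \<in> frob_fixed 1" "b \<noteq> 0"
  shows "L_coeff \<psi> b 2 = of_nat CHAR('a)"
proof -
  let ?F = "frob_fixed 1 :: 'a set"
  have fin: "finite ?F" by (rule card_frob_fixed) simp
  have bij: "bij_betw (\<lambda>(u, v). [:u, v, 1:]) ((?F - {0}) \<times> ?F) (rational_monic 2)"
  proof (rule bij_betw_byWitness[of _ "\<lambda>P. (coeff P 0, coeff P 1)"])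
    show "\<forall>P\<in>rational_monic 2. (case (coeff P 0, coeff P 1) of (u, v) \<Rightarrow> [:u, v, 1::'a:]) = P"
    proof
      fix P :: "'a poly" assume "P \<in> rational_monic 2"
      then have P: "degree P = 2" "coeff P 2 = 1" by (auto simp: rational_monic_def)
      have "coeff [:coeff P 0, coeff P 1, 1:] i = coeff P i" for i
      proof (cases "i \<le> 2")
        case True
        then have "i = 0 \<or> i = 1 \<or> i = 2" by auto
        then show ?thesis using P by (auto simp: numeral_2_eq_2)
      next
        case False
        then have "coeff P i = 0" using P by (intro coeff_eq_0) simp
        moreover have "coeff [:coeff P 0, coeff P 1, 1:] i = 0" using False by (intro coeff_eq_0) simp
        ultimately show ?thesis by simp
      qed
      then show "(case (coeff P 0, coeff P 1) of (u, v) \<Rightarrow> [:u, v, 1::'a:]) = P" by (simp add: poly_eqI)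
    qed
    show "(\<lambda>(u, v). [:u, v, 1:]) ` ((?F - {0}) \<times> ?F) \<subseteq> rational_monic 2"
    proof (rule subsetI)
      fix P :: "'a poly" assume "P \<in> (\<lambda>(u, v). [:u, v, 1:]) ` ((?F - {0}) \<times> ?F)"
      then obtain u v where P: "P = [:u, v, 1:]" "u \<in> ?F" "u \<noteq> 0" "v \<in> ?F" by auto
      have "coeff P i \<in> ?F" for i
        using P frob_fixed_arith(6,7)[where 'a = 'a and n = 1] by (simp add: coeff_pCons split: nat.split)
      then show "P \<in> rational_monic 2" using P by (simp add: rational_monic_def numeral_2_eq_2)
    qed
  qed (auto simp: rational_monic_def)
  have inner: "(\<Sum>v\<in>?F. \<psi> (- v - b * (v / u))) = (if u = - b then of_nat CHAR('a) else 0)" if u: "u \<in> ?F - {0}" for u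
  proof -
    have eq: "- v - b * (v / u) = (- 1 - b / u) * v" for v using u by (simp add: field_simps)
    show ?thesis
    proof (cases "u = - b")
      case True
      then have "(\<Sum>v\<in>?F. \<psi> (- v - b * (v / u))) = (\<Sum>v\<in>?F. 1)" unfolding eq using b by (simp add: add_char_0[OF \<psi>])
      then show ?thesis using True card_frob_fixed(2)[where 'a='a and n=1] by simp
    next
      case False
      have "- 1 - b / u \<in> ?F" by (intro frob_fixed_arith(3-5,7)) (use b u in auto)
      moreover have "- 1 - b / u \<noteq> 0" using False u by (auto simp: field_simps eq_neg_iff_add_eq_0)
      ultimately show ?thesis unfolding eq using add_char_sum_zero[OF \<psi>] False by simp
    qed
  qed
  have "L_coeff \<psi> b 2 = (\<Sum>(u, v)\<in>(?F - {0}) \<times> ?F. \<psi> (- v - b * (v / u)))"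
    using L_coeff_eq[of \<psi> b 1] sum.reindex_bij_betw[OF bij, of "\<lambda>P. \<psi> (- coeff P 1 - b * (coeff P 1 / coeff P 0))"]
    by (simp add: numeral_2_eq_2 case_prod_unfold)
  also have "\<dots> = (\<Sum>u\<in>?F - {0}. \<Sum>v\<in>?F. \<psi> (- v - b * (v / u)))"
    by (rule sum.cartesian_product[symmetric])
  also have "\<dots> = (\<Sum>u\<in>?F - {0}. if u = - b then of_nat CHAR('a) else 0)"
    by (intro sum.cong refl inner)
  also have "\<dots> = of_nat CHAR('a)"
    using fin b frob_fixed_arith(5)[OF b(1)] by (simp add: sum.delta)
  finally show ?thesis .
qed

text \<open>The weight of the Frobenius orbit multiset of x is \<open>\<psi>\<close> of the trace of
  x + b / x, so the power sums in \<open>newton_identity\<close> are the Kloosterman sums over the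
  extensions.\<close>

lemma L_function_recurrence:
  fixes b :: "'a::{alg_closed_field,field_prime_char}"
  assumes \<psi>: "add_char \<psi>" and b: "b \<in> frob_fixed 1"
  shows "of_nat d * L_coeff \<psi> b d = (\<Sum>n=1..d. kloosterman_ext \<psi> b n * L_coeff \<psi> b (d - n))"
proof -
  have funpow: "(frob ^^ n) x = x ^ (CHAR('a) ^ n)" for n and x :: 'a
    by (induction n) (simp_all add: power_mult[symmetric] mult.commute)
  have bn: "b ^ (CHAR('a) ^ n) = b" for n using frob_fixed_arith(8)[OF b, of n] by (simp add: frob_fixed_def)
  have inj: "inj (frob :: 'a \<Rightarrow> 'a)" using frobenius_inj[of _ 1] by (auto simp: inj_def)
  have tr: "(\<Sum>x\<in>#A. x + b / x) \<in> frob_fixed 1" if "image_mset frob A = A" for A :: "'a multiset"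
  proof -
    have "frob (\<Sum>x\<in>#A. x + b / x) = (\<Sum>x\<in>#A. frob (x + b / x))"
      by (induction A) (simp_all add: freshmans_dream[OF prime_CHAR refl] power_0_left)
    also have "\<dots> = (\<Sum>x\<in>#A. frob x + b / frob x)"
      using bn[of 1] by (simp add: freshmans_dream[OF prime_CHAR refl] power_divide)
    also have "\<dots> = (\<Sum>x\<in>#image_mset frob A. x + b / x)" by (simp add: image_mset.compositionality o_def)
    finally show ?thesis unfolding that by (simp add: frob_fixed_def)
  qed
  have w_orb: "mset_weight \<psi> b (orbit_mset frob n x) = \<psi> (frob_trace n (x + b / x))" for n x
    unfolding mset_weight_def orbit_mset_def frob_trace_def
    by (simp add: image_mset.compositionality o_def funpow frobenius_add power_divide bn sum_unfold_sum_mset)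
  have "of_nat d * (\<Sum>A\<in>stable_msets frob d. mset_weight \<psi> b A) =
    (\<Sum>n=1..d. (\<Sum>x\<in>frob_fixed n - {0}. mset_weight \<psi> b (orbit_mset frob n x)) * (\<Sum>A\<in>stable_msets frob (d - n). mset_weight \<psi> b A))"
  proof (rule newton_identity[OF inj])
    show "finite (stable_msets (frob :: 'a \<Rightarrow> 'a) d)" for d
      using bij_betw_finite[OF linear_prod_bij[of d, where ?'a = 'a]] finite_rational_monic by simp
    show "frob_fixed n = {x. (frob ^^ n) x = (x::'a)}" for n by (simp add: frob_fixed_def funpow)
    show "finite (frob_fixed n :: 'a set)" if "n \<ge> 1" for n using that by (rule card_frob_fixed)
    show "mset_weight \<psi> b (A + B) = mset_weight \<psi> b A * mset_weight \<psi> b B"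
      if "image_mset frob A = A" "image_mset frob B = B" for A B
      using \<psi> tr[OF that(1)] tr[OF that(2)] by (simp add: mset_weight_def add_char_def)
  qed (simp add: power_0_left)
  then show ?thesis unfolding L_coeff_def kloosterman_ext_def w_orb .
qed

section \<open>From the quadratic L-function to the square-root bound\<close>

lemma power_sum_recurrence:
  fixes S :: "nat \<Rightarrow> complex" and p :: complex
  assumes S2: "2 * p = S 2 + S 1 * S 1"
    and rec: "\<And>n. S (n + 3) + S (n + 2) * S 1 + S (n + 1) * p = 0"
    and ab: "\<alpha> + \<beta> = - S 1" "\<alpha> * \<beta> = p"
  shows "S (Suc n) = - (\<alpha> ^ Suc n + \<beta> ^ Suc n)"
\<comment> \<open>The hypotheses are the Newton identities of 1 + S_1 T + p T^2, whose reciprocal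
  roots are \<alpha> and \<beta>.\<close>
proof (induction n rule: less_induct)
  case (less n)
  consider "n = 0" | "n = 1" | m where "n = m + 2" by (metis add_2_eq_Suc' not0_implies_Suc One_nat_def)
  then show ?case
  proof cases
    case 1
    then show ?thesis using ab by simp
  next
    case 2
    have "S 2 = 2 * (\<alpha> * \<beta>) - (\<alpha> + \<beta>) * (\<alpha> + \<beta>)" using S2 unfolding ab by (simp add: algebra_simps)
    then show ?thesis using 2 by (simp add: numeral_2_eq_2 algebra_simps)
  next
    case (3 m)
    have IH: "S (m + 2) = - (\<alpha> ^ (m + 2) + \<beta> ^ (m + 2))" "S (m + 1) = - (\<alpha> ^ (m + 1) + \<beta> ^ (m + 1))"
      using less[of "m + 1"] less[of m] 3 by simp_all
    have S1: "S 1 = - (\<alpha> + \<beta>)" unfolding ab by simp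
    have "S (m + 3) = - (S (m + 2) * S 1) - S (m + 1) * p" using rec[of m] by (simp add: algebra_simps eq_neg_iff_add_eq_0)
    also have "\<dots> = - (\<alpha> ^ (m + 3) + \<beta> ^ (m + 3))"
      unfolding IH S1 ab(2)[symmetric] by (simp add: algebra_simps eval_nat_numeral)
    finally show ?thesis using 3 by (simp add: eval_nat_numeral)
  qed
qed

text \<open>The excess factor s^3 in the bound does not depend on k. If |\<alpha>| > s, the power
  (|\<alpha>| / s)^m outgrows it, while the product condition keeps |\<beta>| at most s.\<close>

lemma root_bound_from_growth:
  fixes \<alpha> \<beta> :: complex and s :: real
  assumes s: "s \<ge> 1" and ab: "norm (\<alpha> * \<beta>) = s\<^sup>2"
    and bd: "\<And>k. k \<ge> 1 \<Longrightarrow> norm (\<alpha> ^ (2 * k + 3) + \<beta> ^ (2 * k + 3)) \<le> 3 * s ^ (2 * k + 6) + 1"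
  shows "norm \<alpha> \<le> s"
proof (rule ccontr)
  assume "\<not> norm \<alpha> \<le> s"
  then have a: "norm \<alpha> > s" by simp
  define t where "t = norm \<alpha> / s"
  have t: "t > 1" using a s by (simp add: t_def)
  have b: "norm \<beta> \<le> s"
  proof (rule ccontr)
    assume "\<not> norm \<beta> \<le> s"
    then have "s * s < norm \<alpha> * norm \<beta>" using a s by (intro mult_strict_mono) auto
    then show False using ab by (simp add: norm_mult power2_eq_square)
  qed
  \<comment> \<open>The 5 collects the 3 of the bound, its summand 1 and the contribution of
    \<beta>.\<close>
  obtain n where n: "5 * s ^ 3 < t ^ n" using real_arch_pow[OF t] by blast
  define k where "k = Suc n"
  define m where "m = 2 * k + 3"
  have m6: "s ^ (2 * k + 6) = s ^ m * s ^ 3" by (simp add: m_def add_ac flip: power_add)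
  have sm: "s ^ m \<ge> 1" "s ^ 3 \<ge> 1" using s by (simp_all add: one_le_power)
  have "norm \<alpha> ^ m \<le> norm (\<alpha> ^ m + \<beta> ^ m) + norm (\<beta> ^ m)"
    using norm_triangle_ineq4[of "\<alpha> ^ m + \<beta> ^ m" "\<beta> ^ m"] by (simp add: norm_power)
  also have "\<dots> \<le> 3 * (s ^ m * s ^ 3) + 1 + s ^ m"
  proof (rule add_mono)
    have "k \<ge> 1" by (simp add: k_def)
    from bd[OF this] show "norm (\<alpha> ^ m + \<beta> ^ m) \<le> 3 * (s ^ m * s ^ 3) + 1"
      unfolding m6 m_def[symmetric] .
    show "norm (\<beta> ^ m) \<le> s ^ m" using b by (simp add: norm_power power_mono)
  qed
  also have "\<dots> \<le> 5 * (s ^ m * s ^ 3)"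
  proof -
    have "s ^ m * 1 \<le> s ^ m * s ^ 3" using sm by (intro mult_left_mono) auto
    then show ?thesis using sm by linarith
  qed
  finally have "t ^ m \<le> 5 * s ^ 3" using s by (simp add: t_def power_divide field_simps)
  moreover have "t ^ n \<le> t ^ m" using t by (intro power_increasing) (auto simp: m_def k_def)
  ultimately show False using n by linarith
qed

theorem weil_bound_field:
  fixes b :: "'a::{alg_closed_field,field_prime_char}"
  assumes \<psi>: "add_char \<psi>" and b: "b \<in> frob_fixed 1" "b \<noteq> 0"
  shows "norm (\<Sum>x\<in>frob_fixed 1 - {0}. \<psi> (x + b / x)) \<le> 2 * sqrt (real CHAR('a))"
proof -
  define S where "S = kloosterman_ext \<psi> b"
  define p where "p = CHAR('a)"
  define c where "c = L_coeff \<psi> b"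
  have c0: "c 0 = 1" and c2: "c 2 = of_nat p" and c3: "c (Suc (Suc (Suc m))) = 0" for m
    using L_coeff_0[OF \<psi>] L_coeff_2[OF \<psi> b] L_coeff_ge_3[OF \<psi> b(1)] by (simp_all add: c_def p_def)
  have N: "of_nat d * c d = (\<Sum>n=1..d. S n * c (d - n))" for d
    using L_function_recurrence[OF \<psi> b(1)] by (simp add: c_def S_def)
  have c1: "c 1 = S 1" using N[of 1] c0 by simp
  have S2: "2 * of_nat p = S 2 + S 1 * S 1"
    using N[of 2] c0 c1 c2 by (simp add: numeral_2_eq_2)
  have rec: "S (n + 3) + S (n + 2) * S 1 + S (n + 1) * of_nat p = 0" for n
  proof -
    have "(\<Sum>i=1..n + 3. S i * c (n + 3 - i)) = 0" using N[of "n + 3"] c3[of n] by (simp add: eval_nat_numeral)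
    also have "{1..n + 3} = {1..n} \<union> {n + 1, n + 2, n + 3}" by auto
    also have "(\<Sum>i\<in>\<dots>. S i * c (n + 3 - i)) = (\<Sum>i=1..n. S i * c (n + 3 - i)) + (\<Sum>i\<in>{n + 1, n + 2, n + 3}. S i * c (n + 3 - i))"
      by (rule sum.union_disjoint) auto
    also have "(\<Sum>i=1..n. S i * c (n + 3 - i)) = 0"
    proof (intro sum.neutral ballI)
      fix i assume "i \<in> {1..n}"
      then have "n + 3 - i = Suc (Suc (Suc (n - i)))" by auto
      then show "S i * c (n + 3 - i) = 0" using c3 by simp
    qed
    finally show ?thesis using c0 c1 c2 by (simp add: algebra_simps)
  qed
  \<comment> \<open>\<alpha> and \<beta> will be the roots of T^2 + S_1 T + p, hence the reciprocal
    roots of the L-function.\<close>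
  define D where "D = csqrt ((S 1)\<^sup>2 - 4 * of_nat p)"
  define \<alpha> where "\<alpha> = (- S 1 + D) / 2"
  define \<beta> where "\<beta> = (- S 1 - D) / 2"
  have ab: "\<alpha> + \<beta> = - S 1" "\<alpha> * \<beta> = of_nat p"
  proof -
    show "\<alpha> + \<beta> = - S 1" by (simp add: \<alpha>_def \<beta>_def field_simps)
    have "D\<^sup>2 = (S 1)\<^sup>2 - 4 * of_nat p" by (simp add: D_def)
    then show "\<alpha> * \<beta> = of_nat p" by (simp add: \<alpha>_def \<beta>_def field_simps power2_eq_square)
  qed
  have Sn: "S (Suc n) = - (\<alpha> ^ Suc n + \<beta> ^ Suc n)" for n
    by (rule power_sum_recurrence[OF S2 rec ab])
  define s where "s = sqrt (real p)"
  have s: "s \<ge> 1" "s\<^sup>2 = real p" using CHAR_ge_2[where 'a='a] by (simp_all add: s_def p_def)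
  have bd: "norm (\<alpha> ^ (2 * k + 3) + \<beta> ^ (2 * k + 3)) \<le> 3 * s ^ (2 * k + 6) + 1" if "k \<ge> 1" for k
  proof -
    have "S (2 * k + 3) = - (\<alpha> ^ (2 * k + 3) + \<beta> ^ (2 * k + 3))"
      using Sn[of "2 * k + 2"] by (simp add: eval_nat_numeral)
    then have "norm (\<alpha> ^ (2 * k + 3) + \<beta> ^ (2 * k + 3)) = norm (S (2 * k + 3))" by (simp only: norm_minus_cancel)
    also have "\<dots> \<le> 3 * real p ^ (k + 3) + 1"
      using kloosterman_ext_bound[OF that b(2,1) \<psi>] by (simp add: S_def p_def)
    also have "real p ^ (k + 3) = s ^ (2 * k + 6)"
      unfolding s(2)[symmetric] by (simp add: power_mult[symmetric] algebra_simps)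
    finally show ?thesis .
  qed
  have "norm (\<alpha> * \<beta>) = s\<^sup>2" unfolding ab s by simp
  then have "norm \<alpha> \<le> s" "norm \<beta> \<le> s"
    using root_bound_from_growth[OF s(1), of \<alpha> \<beta>] root_bound_from_growth[OF s(1), of \<beta> \<alpha>] bd
    by (simp_all add: mult.commute add.commute)
  moreover have "norm (S 1) \<le> norm \<alpha> + norm \<beta>" 
    using norm_triangle_ineq[of \<alpha> \<beta>] unfolding ab(1) by simp
  moreover have "S 1 = (\<Sum>x\<in>frob_fixed 1 - {0}. \<psi> (x + b / x))"
    unfolding S_def kloosterman_ext_def frob_trace_def by simp
  ultimately show ?thesis by (simp add: s_def p_def)
qed

section \<open>Kloosterman sums to composite moduli\<close>

definition ee :: "int \<Rightarrow> int \<Rightarrow> complex" where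
  "ee a q = cis (2 * pi * (of_int a / of_int q))"

lemma ee_0 [simp]: "ee 0 q = 1"
  by (simp add: ee_def)

lemma norm_ee [simp]: "norm (ee a q) = 1"
  by (simp add: ee_def)

lemma ee_add: "ee (a + b) q = ee a q * ee b q"
  by (simp add: ee_def cis_mult add_divide_distrib distrib_left)

lemma ee_mult_left: "k \<noteq> 0 \<Longrightarrow> ee (k * a) (k * q) = ee a q"
  by (simp add: ee_def)

lemma cis_2pi_int: "cis (2 * pi * of_int k) = 1"
  by (metis cis_conv_exp exp_two_pi_i' Re_complex_of_real cis_multiple_2pi Ints_of_int)

lemma ee_eq_1:
  assumes "q dvd a"
  shows "ee a q = 1"
proof -
  obtain k where "a = q * k" using assms by (rule dvdE)
  then have "ee a q = cis (2 * pi * of_int k) \<or> q = 0" by (simp add: ee_def)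
  then show ?thesis using cis_2pi_int[of k] by (auto simp: ee_def)
qed

lemma ee_cong:
  assumes "[a = b] (mod q)"
  shows "ee a q = ee b q"
proof -
  have "ee a q = ee (a - b) q * ee b q" by (simp flip: ee_add)
  then show ?thesis using assms by (simp add: ee_eq_1 cong_iff_dvd_diff)
qed

lemma ee_eq_1_iff:
  assumes "q \<noteq> 0"
  shows "ee a q = 1 \<longleftrightarrow> q dvd a"
proof
  assume "ee a q = 1"
  then have "exp (\<i> * of_real (2 * pi * (of_int a / of_int q))) = 1" by (simp add: ee_def cis_conv_exp)
  then obtain n :: int where "2 * pi * (of_int a / of_int q) = of_int (2 * n) * pi"
    unfolding exp_eq_1 by auto
  then have "(of_int a :: real) = of_int (n * q)" using assms by (simp add: field_simps)
  then have "a = n * q" by (simp only: of_int_eq_iff)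
  then show "q dvd a" by simp
qed (rule ee_eq_1)

lemma sum_periodic_shift:
  fixes q :: int
  assumes "q > 0" "\<And>t. f (t mod q) = f t"
  shows "(\<Sum>t\<in>{0..<q}. f (t + b)) = (\<Sum>t\<in>{0..<q}. f t)"
  by (rule sum.reindex_bij_witness[of _ "\<lambda>t. (t - b) mod q" "\<lambda>t. (t + b) mod q"])
    (use assms in \<open>auto simp: mod_simps\<close>)

lemma sum_ee:
  assumes "q > 0"
  shows "(\<Sum>t\<in>{0..<q}. ee (a * t) q) = (if q dvd a then of_int q else 0)"
proof (cases "q dvd a")
  case True
  then show ?thesis using assms by (simp add: ee_eq_1)
next
  case False
  have "(\<Sum>t\<in>{0..<q}. ee (a * t) q) = (\<Sum>t\<in>{0..<q}. ee (a * (t + 1)) q)"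
  proof (rule sum_periodic_shift[symmetric, OF assms])
    show "ee (a * (t mod q)) q = ee (a * t) q" for t by (intro ee_cong cong_scalar_left) simp
  qed
  also have "\<dots> = (\<Sum>t\<in>{0..<q}. ee (a * t) q) * ee a q"
    by (simp add: distrib_left ee_add sum_distrib_right)
  finally show ?thesis using False ee_eq_1_iff[of q a] assms by simp
qed

text \<open>Pairs instead of a chosen inverse make the two arguments of a Kloosterman sum symmetric
  and let a substitution by units act on both at once. For q = 1 the only pair is (0, 0).\<close>

definition unit_pairs :: "int \<Rightarrow> (int \<times> int) set" where
  "unit_pairs q = {(u, v). 0 \<le> u \<and> u < q \<and> 0 \<le> v \<and> v < q \<and> [u * v = 1] (mod q)}"

lemma finite_unit_pairs [simp]: "finite (unit_pairs q)"
proof (rule finite_subset)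
  show "unit_pairs q \<subseteq> {0..<q} \<times> {0..<q}" by (auto simp: unit_pairs_def)
qed simp

lemma cong_inverse_unique:
  fixes u :: int
  assumes "[u * v = 1] (mod q)" "[u' * v' = 1] (mod q)" "[u = u'] (mod q)"
  shows "[v = v'] (mod q)"
proof -
  have "[u * v' = u' * v'] (mod q)" using assms(3) by (rule cong_scalar_right)
  then have 1: "[u * v' = 1] (mod q)" using assms(2) cong_trans by blast
  have "[v * (u * v') = v * 1] (mod q)" using 1 by (rule cong_scalar_left)
  moreover have "[v' * (u * v) = v' * 1] (mod q)" using assms(1) by (rule cong_scalar_left)
  moreover have "v * (u * v') = v' * (u * v)" by simp
  ultimately show ?thesis by (metis cong_sym cong_trans mult.right_neutral)
qed

lemma cong_less_imp_eq: "0 \<le> u \<Longrightarrow> u < q \<Longrightarrow> 0 \<le> v \<Longrightarrow> v < q \<Longrightarrow> [u = v] (mod q) \<Longrightarrow> u = (v::int)"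
  by (simp add: Cong.cong_def)

lemma unit_pairs_unique:
  "(u, v) \<in> unit_pairs q \<Longrightarrow> (u, v') \<in> unit_pairs q \<Longrightarrow> v = v'"
  "(u, v) \<in> unit_pairs q \<Longrightarrow> (u', v) \<in> unit_pairs q \<Longrightarrow> u = u'"
  using cong_inverse_unique[of u v q u v'] cong_inverse_unique[of v u q v u']
  by (auto simp: unit_pairs_def mult.commute intro!: cong_less_imp_eq[of _ q])

lemma unit_pairs_cong: "q > 0 \<Longrightarrow> [a * b = 1] (mod q) \<Longrightarrow> (a mod q, b mod q) \<in> unit_pairs q"
  by (simp add: unit_pairs_def Cong.cong_def mod_simps)

lemma unit_pairs_coprime:
  assumes "(u, v) \<in> unit_pairs q"
  shows "coprime u q" "coprime v q"
  using assms coprime_iff_invertible_int[of u q] coprime_iff_invertible_int[of v q]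
  by (auto simp: unit_pairs_def mult.commute)

lemma unit_pairs_scale:
  fixes q :: int
  assumes q: "q > 0" and w: "[w * w' = 1] (mod q)"
    and per: "\<And>u v. f (u mod q) (v mod q) = f u v"
  shows "(\<Sum>(u, v)\<in>unit_pairs q. f (w * u) (w' * v)) = (\<Sum>(u, v)\<in>unit_pairs q. f u v)"
proof -
  have cong: "[w * u * (w' * v) = 1] (mod q)" "[w' * u * (w * v) = 1] (mod q)" if "[u * v = 1] (mod q)" for u v
  proof -
    have "[(w * w') * (u * v) = 1 * 1] (mod q)" using w that by (rule cong_mult)
    then show "[w * u * (w' * v) = 1] (mod q)" "[w' * u * (w * v) = 1] (mod q)" by (simp_all add: mult_ac)
  qed
  have can: "(w' * (w * u mod q)) mod q = u mod q" "(w * (w' * u mod q)) mod q = u mod q" for u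
  proof -
    have "[w * w' * u = 1 * u] (mod q)" using w by (rule cong_scalar_right)
    then show "(w' * (w * u mod q)) mod q = u mod q" "(w * (w' * u mod q)) mod q = u mod q"
      by (simp_all add: mod_simps Cong.cong_def mult_ac)
  qed
  show ?thesis
  proof (rule sum.reindex_bij_witness[of _ "\<lambda>(u, v). (w' * u mod q, w * v mod q)" "\<lambda>(u, v). (w * u mod q, w' * v mod q)"], goal_cases)
    case (1 a)
    then show ?case using can by (auto simp: unit_pairs_def)
  next
    case (2 a)
    then show ?case using cong q by (auto simp: unit_pairs_def intro!: unit_pairs_cong[unfolded unit_pairs_def, simplified])
  next
    case (3 b)
    then show ?case using can by (auto simp: unit_pairs_def)
  next
    case (4 b)
    then show ?case using cong q by (auto simp: unit_pairs_def intro!: unit_pairs_cong[unfolded unit_pairs_def, simplified])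
  next
    case (5 a)
    then show ?case by (cases a) (simp add: per)
  qed
qed

definition kloosterman :: "int \<Rightarrow> int \<Rightarrow> int \<Rightarrow> complex" where
  "kloosterman q m n = (\<Sum>(u, v)\<in>unit_pairs q. ee (m * u + n * v) q)"

lemma kloosterman_commute: "kloosterman q m n = kloosterman q n m"
  unfolding kloosterman_def
  by (rule sum.reindex_bij_witness[of _ prod.swap prod.swap]) (auto simp: unit_pairs_def mult.commute add.commute)

lemma card_unit_pairs_le: "q > 0 \<Longrightarrow> int (card (unit_pairs q)) \<le> q"
proof -
  have "inj_on fst (unit_pairs q)"
    by (auto simp: inj_on_def dest: unit_pairs_unique(1))
  then have "card (unit_pairs q) \<le> card {0..<q}"
    by (rule card_inj_on_le) (auto simp: unit_pairs_def)
  then show "q > 0 \<Longrightarrow> ?thesis" by simp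
qed

lemma kloosterman_trivial_bound: "q > 0 \<Longrightarrow> norm (kloosterman q m n) \<le> of_int q"
proof -
  assume q: "q > 0"
  have "norm (kloosterman q m n) \<le> (\<Sum>(u, v)\<in>unit_pairs q. 1)"
    unfolding kloosterman_def by (rule sum_norm_le) auto
  also have "\<dots> = real (card (unit_pairs q))" by simp
  also have "\<dots> \<le> of_int q" using card_unit_pairs_le[OF q] by (metis of_int_le_iff of_int_of_nat_eq)
  finally show ?thesis .
qed

lemma kloosterman_periodic:
  "ee (m * (u mod q) + n * (v mod q)) q = ee (m * u + n * v) q"
  by (intro ee_cong cong_add cong_scalar_left) simp_all

text \<open>The averaging here is the \<open>p\<close>-adic analogue of the method of stationary phase: the sum is
  invariant under \<open>(u, v) \<mapsto> (u \<epsilon>, v / \<epsilon>)\<close>, and the average over \<open>\<epsilon> = 1 + c t\<close> only retains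
  the critical points.\<close>

lemma kloosterman_stationary:
  fixes c r m n :: int
  assumes c: "c > 0" and r: "r > 0" and dvd: "c * r dvd c\<^sup>2"
  shows "kloosterman (c * r) m n =
    (\<Sum>(u, v)\<in>unit_pairs (c * r). if r dvd m * u - n * v then ee (m * u + n * v) (c * r) else 0)"
proof -
  define q where "q = c * r"
  have q: "q > 0" using c r by (simp add: q_def)
  have "kloosterman q m n = (\<Sum>(u, v)\<in>unit_pairs q. ee (m * u + n * v) q * ee ((m * u - n * v) * t) r)" for t
  proof -
    \<comment> \<open>As q divides c^2, the inverse of 1 + c t is linear in t, and so is the change
      of the phase.\<close>
    have "[(1 + c * t) * (1 - c * t) = 1] (mod q)"
    proof -
      have "(1 + c * t) * (1 - c * t) - 1 = - (c\<^sup>2 * t\<^sup>2)" by (simp add: power2_eq_square algebra_simps)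
      then show ?thesis using dvd unfolding cong_iff_dvd_diff q_def by simp
    qed
    then have "kloosterman q m n = (\<Sum>(u, v)\<in>unit_pairs q. ee (m * ((1 + c * t) * u) + n * ((1 - c * t) * v)) q)"
      unfolding kloosterman_def
      by (rule unit_pairs_scale[OF q, where f = "\<lambda>u v. ee (m * u + n * v) q", OF _ kloosterman_periodic, symmetric])
    also have "\<dots> = (\<Sum>(u, v)\<in>unit_pairs q. ee (m * u + n * v) q * ee ((m * u - n * v) * t) r)"
    proof (intro sum.cong refl, clarify)
      fix u v
      have "m * ((1 + c * t) * u) + n * ((1 - c * t) * v) = (m * u + n * v) + c * ((m * u - n * v) * t)"
        by (simp add: algebra_simps)
      then show "ee (m * ((1 + c * t) * u) + n * ((1 - c * t) * v)) q = ee (m * u + n * v) q * ee ((m * u - n * v) * t) r"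
        using ee_mult_left[of c "(m * u - n * v) * t" r] c by (simp add: ee_add q_def)
    qed
    finally show ?thesis .
  qed
  then have "(\<Sum>t\<in>{0..<r}. kloosterman q m n) = (\<Sum>t\<in>{0..<r}. \<Sum>(u, v)\<in>unit_pairs q. ee (m * u + n * v) q * ee ((m * u - n * v) * t) r)"
    by (intro sum.cong refl)
  also have "\<dots> = (\<Sum>(u, v)\<in>unit_pairs q. \<Sum>t\<in>{0..<r}. ee (m * u + n * v) q * ee ((m * u - n * v) * t) r)"
    by (subst sum.swap) (simp add: case_prod_unfold)
  also have "\<dots> = (\<Sum>(u, v)\<in>unit_pairs q. of_int r * (if r dvd m * u - n * v then ee (m * u + n * v) q else 0))"
    by (intro sum.cong refl) (auto simp: sum_ee[OF r] simp flip: sum_distrib_left)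
  also have "\<dots> = of_int r * (\<Sum>(u, v)\<in>unit_pairs q. if r dvd m * u - n * v then ee (m * u + n * v) q else 0)"
    by (simp add: sum_distrib_left case_prod_unfold)
  finally show ?thesis unfolding q_def[symmetric] using r by simp
qed

section \<open>Quadratic Gauss sums and odd powers of a prime\<close>

definition gauss_sum :: "int \<Rightarrow> int \<Rightarrow> int \<Rightarrow> complex" where
  "gauss_sum p a b = (\<Sum>t\<in>{0..<p}. ee (a * t\<^sup>2 + b * t) p)"

lemma cnj_ee: "cnj (ee a q) = ee (- a) q"
  by (simp add: ee_def cis_cnj)

text \<open>In the square of the norm, the shift t + s in one factor leaves a phase linear in s with
  frequency 2 a t; its sum over s vanishes unless t = 0.\<close>

lemma norm_gauss_sum:
  assumes p: "p > 0" and cop: "coprime (2 * a) p"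
  shows "norm (gauss_sum p a b) = sqrt (of_int p)"
proof -
  define f where "f = (\<lambda>t. ee (a * t\<^sup>2 + b * t) p)"
  have per: "f (t mod p) = f t" for t unfolding f_def
    by (intro ee_cong cong_add cong_scalar_left cong_pow) simp_all
  have "of_real ((norm (gauss_sum p a b))\<^sup>2) = gauss_sum p a b * cnj (gauss_sum p a b)"
    by (simp add: complex_norm_square[symmetric])
  also have "\<dots> = (\<Sum>s\<in>{0..<p}. (\<Sum>t\<in>{0..<p}. f t) * cnj (f s))"
    unfolding gauss_sum_def f_def[symmetric] by (simp add: sum_distrib_left)
  also have "\<dots> = (\<Sum>s\<in>{0..<p}. (\<Sum>t\<in>{0..<p}. f (t + s)) * cnj (f s))"
    by (subst sum_periodic_shift[where f = f]) (simp_all only: p per)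
  also have "\<dots> = (\<Sum>s\<in>{0..<p}. \<Sum>t\<in>{0..<p}. f t * ee (2 * a * t * s) p)"
  proof (intro sum.cong refl)
    fix s
    have "f (t + s) * cnj (f s) = f t * ee (2 * a * t * s) p" for t
      unfolding f_def cnj_ee ee_add[symmetric] by (rule arg_cong[where f = "\<lambda>x. ee x p"]) (simp add: power2_eq_square algebra_simps)
    then show "(\<Sum>t\<in>{0..<p}. f (t + s)) * cnj (f s) = (\<Sum>t\<in>{0..<p}. f t * ee (2 * a * t * s) p)"
      by (simp add: sum_distrib_right)
  qed
  also have "\<dots> = (\<Sum>t\<in>{0..<p}. f t * (\<Sum>s\<in>{0..<p}. ee (2 * a * t * s) p))"
    by (subst sum.swap) (simp add: sum_distrib_left)
  also have "\<dots> = (\<Sum>t\<in>{0..<p}. if t = 0 then of_int p else 0)"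
  proof (intro sum.cong refl)
    fix t assume t: "t \<in> {0..<p}"
    have "p dvd 2 * a * t \<longleftrightarrow> p dvd t" using cop by (simp add: coprime_commute coprime_dvd_mult_right_iff)
    also have "\<dots> \<longleftrightarrow> t = 0" using t zdvd_not_zless[of t p] by (cases "t = 0") auto
    finally show "f t * (\<Sum>s\<in>{0..<p}. ee (2 * a * t * s) p) = (if t = 0 then of_int p else 0)"
      by (simp add: sum_ee[OF p] f_def)
  qed
  also have "\<dots> = of_int p" using p by (simp add: sum.delta)
  finally have "(norm (gauss_sum p a b))\<^sup>2 = of_int p" by (metis of_real_eq_iff of_real_of_int_eq)
  then show ?thesis by (metis norm_ge_zero real_sqrt_unique)
qed

text \<open>For q = p r^2 the localisation with c = p r alone loses a factor sqrt(p). A second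
  average, over \<epsilon> = 1 + r t, keeps the quadratic term of the phase and produces a Gauss sum
  mod p, which wins this factor back.\<close>

lemma kloosterman_stationary_odd:
  fixes p r m n :: int
  assumes p: "p > 0" and r: "r > 0" and dvd: "p dvd r"
  defines "q \<equiv> p * r * r"
  shows "of_int p * kloosterman q m n =
    (\<Sum>(u, v)\<in>unit_pairs q. if r dvd m * u - n * v then ee (m * u + n * v) q * gauss_sum p (n * v) ((m * u - n * v) div r) else 0)"
proof -
  have q: "q > 0" using p r by (simp add: q_def)
  define f where "f = (\<lambda>u v. if r dvd m * u - n * v then ee (m * u + n * v) q else 0)"
  have rq: "r dvd q" by (simp add: q_def)
  have per: "f (u mod q) (v mod q) = f u v" for u v
  proof -
    have "[m * (u mod q) - n * (v mod q) = m * u - n * v] (mod q)"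
      by (intro cong_diff cong_scalar_left) simp_all
    then have "[m * (u mod q) - n * (v mod q) = m * u - n * v] (mod r)" using rq cong_dvd_modulus by blast
    then have "r dvd m * (u mod q) - n * (v mod q) \<longleftrightarrow> r dvd m * u - n * v" by (rule cong_dvd_iff[rotated]) 
    then show ?thesis by (simp add: f_def kloosterman_periodic)
  qed
  have K: "kloosterman q m n = (\<Sum>(u, v)\<in>unit_pairs q. f u v)"
    using kloosterman_stationary[of "p * r" r m n] p r unfolding f_def q_def by (simp add: power2_eq_square mult_ac)
  have "kloosterman q m n = (\<Sum>(u, v)\<in>unit_pairs q. if r dvd m * u - n * v then ee (m * u + n * v) q * ee (n * v * t\<^sup>2 + (m * u - n * v) div r * t) p else 0)" for t
  proof -
    define w where "w = 1 + r * t"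
    \<comment> \<open>The inverse of 1 + r t to second order; the error r^3 t^3 vanishes mod q
      because p divides r.\<close>
    define w' where "w' = 1 - r * t + r * r * (t * t)"
    have "[w * w' = 1] (mod q)"
    proof -
      have "w * w' - 1 = r * r * r * (t * t * t)" by (simp add: w_def w'_def algebra_simps)
      moreover obtain z where "r = p * z" using dvd by (auto elim: dvdE)
      then have "q dvd r * r * r" by (simp add: q_def)
      ultimately show ?thesis unfolding cong_iff_dvd_diff by (metis dvd_mult2)
    qed
    then have "kloosterman q m n = (\<Sum>(u, v)\<in>unit_pairs q. f (w * u) (w' * v))"
      unfolding K by (rule unit_pairs_scale[where f = f, OF q _ per, symmetric])
    also have "\<dots> = (\<Sum>(u, v)\<in>unit_pairs q. if r dvd m * u - n * v then ee (m * u + n * v) q * ee (n * v * t\<^sup>2 + (m * u - n * v) div r * t) p else 0)"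
    proof (intro sum.cong refl, clarify)
      fix u v
      have 1: "m * (w * u) - n * (w' * v) = (m * u - n * v) + r * (m * t * u + n * t * v - n * r * (t * t) * v)"
        by (simp add: w_def w'_def algebra_simps)
      have iff: "r dvd m * (w * u) - n * (w' * v) \<longleftrightarrow> r dvd m * u - n * v" unfolding 1 by (simp add: dvd_add_left_iff)
      have 2: "m * (w * u) + n * (w' * v) = (m * u + n * v) + r * r * (n * v * t\<^sup>2 + (m * u - n * v) div r * t)"
        if "r dvd m * u - n * v"
      proof -
        from that have "r * ((m * u - n * v) div r) = m * u - n * v" by simp
        then have "r * r * ((m * u - n * v) div r * t) = r * t * (m * u - n * v)" by (metis mult.assoc mult.commute)
        then show ?thesis by (simp add: w_def w'_def power2_eq_square algebra_simps)
      qed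
      have "ee (r * r * x) q = ee x p" for x
        using ee_mult_left[of "r * r" x p] r by (simp add: q_def mult_ac)
      then show "f (w * u) (w' * v) = (if r dvd m * u - n * v then ee (m * u + n * v) q * ee (n * v * t\<^sup>2 + (m * u - n * v) div r * t) p else 0)"
        unfolding f_def iff using 2 by (simp add: ee_add)
    qed
    finally show ?thesis .
  qed
  then have "(\<Sum>t\<in>{0..<p}. kloosterman q m n) = (\<Sum>t\<in>{0..<p}. \<Sum>(u, v)\<in>unit_pairs q. if r dvd m * u - n * v then ee (m * u + n * v) q * ee (n * v * t\<^sup>2 + (m * u - n * v) div r * t) p else 0)"
    by (intro sum.cong refl)
  also have "\<dots> = (\<Sum>(u, v)\<in>unit_pairs q. \<Sum>t\<in>{0..<p}. if r dvd m * u - n * v then ee (m * u + n * v) q * ee (n * v * t\<^sup>2 + (m * u - n * v) div r * t) p else 0)"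
    by (subst sum.swap) (simp add: case_prod_unfold)
  also have "\<dots> = (\<Sum>(u, v)\<in>unit_pairs q. if r dvd m * u - n * v then ee (m * u + n * v) q * gauss_sum p (n * v) ((m * u - n * v) div r) else 0)"
    by (intro sum.cong refl) (auto simp: gauss_sum_def simp flip: sum_distrib_left)
  finally show ?thesis using p by simp
qed

section \<open>Common factors and the Chinese remainder theorem\<close>

lemma div_less_of_less_mult:
  fixes u p q :: int
  assumes "0 < q" "u < p * q"
  shows "u div q < p"
proof -
  have "(u div q) * q \<le> u" using assms(1) pos_mod_sign[of q u] div_mult_mod_eq[of u q] by linarith
  then have "(u div q) * q < p * q" using assms(2) by linarith
  then show ?thesis using assms(1) by (simp add: mult_less_cancel_right_disj)
qed

text \<open>As p divides q, every residue mod p q above a unit mod q is a unit. So reduction of unit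
  pairs has fibres of p elements, indexed by the quotient of u by q.\<close>

lemma kloosterman_reduce:
  fixes p q m n :: int
  assumes p: "p > 0" and q: "q > 0" and dvd: "p dvd q"
  shows "kloosterman (p * q) (p * m) (p * n) = of_int p * kloosterman q m n"
proof -
  define Q where "Q = p * q"
  have Q: "Q > 0" using p q by (simp add: Q_def)
  define g where "g = (\<lambda>(u, v). (u mod q, v mod q))"
  have img: "g ` unit_pairs Q \<subseteq> unit_pairs q"
  proof
    fix z assume "z \<in> g ` unit_pairs Q"
    then obtain u v where z: "z = (u mod q, v mod q)" "[u * v = 1] (mod Q)" by (auto simp: g_def unit_pairs_def)
    then have "[u * v = 1] (mod q)" using cong_dvd_modulus[of "u * v" 1 Q q] by (simp add: Q_def)
    then show "z \<in> unit_pairs q" unfolding z(1) by (rule unit_pairs_cong[OF q])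
  qed
  have fibre: "card {x \<in> unit_pairs Q. g x = (a, b)} = nat p" if ab: "(a, b) \<in> unit_pairs q" for a b
  proof -
    have a: "0 \<le> a" "a < q" using ab by (auto simp: unit_pairs_def)
    have "bij_betw (\<lambda>(u, v). u div q) {x \<in> unit_pairs Q. g x = (a, b)} {0..<p}"
      unfolding bij_betw_def
    proof
      show "inj_on (\<lambda>(u, v). u div q) {x \<in> unit_pairs Q. g x = (a, b)}"
      proof (rule inj_onI)
        fix x y assume x: "x \<in> {x \<in> unit_pairs Q. g x = (a, b)}" and y: "y \<in> {x \<in> unit_pairs Q. g x = (a, b)}"
          and eq: "(\<lambda>(u, v). u div q) x = (\<lambda>(u, v). u div q) y"
        obtain u v u' v' where xy: "x = (u, v)" "y = (u', v')" by (metis surj_pair)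
        have "u = u'" using x y eq by (metis (mono_tags, lifting) xy g_def case_prod_conv mem_Collect_eq prod.inject div_mult_mod_eq)
        then show "x = y" using x y unit_pairs_unique(1) by (auto simp: xy)
      qed
      show "(\<lambda>(u, v). u div q) ` {x \<in> unit_pairs Q. g x = (a, b)} = {0..<p}"
      proof (intro equalityI subsetI)
        fix s assume "s \<in> (\<lambda>(u, v). u div q) ` {x \<in> unit_pairs Q. g x = (a, b)}"
        then obtain u v where "s = u div q" "0 \<le> u" "u < Q" by (auto simp: unit_pairs_def)
        then show "s \<in> {0..<p}" using q by (auto simp: Q_def pos_imp_zdiv_nonneg_iff div_less_of_less_mult)
      next
        fix s assume s: "s \<in> {0..<p}"
        define u where "u = a + q * s"
        have "coprime a q" using unit_pairs_coprime[OF ab] by simp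
        then have "coprime u q" unfolding u_def by (metis coprime_iff_gcd_eq_1 gcd_add_mult mult.commute add.commute gcd.commute)
        then have "coprime u Q" unfolding Q_def using dvd by (metis coprime_mult_right_iff coprime_divisors dvd_refl)
        then have cop: "[u * modular_inverse Q u = 1] (mod Q)" by (rule cong_modular_inverse1)
        define v where "v = modular_inverse Q u"
        have range: "0 \<le> v" "v < Q" using Q by (simp_all add: v_def modular_inverse_int_nonneg modular_inverse_int_less)
        have "q * s \<le> q * (p - 1)" using s q by (intro mult_left_mono) auto
        then have u: "0 \<le> u" "u < Q" using a s q by (auto simp: u_def Q_def algebra_simps)
        have uv: "(u, v) \<in> unit_pairs Q" using cop range u by (simp add: unit_pairs_def v_def)
        have um: "u mod q = a" "u div q = s" using a q by (simp_all add: u_def)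
        have "(a, v mod q) \<in> unit_pairs q" using img uv um by (force simp: g_def)
        then have "v mod q = b" using unit_pairs_unique(1) ab by blast
        then have "(u, v) \<in> {x \<in> unit_pairs Q. g x = (a, b)}" using uv um by (simp add: g_def)
        then show "s \<in> (\<lambda>(u, v). u div q) ` {x \<in> unit_pairs Q. g x = (a, b)}"
          using um by force
      qed
    qed
    then show ?thesis by (simp add: bij_betw_same_card)
  qed
  have "kloosterman Q (p * m) (p * n) = (\<Sum>x\<in>unit_pairs Q. ee (m * fst (g x) + n * snd (g x)) q)"
    unfolding kloosterman_def
  proof (intro sum.cong refl, clarify)
    fix u v
    have "ee (p * m * u + p * n * v) Q = ee (p * (m * u + n * v)) (p * q)" by (simp add: Q_def algebra_simps)
    also have "\<dots> = ee (m * u + n * v) q" using p by (intro ee_mult_left) simp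
    also have "\<dots> = ee (m * (u mod q) + n * (v mod q)) q" by (simp add: kloosterman_periodic)
    finally show "ee (p * m * u + p * n * v) Q = ee (m * fst (g (u, v)) + n * snd (g (u, v))) q" by (simp add: g_def)
  qed
  also have "\<dots> = (\<Sum>y\<in>unit_pairs q. \<Sum>x | x \<in> unit_pairs Q \<and> g x = y. ee (m * fst (g x) + n * snd (g x)) q)"
    by (rule sum.group[symmetric, OF _ _ img]) simp_all
  also have "\<dots> = (\<Sum>y\<in>unit_pairs q. \<Sum>x | x \<in> unit_pairs Q \<and> g x = y. ee (m * fst y + n * snd y) q)"
    by (intro sum.cong refl) auto
  also have "\<dots> = (\<Sum>y\<in>unit_pairs q. of_int p * ee (m * fst y + n * snd y) q)"
  proof (intro sum.cong refl)
    fix y assume "y \<in> unit_pairs q"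
    then show "(\<Sum>x | x \<in> unit_pairs Q \<and> g x = y. ee (m * fst y + n * snd y) q) = of_int p * ee (m * fst y + n * snd y) q"
      using fibre[of "fst y" "snd y"] p by simp
  qed
  finally show ?thesis unfolding kloosterman_def Q_def by (simp add: sum_distrib_left case_prod_unfold)
qed

text \<open>Twisted multiplicativity, from 1 / (q1 q2) = a2 / q1 + a1 / q2 modulo 1, where a2
  inverts q2 mod q1 and a1 inverts q1 mod q2.\<close>

lemma kloosterman_crt:
  fixes q1 q2 :: int
  assumes q: "q1 > 0" "q2 > 0" and cop: "coprime q1 q2"
  obtains a1 a2 where "coprime a2 q1" "coprime a1 q2"
    "\<And>m n. kloosterman (q1 * q2) m n = kloosterman q1 (a2 * m) (a2 * n) * kloosterman q2 (a1 * m) (a1 * n)"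
proof -
  obtain a2 where a2: "[q2 * a2 = 1] (mod q1)" using cop cong_solve_coprime_int coprime_commute by blast
  obtain a1 where a1: "[q1 * a1 = 1] (mod q2)" using cop cong_solve_coprime_int by blast
  have cops: "coprime a2 q1" "coprime a1 q2"
    using a1 a2 coprime_iff_invertible_int[of a2 q1] coprime_iff_invertible_int[of a1 q2] by (auto simp: mult.commute)
  have split1: "[q1 * a1 + q2 * a2 = 1] (mod q1 * q2)"
  proof (rule coprime_cong_mult[OF _ _ cop])
    have "[q1 * a1 + q2 * a2 = 0 + 1] (mod q1)" by (intro cong_add a2) (simp add: cong_0_iff)
    then show "[q1 * a1 + q2 * a2 = 1] (mod q1)" by simp
    have "[q1 * a1 + q2 * a2 = 1 + 0] (mod q2)" by (intro cong_add a1) (simp add: cong_0_iff)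
    then show "[q1 * a1 + q2 * a2 = 1] (mod q2)" by simp
  qed
  have ee: "ee x (q1 * q2) = ee (a2 * x) q1 * ee (a1 * x) q2" for x
  proof -
    have "[(q1 * a1 + q2 * a2) * x = 1 * x] (mod q1 * q2)" using split1 by (rule cong_scalar_right)
    then have "ee x (q1 * q2) = ee ((q1 * a1 + q2 * a2) * x) (q1 * q2)" by (intro ee_cong) (simp add: cong_sym)
    also have "(q1 * a1 + q2 * a2) * x = q1 * (a1 * x) + q2 * (a2 * x)" by (simp add: algebra_simps)
    also have "ee \<dots> (q1 * q2) = ee (a1 * x) q2 * ee (q2 * (a2 * x)) (q2 * q1)"
      using q by (simp add: ee_add ee_mult_left mult.commute[of q2 q1])
    also have "ee (q2 * (a2 * x)) (q2 * q1) = ee (a2 * x) q1" using q by (intro ee_mult_left) simp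
    finally show ?thesis by simp
  qed
  define h where "h = (\<lambda>(u, v). ((u mod q1, v mod q1), (u mod q2, v mod q2)))"
  have bij: "bij_betw h (unit_pairs (q1 * q2)) (unit_pairs q1 \<times> unit_pairs q2)"
    unfolding bij_betw_def
  proof
    show "inj_on h (unit_pairs (q1 * q2))"
    proof (rule inj_onI)
      fix x y assume x: "x \<in> unit_pairs (q1 * q2)" and y: "y \<in> unit_pairs (q1 * q2)" and eq: "h x = h y"
      obtain u v u' v' where xy: "x = (u, v)" "y = (u', v')" by (metis surj_pair)
      have "[u = u'] (mod q1 * q2)" "[v = v'] (mod q1 * q2)"
        using eq cop by (auto simp: h_def xy Cong.cong_def[symmetric] intro!: coprime_cong_mult)
      then show "x = y" using x y by (auto simp: xy unit_pairs_def intro: cong_less_imp_eq[of _ "q1 * q2"])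
    qed
    show "h ` unit_pairs (q1 * q2) = unit_pairs q1 \<times> unit_pairs q2"
    proof (intro equalityI subsetI)
      fix z assume "z \<in> h ` unit_pairs (q1 * q2)"
      then obtain u v where z: "z = h (u, v)" "[u * v = 1] (mod q1 * q2)" by (auto simp: unit_pairs_def)
      have "[u * v = 1] (mod q1)" "[u * v = 1] (mod q2)"
        using z(2) by (auto intro: cong_dvd_modulus)
      then show "z \<in> unit_pairs q1 \<times> unit_pairs q2" using q by (simp add: z(1) h_def unit_pairs_cong)
    next
      fix z assume "z \<in> unit_pairs q1 \<times> unit_pairs q2"
      then obtain a b c d where z: "z = ((a, b), (c, d))" "(a, b) \<in> unit_pairs q1" "(c, d) \<in> unit_pairs q2" by auto
      obtain u where u: "[u = a] (mod q1)" "[u = c] (mod q2)" using binary_chinese_remainder_int[OF cop] by blast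
      obtain v where v: "[v = b] (mod q1)" "[v = d] (mod q2)" using binary_chinese_remainder_int[OF cop] by blast
      have ab: "0 \<le> a" "a < q1" "0 \<le> b" "b < q1" "[a * b = 1] (mod q1)"
        and cd: "0 \<le> c" "c < q2" "0 \<le> d" "d < q2" "[c * d = 1] (mod q2)"
        using z by (auto simp: unit_pairs_def)
      have "[u * v = 1] (mod q1)" using cong_trans[OF cong_mult[OF u(1) v(1)] ab(5)] .
      moreover have "[u * v = 1] (mod q2)" using cong_trans[OF cong_mult[OF u(2) v(2)] cd(5)] .
      ultimately have "[u * v = 1] (mod q1 * q2)" using cop by (rule coprime_cong_mult)
      then have mem: "(u mod (q1 * q2), v mod (q1 * q2)) \<in> unit_pairs (q1 * q2)"
        using q by (intro unit_pairs_cong) auto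
      have "h (u mod (q1 * q2), v mod (q1 * q2)) = z"
        using u v ab cd by (simp add: h_def z(1) Cong.cong_def mod_mod_cancel)
      then show "z \<in> h ` unit_pairs (q1 * q2)" using mem by force
    qed
  qed
  have "kloosterman (q1 * q2) m n = kloosterman q1 (a2 * m) (a2 * n) * kloosterman q2 (a1 * m) (a1 * n)" for m n
  proof -
    have "kloosterman q1 (a2 * m) (a2 * n) * kloosterman q2 (a1 * m) (a1 * n)
      = (\<Sum>(x, y)\<in>unit_pairs q1 \<times> unit_pairs q2. ee (a2 * m * fst x + a2 * n * snd x) q1 * ee (a1 * m * fst y + a1 * n * snd y) q2)"
      unfolding kloosterman_def by (simp add: sum_product sum.cartesian_product case_prod_unfold)
    also have "\<dots> = (\<Sum>z\<in>unit_pairs (q1 * q2). (case h z of (x, y) \<Rightarrow> ee (a2 * m * fst x + a2 * n * snd x) q1 * ee (a1 * m * fst y + a1 * n * snd y) q2))"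
      by (rule sum.reindex_bij_betw[OF bij, symmetric])
    also have "\<dots> = kloosterman (q1 * q2) m n"
      unfolding kloosterman_def
    proof (intro sum.cong refl, clarify)
      fix u v
      show "(case h (u, v) of (x, y) \<Rightarrow> ee (a2 * m * fst x + a2 * n * snd x) q1 * ee (a1 * m * fst y + a1 * n * snd y) q2)
         = ee (m * u + n * v) (q1 * q2)"
        unfolding ee by (simp add: h_def kloosterman_periodic distrib_left mult.assoc[symmetric])
    qed
    finally show ?thesis ..
  qed
  with cops that show ?thesis by blast
qed

section \<open>Counting the critical points\<close>

lemma card_residue_class_le:
  fixes r c a :: int
  assumes "r > 0" "c > 0"
  shows "card {u \<in> {0..<r * c}. r dvd u - a} \<le> nat c"
proof -
  have "inj_on (\<lambda>u. u div r) {u \<in> {0..<r * c}. r dvd u - a}"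
  proof (rule inj_onI)
    fix u v assume uv: "u \<in> {u \<in> {0..<r * c}. r dvd u - a}" "v \<in> {u \<in> {0..<r * c}. r dvd u - a}" "u div r = v div r"
    then have "u mod r = v mod r" by (simp add: mod_eq_dvd_iff) (metis diff_diff_eq2 dvd_diff diff_add_cancel add_diff_cancel)
    then show "u = v" using uv(3) by (metis div_mult_mod_eq)
  qed
  moreover have "(\<lambda>u. u div r) ` {u \<in> {0..<r * c}. r dvd u - a} \<subseteq> {0..<c}"
    using assms by (auto simp: pos_imp_zdiv_nonneg_iff mult.commute intro!: div_less_of_less_mult)
  ultimately have "card {u \<in> {0..<r * c}. r dvd u - a} \<le> card {0..<c}" by (intro card_inj_on_le) auto
  then show ?thesis by simp
qed

text \<open>For odd p the factors u - u0 and u + u0 are not both divisible by p. For p = 2 both are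
  even, but their halves add up to the odd number u, so only one half is even; this costs one power
  of 2.\<close>

lemma square_roots_mod_prime_power:
  fixes p :: int
  assumes p: "prime p" and u: "\<not> p dvd u" and u0: "\<not> p dvd u0" and dvd: "p ^ h dvd u\<^sup>2 - u0\<^sup>2" and h: "h \<ge> 1"
  defines "r \<equiv> (if p = 2 then p ^ (h - 1) else p ^ h)"
  shows "r dvd u - u0 \<or> r dvd u - (- u0)"
proof -
  have fac: "u\<^sup>2 - u0\<^sup>2 = (u - u0) * (u + u0)" by (simp add: power2_eq_square algebra_simps)
  show ?thesis
  proof (cases "p = 2")
    case False
    have "\<not> (p dvd u - u0 \<and> p dvd u + u0)"
    proof
      assume "p dvd u - u0 \<and> p dvd u + u0"
      then have "p dvd (u - u0) + (u + u0)" using dvd_add by blast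
      then have "p dvd 2 * u" by simp
      then have "p dvd 2" using p u prime_dvd_mult_iff by blast
      then have "p = 2" using p primes_dvd_imp_eq[of p 2] by simp
      with False show False by simp
    qed
    then consider "coprime (p ^ h) (u - u0)" | "coprime (p ^ h) (u + u0)"
      using prime_imp_coprime[OF p] by (metis coprime_power_left_iff)
    then show ?thesis
    proof cases
      case 1
      then have "p ^ h dvd u + u0" using dvd unfolding fac by (simp add: coprime_dvd_mult_right_iff)
      then show ?thesis using False by (simp add: r_def)
    next
      case 2
      then have "p ^ h dvd u - u0" using dvd unfolding fac by (simp add: coprime_dvd_mult_left_iff)
      then show ?thesis using False by (simp add: r_def)
    qed
  next
    case True
    obtain k where k: "h = Suc k" using h by (cases h) auto
    have odd: "odd u" "odd u0" using u u0 True by auto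
    then have "even (u - u0)" "even (u + u0)" by auto
    then obtain s t where st: "u - u0 = 2 * s" "u + u0 = 2 * t" by (meson evenE)
    then have "odd (s + t)" using odd by presburger
    have "2 * 2 ^ k dvd 2 * (2 * (s * t))" using dvd k True unfolding fac st by (simp add: mult_ac)
    then have "2 ^ k dvd 2 * s * t" by (simp only: dvd_mult_cancel_left) (simp add: mult_ac)
    then have d: "2 ^ k dvd s * (2 * t)" by (simp add: mult_ac)
    have "2 ^ k dvd u - u0 \<or> 2 ^ k dvd u + u0"
    proof (cases "odd s")
      case True
      then have "coprime (2 ^ k) s" by simp
      then show ?thesis using d st by (simp add: coprime_dvd_mult_right_iff)
    next
      case False
      then have "coprime (2 ^ k) t" using \<open>odd (s + t)\<close> by simp
      moreover have "2 ^ k dvd (2 * s) * t" using d by (simp add: mult_ac)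
      ultimately show ?thesis using st by (simp add: coprime_dvd_mult_left_iff)
    qed
    then show ?thesis using True k by (simp add: r_def)
  qed
qed

text \<open>For a unit pair, m u = n v mod p^h implies m u^2 = n mod p^h. All solutions u agree up
  to sign with a fixed one, mod p^h or, for p = 2, mod p^(h-1). This leaves at most 2 c or 4 c
  residues.\<close>

lemma card_critical_points:
  fixes p m n c :: int
  assumes p: "prime p" and n: "\<not> p dvd n" and h: "h \<ge> 1" and c: "c > 0"
  shows "card {(u, v) \<in> unit_pairs (p ^ h * c). p ^ h dvd m * u - n * v} \<le> 4 * nat c"
proof -
  define q where "q = p ^ h * c"
  define T where "T = {(u, v) \<in> unit_pairs q. p ^ h dvd m * u - n * v}"
  have p2: "p \<ge> 2" using p by (simp add: prime_ge_2_int)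
  define r where "r = (if p = 2 then p ^ (h - 1) else p ^ h)"
  define d where "d = (if p = 2 then 2 * c else c)"
  have rd: "q = r * d" "r > 0" "d > 0" using h c p2 by (cases h; simp add: q_def r_def d_def)+
  have finT: "finite T" unfolding T_def by (rule finite_subset[OF _ finite_unit_pairs[of q]]) auto
  have injT: "inj_on fst T" unfolding T_def by (auto simp: inj_on_def dest: unit_pairs_unique(1))
  have crit: "0 \<le> u \<and> u < q \<and> \<not> p dvd u \<and> p ^ h dvd m * u\<^sup>2 - n" if "(u, v) \<in> T" for u v
  proof -
    have uv: "(u, v) \<in> unit_pairs q" "p ^ h dvd m * u - n * v" using that by (auto simp: T_def)
    have "coprime u q" using unit_pairs_coprime(1)[OF uv(1)] .
    moreover have "p dvd q" using h by (simp add: q_def dvd_mult2 dvd_power)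
    ultimately have "\<not> p dvd u" using p by (metis coprime_common_divisor not_prime_unit)
    moreover have "p ^ h dvd u * v - 1" using uv(1) unfolding unit_pairs_def cong_iff_dvd_diff q_def by (auto dest: dvd_mult_left)
    then have "p ^ h dvd u * (m * u - n * v) + n * (u * v - 1)" using uv(2) by (intro dvd_add dvd_mult)
    then have "p ^ h dvd m * u\<^sup>2 - n" by (simp add: power2_eq_square algebra_simps)
    ultimately show ?thesis using uv(1) by (auto simp: unit_pairs_def)
  qed
  have "card T \<le> 4 * nat c"
  proof (cases "T = {}")
    case False
    then obtain u0 v0 where u0: "(u0, v0) \<in> T" by auto
    have "\<not> p dvd m"
    proof
      assume "p dvd m"
      then have "p dvd m * u0\<^sup>2" by simp
      moreover have "p dvd m * u0\<^sup>2 - n" using crit[OF u0] h dvd_trans[OF dvd_power[of h p]] by auto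
      ultimately have "p dvd n" by (metis dvd_diffD1 dvd_diff diff_diff_eq2 add_diff_cancel_left')
      then show False using n by simp
    qed
    then have copm: "coprime (p ^ h) m" using prime_imp_coprime[OF p] by simp
    have "fst ` T \<subseteq> {u \<in> {0..<r * d}. r dvd u - u0} \<union> {u \<in> {0..<r * d}. r dvd u - (- u0)}"
    proof
      fix u assume "u \<in> fst ` T"
      then obtain v where uv: "(u, v) \<in> T" by auto
      have "p ^ h dvd (m * u\<^sup>2 - n) - (m * u0\<^sup>2 - n)" using crit[OF uv] crit[OF u0] dvd_diff by blast
      then have "p ^ h dvd m * (u\<^sup>2 - u0\<^sup>2)" by (simp add: algebra_simps)
      then have "p ^ h dvd u\<^sup>2 - u0\<^sup>2" using copm by (simp add: coprime_dvd_mult_right_iff)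
      then have "r dvd u - u0 \<or> r dvd u - (- u0)"
        using square_roots_mod_prime_power[OF p _ _ _ h, of u u0] crit[OF uv] crit[OF u0] unfolding r_def by blast
      then show "u \<in> {u \<in> {0..<r * d}. r dvd u - u0} \<union> {u \<in> {0..<r * d}. r dvd u - (- u0)}"
        using crit[OF uv] rd(1) by auto
    qed
    moreover have "finite {u \<in> {0..<r * d}. r dvd u - a}" for a by (rule finite_subset[of _ "{0..<r * d}"]) auto
    ultimately have "card (fst ` T) \<le> card ({u \<in> {0..<r * d}. r dvd u - u0} \<union> {u \<in> {0..<r * d}. r dvd u - (- u0)})"
      by (intro card_mono finite_UnI)
    also have "\<dots> \<le> nat d + nat d"
      using card_residue_class_le[OF rd(2,3)] by (intro card_Un_le[THEN order_trans] add_mono)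
    also have "\<dots> \<le> 4 * nat c" using c by (auto simp: d_def)
    finally show ?thesis by (simp add: card_image[OF injT])
  qed simp
  then show ?thesis by (simp add: T_def q_def)
qed

section \<open>Weil's bound\<close>

instance alg_closure :: (field_prime_char) field_prime_char
  by standard (metis CHAR_alg_closure CHAR_pos of_nat_CHAR)

lemma of_int_eq_iff_cong: "(of_int a = (of_int b :: 'a::field_prime_char)) \<longleftrightarrow> [a = b] (mod int CHAR('a))"
proof -
  have "(of_int a = (of_int b :: 'a)) \<longleftrightarrow> of_int (a - b) = (0 :: 'a)" by simp
  also have "\<dots> \<longleftrightarrow> int CHAR('a) dvd a - b" by (rule of_int_eq_0_iff_char_dvd)
  finally show ?thesis by (simp add: cong_iff_dvd_diff)
qed

lemma prime_field_eq:
  "(frob_fixed 1 :: 'a::{alg_closed_field,field_prime_char} set) = of_int ` {0..<int CHAR('a)}"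
proof (rule card_subset_eq[symmetric])
  show "finite (frob_fixed 1 :: 'a set)" by (rule card_frob_fixed) simp
  have inj: "inj_on (of_int :: int \<Rightarrow> 'a) {0..<int CHAR('a)}"
    by (auto simp: inj_on_def of_int_eq_iff_cong intro: cong_less_imp_eq[of _ "int CHAR('a)"])
  show "card (of_int ` {0..<int CHAR('a)} :: 'a set) = card (frob_fixed 1 :: 'a set)"
    using card_frob_fixed(2)[where 'a='a and n=1] by (simp add: card_image[OF inj])
  show "of_int ` {0..<int CHAR('a)} \<subseteq> (frob_fixed 1 :: 'a set)"
  proof
    fix x :: 'a assume "x \<in> of_int ` {0..<int CHAR('a)}"
    then obtain j where "x = of_int j" "0 \<le> j" by auto
    then obtain k where k: "x = of_nat k" by (metis of_int_of_nat_eq zero_le_imp_eq_int)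
    have "of_nat k \<in> (frob_fixed 1 :: 'a set)" 
      by (induction k) (auto intro!: frob_fixed_arith(1,6,7) simp del: One_nat_def)
    then show "x \<in> frob_fixed 1" by (simp add: k)
  qed
qed

text \<open>The character e(j / p), well defined on the prime field because representatives differ
  by multiples of p. Elsewhere \<open>SOME\<close> returns an arbitrary integer, as
  \<open>add_char\<close> allows.\<close>

definition canonical_char :: "'a::{alg_closed_field,field_prime_char} \<Rightarrow> complex" where
  "canonical_char x = ee (SOME j. of_int j = x) (int CHAR('a))"

lemma canonical_char_of_int: "canonical_char (of_int j :: 'a::{alg_closed_field,field_prime_char}) = ee j (int CHAR('a))"
proof -
  have "of_int (SOME k. of_int k = (of_int j :: 'a)) = (of_int j :: 'a)" by (rule someI[of _ j]) simp
  then show ?thesis unfolding canonical_char_def of_int_eq_iff_cong by (rule ee_cong)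
qed

lemma add_char_canonical: "add_char (canonical_char :: 'a::{alg_closed_field,field_prime_char} \<Rightarrow> complex)"
  unfolding add_char_def
proof (intro conjI ballI)
  fix x y :: 'a assume "x \<in> frob_fixed 1" "y \<in> frob_fixed 1"
  then obtain i j where "x = of_int i" "y = of_int j" by (auto simp: prime_field_eq simp del: One_nat_def)
  then show "canonical_char (x + y) = canonical_char x * canonical_char y"
    using canonical_char_of_int[where 'a='a, of "i + j"] by (simp add: canonical_char_of_int ee_add)
next
  fix x :: 'a assume "x \<in> frob_fixed 1"
  then show "norm (canonical_char x) = 1" by (simp add: canonical_char_def)
next
  have "canonical_char (of_int 1 :: 'a) \<noteq> 1" unfolding canonical_char_of_int
    using ee_eq_1_iff[of "int CHAR('a)" 1] CHAR_ge_2[where 'a='a] by simp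
  moreover have "(1::'a) \<in> frob_fixed 1" by (rule frob_fixed_arith(7))
  ultimately show "\<exists>x\<in>frob_fixed 1. canonical_char (x::'a) \<noteq> 1" by auto
qed

text \<open>The substitution x = m u gives n v = m n / x, which turns the sum with two parameters
  into the form x + b / x with b = m n.\<close>

lemma kloosterman_eq_field_sum:
  assumes p: "p = int CHAR('a::{alg_closed_field,field_prime_char})" and m: "\<not> p dvd m" and n: "\<not> p dvd n"
  shows "kloosterman p m n = (\<Sum>x\<in>frob_fixed 1 - {0::'a}. canonical_char (x + of_int (m * n) / x))"
proof -
  have pr: "prime p" using prime_CHAR[where 'a='a] p by simp
  have p0: "p > 0" using pr by (simp add: prime_gt_0_int)
  define g where "g = (\<lambda>(u::int, v::int). of_int (m * u) :: 'a)"
  have nz: "of_int j \<noteq> (0::'a) \<longleftrightarrow> \<not> p dvd j" for j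
    using of_int_eq_0_iff_char_dvd[of j, where ?'a='a] p by simp
  have bij: "bij_betw g (unit_pairs p) (frob_fixed 1 - {0})"
    unfolding bij_betw_def
  proof
    show "inj_on g (unit_pairs p)"
    proof (rule inj_onI)
      fix x y assume x: "x \<in> unit_pairs p" and y: "y \<in> unit_pairs p" and eq: "g x = g y"
      obtain u v u' v' where xy: "x = (u, v)" "y = (u', v')" by (metis surj_pair)
      have "[m * u = m * u'] (mod p)" using eq by (simp only: g_def xy case_prod_conv of_int_eq_iff_cong p)
      then have "[u = u'] (mod p)" using prime_imp_coprime[OF pr m] by (simp add: cong_mult_lcancel coprime_commute)
      then have "u = u'" using x y by (auto simp: unit_pairs_def xy intro: cong_less_imp_eq)
      then show "x = y" using x y unit_pairs_unique(1) by (auto simp: xy)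
    qed
    show "g ` unit_pairs p = frob_fixed 1 - {0}"
    proof (intro equalityI subsetI)
      fix x assume "x \<in> g ` unit_pairs p"
      then obtain u v where uv: "x = of_int (m * u)" "(u, v) \<in> unit_pairs p" by (auto simp: g_def)
      have "\<not> p dvd u" using unit_pairs_coprime(1)[OF uv(2)] pr by (metis coprime_common_divisor dvd_refl not_prime_unit)
      then have "\<not> p dvd m * u" using m pr by (simp add: prime_dvd_mult_iff)
      then have "x \<noteq> 0" unfolding uv(1) by (rule nz[THEN iffD2])
      moreover have "x = of_int ((m * u) mod p)" unfolding uv(1) of_int_eq_iff_cong p[symmetric] by simp
      then have "x \<in> frob_fixed 1" using p0 unfolding prime_field_eq p[symmetric] by auto
      ultimately show "x \<in> frob_fixed 1 - {0}" by blast
    next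
      fix x :: 'a assume x: "x \<in> frob_fixed 1 - {0}"
      then obtain j where j: "x = of_int j" by (auto simp: prime_field_eq simp del: One_nat_def)
      have "\<not> p dvd j" using x j by (intro nz[THEN iffD1]) auto
      obtain m' where m': "[m * m' = 1] (mod p)"
        using cong_solve_coprime_int[of m p] prime_imp_coprime[OF pr m] by (auto simp: coprime_commute)
      have "\<not> p dvd m'"
      proof
        assume "p dvd m'"
        then have "p dvd 1" using m' by (metis cong_dvd_iff dvd_mult)
        then show False using pr not_prime_unit by blast
      qed
      then have "\<not> p dvd m' * j" using \<open>\<not> p dvd j\<close> pr by (simp add: prime_dvd_mult_iff)
      then obtain v where v: "[m' * j * v = 1] (mod p)"
        using cong_solve_coprime_int[of "m' * j" p] prime_imp_coprime[OF pr] by (metis coprime_commute)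
      have "((m' * j) mod p, v mod p) \<in> unit_pairs p" using p0 v by (rule unit_pairs_cong)
      moreover have "g ((m' * j) mod p, v mod p) = x"
      proof -
        have "[m * ((m' * j) mod p) = m * (m' * j)] (mod p)" by (intro cong_scalar_left) simp
        also have "m * (m' * j) = (m * m') * j" by simp
        also have "[(m * m') * j = 1 * j] (mod p)" using m' by (rule cong_scalar_right)
        finally show ?thesis unfolding g_def j case_prod_conv of_int_eq_iff_cong p[symmetric] by simp
      qed
      ultimately show "x \<in> g ` unit_pairs p" by force
    qed
  qed
  have "(\<Sum>x\<in>frob_fixed 1 - {0::'a}. canonical_char (x + of_int (m * n) / x)) =
    (\<Sum>z\<in>unit_pairs p. canonical_char (g z + of_int (m * n) / g z))"
    by (rule sum.reindex_bij_betw[OF bij, symmetric])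
  also have "\<dots> = kloosterman p m n" unfolding kloosterman_def
  proof (intro sum.cong refl, clarify)
    fix u v assume uv: "(u, v) \<in> unit_pairs p"
    have "of_int (u * v) = (of_int 1 :: 'a)" using uv unfolding of_int_eq_iff_cong p[symmetric] by (simp add: unit_pairs_def)
    then have uv1: "of_int u * of_int v = (1 :: 'a)" by simp
    then have "of_int u \<noteq> (0::'a)" by auto
    moreover have "of_int m \<noteq> (0::'a)" using nz m by simp
    ultimately have "of_int (m * n) / (of_int (m * u) :: 'a) = of_int (n * v)"
      using uv1 by (simp add: field_simps)
    then have "g (u, v) + of_int (m * n) / g (u, v) = of_int (m * u + n * v)" by (simp add: g_def)
    then show "canonical_char (g (u, v) + of_int (m * n) / g (u, v)) = ee (m * u + n * v) p"
      by (simp only: canonical_char_of_int p)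
  qed
  finally show ?thesis ..
qed

lemma weil_bound_char:
  assumes p: "p = int CHAR('a::{alg_closed_field,field_prime_char})" and m: "\<not> p dvd m" and n: "\<not> p dvd n"
  shows "norm (kloosterman p m n) \<le> 2 * sqrt (of_int p)"
proof -
  have "prime p" using prime_CHAR[where 'a='a] p by simp
  then have "\<not> p dvd m * n" using m n by (simp add: prime_dvd_mult_iff)
  then have b: "of_int (m * n) \<noteq> (0::'a)" using of_int_eq_0_iff_char_dvd[of "m * n", where ?'a='a] p by simp
  have "of_int (m * n) = (of_int ((m * n) mod p) :: 'a)" unfolding of_int_eq_iff_cong p[symmetric] by simp
  then have "of_int (m * n) \<in> (frob_fixed 1 :: 'a set)" 
    using \<open>prime p\<close> unfolding prime_field_eq p[symmetric] by (auto simp: prime_gt_0_int)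
  from weil_bound_field[OF add_char_canonical this b] show ?thesis
    unfolding kloosterman_eq_field_sum[OF assms] by (simp add: p)
qed

text \<open>Types cannot depend on the prime \<open>p\<close>. So the prime is made a constant, chosen to be a
  counterexample to the Weil bound if there is one; the type of that cardinality yields the field of
  characteristic \<open>bad_prime\<close>, to which the type-class based argument applies.\<close>

definition weil_at :: "nat \<Rightarrow> bool" where
  "weil_at p \<longleftrightarrow> (\<forall>m n. \<not> int p dvd m \<longrightarrow> \<not> int p dvd n \<longrightarrow>
     norm (kloosterman (int p) m n) \<le> 2 * sqrt (real p))"

definition bad_prime :: nat where
  "bad_prime = (if \<exists>p::nat. prime p \<and> \<not> weil_at p then SOME p. prime p \<and> \<not> weil_at p else 2)"

lemma prime_bad_prime: "prime bad_prime"
  unfolding bad_prime_def using someI_ex[of "\<lambda>p::nat. prime p \<and> \<not> weil_at p"] by auto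

typedef bad_card = "{0..<bad_prime}"
  using prime_bad_prime prime_gt_0_nat by auto

lemma CARD_bad_card: "CARD(bad_card) = bad_prime"
  using type_definition.card[OF type_definition_bad_card] by simp

instance bad_card :: finite
  by standard (metis CARD_bad_card prime_bad_prime card.infinite not_prime_0)

instance bad_card :: prime_card
  by standard (simp add: CARD_bad_card prime_bad_prime)

theorem weil_bound_prime:
  fixes p m n :: int
  assumes p: "prime p" and mn: "\<not> p dvd m" "\<not> p dvd n"
  shows "norm (kloosterman p m n) \<le> 2 * sqrt (of_int p)"
proof -
  have "weil_at bad_prime"
    using weil_bound_char[where 'a = "bad_card mod_ring alg_closure"] by (simp add: weil_at_def CARD_bad_card)
  \<comment> \<open>Any counterexample would, by the choice of \<open>bad_prime\<close>, make
    \<open>bad_prime\<close> one as well.\<close>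
  then have "\<not> (\<exists>p::nat. prime p \<and> \<not> weil_at p)"
    unfolding bad_prime_def using someI_ex[of "\<lambda>p::nat. prime p \<and> \<not> weil_at p"] by (auto split: if_splits)
  moreover obtain k where k: "p = int k" using p by (metis prime_ge_0_int zero_le_imp_eq_int)
  moreover have "prime k" using p k by simp
  ultimately have "weil_at k" by blast
  then show ?thesis using mn by (simp add: weil_at_def k)
qed

section \<open>Prime and prime power moduli\<close>

lemma kloosterman_prime_divides_one:
  fixes p :: int
  assumes p: "prime p" and m: "p dvd m" and n: "\<not> p dvd n"
  shows "kloosterman p m n = -1"
proof -
  have p0: "p > 0" using p by (simp add: prime_gt_0_int)
  have bij: "bij_betw snd (unit_pairs p) ({0..<p} - {0})"
    unfolding bij_betw_def
  proof
    show "inj_on snd (unit_pairs p)" by (auto simp: inj_on_def dest: unit_pairs_unique(2))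
    show "snd ` unit_pairs p = {0..<p} - {0}"
    proof (intro equalityI subsetI)
      fix v assume "v \<in> snd ` unit_pairs p"
      then obtain u where uv: "(u, v) \<in> unit_pairs p" by auto
      then have "coprime v p" by (rule unit_pairs_coprime)
      then have "v \<noteq> 0" using p by (auto dest: not_prime_unit)
      then show "v \<in> {0..<p} - {0}" using uv by (auto simp: unit_pairs_def)
    next
      fix v assume v: "v \<in> {0..<p} - {0}"
      then have "\<not> p dvd v" using zdvd_not_zless[of v p] by auto
      then obtain u where "[v * u = 1] (mod p)" using cong_solve_coprime_int[of v p] prime_imp_coprime[OF p] by (metis coprime_commute)
      then have "(u mod p, v mod p) \<in> unit_pairs p" using p0 by (intro unit_pairs_cong) (simp_all add: mult.commute)
      then show "v \<in> snd ` unit_pairs p" using v by force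
    qed
  qed
  \<comment> \<open>What remains is a Ramanujan sum: a complete sum over v, which vanishes, minus
    its term at v = 0.\<close>
  have "kloosterman p m n = (\<Sum>z\<in>unit_pairs p. ee (n * snd z) p)"
    unfolding kloosterman_def using m by (intro sum.cong refl) (auto simp: ee_add ee_eq_1)
  also have "\<dots> = (\<Sum>v\<in>{0..<p} - {0}. ee (n * v) p)" by (rule sum.reindex_bij_betw[OF bij])
  also have "\<dots> = (\<Sum>v\<in>{0..<p}. ee (n * v) p) - 1" using p0 by (subst sum_diff1) auto
  also have "\<dots> = -1" using n by (simp add: sum_ee[OF p0])
  finally show ?thesis .
qed

lemma norm_sum_critical:
  "norm (\<Sum>(u, v)\<in>A. if P u v then f u v else 0) \<le> B * real (card {(u, v) \<in> A. P u v})"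
  if "finite A" "\<And>u v. (u, v) \<in> A \<Longrightarrow> P u v \<Longrightarrow> norm (f u v :: complex) \<le> B"
proof -
  have "norm (\<Sum>(u, v)\<in>A. if P u v then f u v else 0) \<le> (\<Sum>(u, v)\<in>A. if P u v then B else 0)"
    using that by (intro sum_norm_le) auto
  also have "\<dots> = (\<Sum>z\<in>{z \<in> A. case z of (u, v) \<Rightarrow> P u v}. B)"
    using that(1) by (subst sum.inter_filter) (auto intro!: sum.cong)
  finally show ?thesis by (simp add: case_prod_unfold mult.commute)
qed

text \<open>The constant has to cover all cases: 4 from the critical points for even k, again 4 for
  odd p and odd k after the Gauss sum, and 8 / sqrt 2 < 6 for odd powers of 2, where 2 is not
  invertible and only the plain localisation applies.\<close>

lemma kloosterman_prime_power_coprime: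
  fixes p m n :: int
  assumes p: "prime p" and n: "\<not> p dvd n" and k: "k \<ge> 2"
  shows "norm (kloosterman (p ^ k) m n) \<le> 6 * sqrt (of_int (p ^ k))"
proof -
  define h where "h = k div 2"
  have h: "h \<ge> 1" using k by (simp add: h_def)
  define r where "r = p ^ h"
  have p2: "p \<ge> 2" using p by (simp add: prime_ge_2_int)
  have r: "r > 0" using p2 by (simp add: r_def)
  have crit: "norm (kloosterman (c * r) m n) \<le> 4 * of_int c" if c: "c > 0" and "c * r dvd c\<^sup>2" for c
  proof -
    have "norm (kloosterman (c * r) m n) \<le> 1 * real (card {(u, v) \<in> unit_pairs (c * r). r dvd m * u - n * v})"
      unfolding kloosterman_stationary[OF c r that(2)] by (rule norm_sum_critical) auto
    also have "\<dots> \<le> real (4 * nat c)"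
      using card_critical_points[OF p n h c, of m] by (simp add: r_def mult.commute)
    finally show ?thesis using c by simp
  qed
  show ?thesis
  proof (cases "even k")
    case True
    then have "p ^ k = r * r" by (auto simp: r_def h_def mult_2 simp flip: power_add elim!: evenE)
    moreover have "norm (kloosterman (r * r) m n) \<le> 4 * of_int r" using crit[OF r] by (simp add: power2_eq_square)
    ultimately show ?thesis using r by simp
  next
    case False
    then have q: "p ^ k = p * r * r" by (auto simp: r_def h_def mult_2 simp flip: power_add elim!: oddE)
    have pr: "p dvd r" using h by (simp add: r_def dvd_power)
    have sq: "sqrt (of_int (p * r * r)) = sqrt (of_int p) * of_int r" using r by (simp add: real_sqrt_mult)
    show ?thesis
    proof (cases "p = 2")
      case True
      have "norm (kloosterman (p * r * r) m n) \<le> 4 * of_int (p * r)"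
        using crit[of "p * r"] r p2 by (simp add: power2_eq_square mult_ac)
      also have "\<dots> = 8 * of_int r" using True by simp
      also have "\<dots> \<le> 6 * (sqrt 2 * of_int r)"
      proof -
        have "4 / 3 \<le> sqrt 2" by (rule real_le_rsqrt) (simp add: power2_eq_square)
        then have "(4 / 3) * of_int r \<le> sqrt 2 * of_int r" using r by (intro mult_right_mono) auto
        then show ?thesis by linarith
      qed
      finally show ?thesis unfolding q sq using True by simp
    next
      case False
      define T where "T = {(u, v) \<in> unit_pairs (p * r * r). r dvd m * u - n * v}"
      have cT: "card T \<le> 4 * nat (p * r)"
        using card_critical_points[OF p n h, of "p * r" m] r p2 unfolding T_def r_def[symmetric] by (simp add: mult_ac)
      have "norm (of_int p * kloosterman (p * r * r) m n) \<le> sqrt (of_int p) * real (card T)"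
        unfolding kloosterman_stationary_odd[OF _ r pr, of m n, OF prime_gt_0_int[OF p]] T_def
      proof (rule norm_sum_critical)
        fix u v assume uv: "(u, v) \<in> unit_pairs (p * r * r)"
        have "coprime v (p * r * r)" using unit_pairs_coprime(2)[OF uv] .
        then have "coprime v p" by simp
        moreover have "coprime n p" using prime_imp_coprime[OF p n] by (simp add: coprime_commute)
        moreover have "coprime 2 p" using primes_coprime[of 2 p] False p by auto
        ultimately have "coprime (2 * (n * v)) p" by simp
        then show "norm (ee (m * u + n * v) (p * r * r) * gauss_sum p (n * v) ((m * u - n * v) div r)) \<le> sqrt (of_int p)"
          using p2 by (simp add: norm_mult norm_gauss_sum)
      qed simp
      also have "\<dots> \<le> sqrt (of_int p) * (4 * (of_int p * of_int r))"
      proof (rule mult_left_mono)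
        have "real (card T) \<le> real (4 * nat (p * r))" using cT by (simp only: of_nat_le_iff)
        also have "\<dots> = 4 * (of_int p * of_int r)" using r p2 by simp
        finally show "real (card T) \<le> 4 * (of_int p * of_int r)" .
      qed (use p2 in simp)
      finally have "of_int p * norm (kloosterman (p * r * r) m n) \<le> of_int p * (4 * (sqrt (of_int p) * of_int r))"
        using p2 by (simp add: norm_mult mult_ac)
      then have "norm (kloosterman (p * r * r) m n) \<le> 4 * (sqrt (of_int p) * of_int r)"
        using p2 by (simp add: mult_le_cancel_left)
      also have "\<dots> \<le> 6 * (sqrt (of_int p) * of_int r)" using r p2 by (intro mult_right_mono) auto
      finally show ?thesis unfolding q sq .
    qed
  qed
qed

text \<open>\<open>kloosterman_reduce\<close> removes a common factor p of m and n: the sum gains p,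
  and so does the square root, since both the modulus and the gcd gain p. Otherwise p misses one of
  m and n, which by symmetry may be n.\<close>

lemma kloosterman_prime_power:
  fixes p m n :: int
  assumes p: "prime p"
  shows "norm (kloosterman (p ^ k) m n) \<le> 6 * sqrt (of_int (p ^ k * gcd (gcd m n) (p ^ k)))"
proof (induction k arbitrary: m n)
  case 0
  then show ?case using kloosterman_trivial_bound[of 1 m n] by simp
next
  case (Suc k)
  have p2: "p \<ge> 2" using p by (simp add: prime_ge_2_int)
  have one: "6 * sqrt (of_int (p ^ Suc k)) \<le> 6 * sqrt (of_int (p ^ Suc k * gcd (gcd m n) (p ^ Suc k)))"
  proof -
    have "gcd (gcd m n) (p ^ Suc k) \<noteq> 0" using p2 by simp
    then have "gcd (gcd m n) (p ^ Suc k) \<ge> 1" using gcd_ge_0_int[of "gcd m n" "p ^ Suc k"] by linarith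
    then have "p ^ Suc k * 1 \<le> p ^ Suc k * gcd (gcd m n) (p ^ Suc k)" using p2 by (intro mult_left_mono) auto
    then have "real_of_int (p ^ Suc k) \<le> of_int (p ^ Suc k * gcd (gcd m n) (p ^ Suc k))" by (simp only: of_int_le_iff mult_1_right)
    then show ?thesis by simp
  qed
  show ?case
  proof (cases "p dvd m \<and> p dvd n")
    case True
    then obtain m' n' where mn: "m = p * m'" "n = p * n'" by (auto elim!: dvdE)
    have g: "gcd (gcd m n) (p ^ Suc k) = p * gcd (gcd m' n') (p ^ k)"
      using p2 by (simp add: mn gcd_mult_left abs_mult)
    show ?thesis
    proof (cases k)
      case 0
      have "norm (kloosterman p m n) \<le> of_int p" using kloosterman_trivial_bound p2 by simp
      also have "\<dots> = sqrt (of_int (p * p))" using p2 by simp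
      also have "\<dots> \<le> 6 * sqrt (of_int (p * p))" by simp
      finally show ?thesis using 0 g by simp
    next
      case (Suc l)
      have "norm (kloosterman (p ^ Suc k) m n) = of_int p * norm (kloosterman (p ^ k) m' n')"
        using kloosterman_reduce[of p "p ^ k" m' n'] p2 Suc by (simp add: mn norm_mult)
      also have "\<dots> \<le> of_int p * (6 * sqrt (of_int (p ^ k * gcd (gcd m' n') (p ^ k))))"
        using Suc.IH[of m' n'] p2 by (intro mult_left_mono) auto
      also have "\<dots> = 6 * (sqrt (of_int (p * p)) * sqrt (of_int (p ^ k * gcd (gcd m' n') (p ^ k))))"
        using p2 by simp
      also have "\<dots> = 6 * sqrt (of_int (p ^ Suc k * gcd (gcd m n) (p ^ Suc k)))"
        unfolding g real_sqrt_mult[symmetric] of_int_mult[symmetric] by (simp add: mult_ac)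
      finally show ?thesis .
    qed
  next
    case False
    have "norm (kloosterman (p ^ Suc k) m n) \<le> 6 * sqrt (of_int (p ^ Suc k))"
    proof (cases "k = 0")
      case True
      have s: "1 \<le> sqrt (of_int p)" using p2 by simp
      have "norm (kloosterman p m n) \<le> 2 * sqrt (of_int p)"
      proof (cases "p dvd m \<or> p dvd n")
        case True
        then have "kloosterman p m n = -1"
          using False kloosterman_prime_divides_one[OF p, of m n] kloosterman_prime_divides_one[OF p, of n m] kloosterman_commute[of p m n] by auto
        then have "norm (kloosterman p m n) = 1" by simp
        then show ?thesis using s by linarith
      qed (use weil_bound_prime[OF p] in auto)
      then have "norm (kloosterman p m n) \<le> 6 * sqrt (of_int p)" using s by linarith
      then show ?thesis using True by simp
    next
      case k: False
      then have k2: "Suc k \<ge> 2" by simp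
      show ?thesis using False kloosterman_prime_power_coprime[OF p _ k2, of n m] kloosterman_prime_power_coprime[OF p _ k2, of m n]
        kloosterman_commute[of "p ^ Suc k" m n] by auto
    qed
    with one show ?thesis by linarith
  qed
qed

section \<open>General moduli and the cost of the prime factors\<close>

lemma gcd_mult_coprime_factor:
  fixes a g q :: int
  assumes "coprime a q"
  shows "gcd (gcd (a * m) (a * n)) q = gcd (gcd m n) q"
proof -
  have "gcd (gcd (a * m) (a * n)) q = gcd (\<bar>a\<bar> * gcd m n) q" by (simp only: gcd_mult_distrib_int)
  also have "\<dots> = gcd (gcd m n) q"
    by (rule gcd_mult_left_left_cancel) (use assms in \<open>simp add: coprime_commute\<close>)
  finally show ?thesis .
qed

lemma gcd_coprime_mult:
  fixes g a b :: int
  assumes "coprime a b"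
  shows "gcd g (a * b) = gcd g a * gcd g b"
proof (rule zdvd_antisym_nonneg)
  show "gcd g (a * b) dvd gcd g a * gcd g b"
  proof -
    obtain a' b' where ab: "gcd g (a * b) = a' * b'" "a' dvd a" "b' dvd b"
      using division_decomp[of "gcd g (a * b)" a b] by auto
    then have "a' dvd g" "b' dvd g" by (metis dvd_mult_left dvd_mult_right gcd_dvd1)+
    then show ?thesis unfolding ab(1) using ab by (intro mult_dvd_mono) auto
  qed
  have "coprime (gcd g a) (gcd g b)" using assms by (meson coprime_divisors gcd_dvd2)
  then show "gcd g a * gcd g b dvd gcd g (a * b)"
    by (intro gcd_greatest divides_mult mult_dvd_mono) auto
qed auto

text \<open>One full prime power is split off at a time. The twists of
  \<open>kloosterman_crt\<close> are units and leave the gcds alone, and gcd(m, n, q) is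
  multiplicative over coprime factors of q.\<close>

theorem kloosterman_bound:
  fixes m n :: int
  assumes "q > 0"
  shows "norm (kloosterman (int q) m n) \<le> 6 ^ card (prime_factors q) * sqrt (real q * of_int (gcd (gcd m n) (int q)))"
  using assms
proof (induction q arbitrary: m n rule: less_induct)
  case (less q)
  show ?case
  proof (cases "q = 1")
    case True
    then show ?thesis using kloosterman_trivial_bound[of 1 m n] by simp
  next
    case False
    then obtain p where p: "prime p" "p dvd q" using prime_factor_nat[of q] less by blast
    define k where "k = multiplicity p q"
    obtain q' where q': "q = p ^ k * q'" "\<not> p dvd q'"
      using multiplicity_decompose'[of q p] p less.prems unfolding k_def by (metis not_gr0 not_prime_unit)
    have k: "k \<ge> 1" using p less.prems by (simp add: k_def Suc_le_eq prime_multiplicity_gt_zero_iff)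
    have q'0: "q' > 0" using q' less.prems by (cases q') auto
    have cop: "coprime (p ^ k) q'" using prime_imp_coprime[OF p(1) q'(2)] by simp
    have "1 < p ^ k" by (rule one_less_power) (use prime_gt_1_nat[OF p(1)] k in auto)
    then have "q' < q" using q' q'0 by simp
    have pf: "prime_factors q = insert p (prime_factors q')"
      using q' q'0 p k by (auto simp: prime_factors_dvd prime_dvd_mult_iff prime_dvd_power_iff dest: primes_dvd_imp_eq)
    have notin: "p \<notin> prime_factors q'" using q' by auto
    have cq: "card (prime_factors q) = Suc (card (prime_factors q'))" unfolding pf using notin by simp
    define P where "P = int p ^ k"
    define Q where "Q = int q'"
    have PQ: "P > 0" "Q > 0" "coprime P Q" using p q'0 cop by (auto simp: P_def Q_def prime_gt_0_nat simp flip: of_nat_power)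
    from kloosterman_crt[OF PQ] obtain a1 a2 where a: "coprime a2 P" "coprime a1 Q"
      "\<And>m n. kloosterman (P * Q) m n = kloosterman P (a2 * m) (a2 * n) * kloosterman Q (a1 * m) (a1 * n)" by metis
    have "norm (kloosterman (int q) m n) = norm (kloosterman P (a2 * m) (a2 * n)) * norm (kloosterman Q (a1 * m) (a1 * n))"
      using a(3)[of m n] by (simp add: q' P_def Q_def norm_mult)
    also have "\<dots> \<le> (6 * sqrt (of_int (P * gcd (gcd m n) P))) * (6 ^ card (prime_factors q') * sqrt (real q' * of_int (gcd (gcd m n) Q)))"
    proof (rule mult_mono)
      show "norm (kloosterman P (a2 * m) (a2 * n)) \<le> 6 * sqrt (of_int (P * gcd (gcd m n) P))"
        using kloosterman_prime_power[of "int p" k "a2 * m" "a2 * n"] p(1) gcd_mult_coprime_factor[OF a(1), of m n]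
        by (simp add: P_def)
      show "norm (kloosterman Q (a1 * m) (a1 * n)) \<le> 6 ^ card (prime_factors q') * sqrt (real q' * of_int (gcd (gcd m n) Q))"
        using less.IH[OF \<open>q' < q\<close> q'0, of "a1 * m" "a1 * n"] gcd_mult_coprime_factor[OF a(2), of m n] by (simp add: Q_def)
    qed (use PQ in auto)
    also have "\<dots> = 6 ^ card (prime_factors q) * sqrt (of_int (P * gcd (gcd m n) P) * (of_int Q * of_int (gcd (gcd m n) Q)))"
      unfolding cq by (simp add: real_sqrt_mult Q_def)
    also have "of_int (P * gcd (gcd m n) P) * (of_int Q * of_int (gcd (gcd m n) Q)) = real q * of_int (gcd (gcd m n) (int q))"
      using gcd_coprime_mult[OF PQ(3), of "gcd m n"] by (simp add: q' P_def Q_def mult_ac)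
    finally show ?thesis .
  qed
qed

text \<open>A prime p > A^(1/\<epsilon>) satisfies A \<le> p^\<epsilon>, so its factor A is paid for
  by q^\<epsilon>; the smaller primes cost at most A^N in all.\<close>

lemma power_omega_bound:
  fixes A \<epsilon> :: real
  assumes A: "A \<ge> 1" and \<epsilon>: "\<epsilon> > 0"
  shows "\<exists>C>0. \<forall>q::nat. q > 0 \<longrightarrow> A ^ card (prime_factors q) \<le> C * real q powr \<epsilon>"
proof -
  define N where "N = nat \<lceil>A powr (1 / \<epsilon>)\<rceil>"
  have "A ^ card (prime_factors q) \<le> A ^ N * real q powr \<epsilon>" if q: "q > 0" for q :: nat
  proof -
    have pw: "A \<le> real p powr \<epsilon>" if "p > N" for p :: nat
    proof -
      have "A powr (1 / \<epsilon>) \<le> real p" using that unfolding N_def by linarith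
      then have "(A powr (1 / \<epsilon>)) powr \<epsilon> \<le> real p powr \<epsilon>" using \<epsilon> by (intro powr_mono2) auto
      then show ?thesis using A \<epsilon> by (simp add: powr_powr)
    qed
    have "A ^ card (prime_factors q) = (\<Prod>p\<in>prime_factors q. A)" by simp
    also have "\<dots> \<le> (\<Prod>p\<in>prime_factors q. (if p \<in> {1..N} then A else 1) * real p powr \<epsilon>)"
    proof (intro prod_mono conjI)
      fix p assume "p \<in> prime_factors q"
      then have "p \<ge> 1" using prime_ge_1_nat by auto
      then have "1 \<le> real p powr \<epsilon>" using \<epsilon> by (simp add: ge_one_powr_ge_zero)
      then show "A \<le> (if p \<in> {1..N} then A else 1) * real p powr \<epsilon>"
        using A pw[of p] \<open>p \<ge> 1\<close> mult_left_mono[of 1 "real p powr \<epsilon>" A] by auto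
    qed (use A in auto)
    also have "\<dots> = (\<Prod>p\<in>prime_factors q. if p \<in> {1..N} then A else 1) * (\<Prod>p\<in>prime_factors q. real p powr \<epsilon>)"
      by (rule prod.distrib)
    also have "\<dots> \<le> A ^ N * real q powr \<epsilon>"
    proof (rule mult_mono)
      have "(\<Prod>p\<in>prime_factors q. if p \<in> {1..N} then A else 1) = A ^ card (prime_factors q \<inter> {1..N})"
        by (simp only: prod.inter_restrict[OF finite_set_mset, symmetric] prod_constant)
      also have "\<dots> \<le> A ^ N"
        using card_mono[of "{1..N}" "prime_factors q \<inter> {1..N}"] A by (intro power_increasing) auto
      finally show "(\<Prod>p\<in>prime_factors q. if p \<in> {1..N} then A else 1) \<le> A ^ N" .
      have "(\<Prod>p\<in>prime_factors q. real p powr \<epsilon>) = (\<Prod>p\<in>prime_factors q. real p) powr \<epsilon>"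
        by (rule prod_powr_distrib[symmetric])
      also have "\<dots> \<le> real q powr \<epsilon>"
      proof (rule powr_mono2)
        have "\<Prod>(prime_factors q) \<le> (\<Prod>p\<in>prime_factors q. p ^ multiplicity p q)"
        proof (intro prod_mono conjI)
          fix p assume p: "p \<in> prime_factors q"
          then have "multiplicity p q \<ge> 1" by (simp add: prime_factors_multiplicity Suc_le_eq)
          then show "p \<le> p ^ multiplicity p q" using self_le_power[of p "multiplicity p q"] prime_ge_1_nat p by auto
        qed auto
        also have "\<dots> = q" using q by (simp add: prime_factorization_nat[symmetric])
        finally have "real (\<Prod>(prime_factors q)) \<le> real q" by (simp only: of_nat_le_iff)
        then show "(\<Prod>p\<in>prime_factors q. real p) \<le> real q" by (simp only: of_nat_prod)
      qed (use \<epsilon> in \<open>auto intro: prod_nonneg\<close>)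
      finally show "(\<Prod>p\<in>prime_factors q. real p powr \<epsilon>) \<le> real q powr \<epsilon>" .
    qed (use A in \<open>auto intro: prod_nonneg\<close>)
    finally show ?thesis .
  qed
  then show ?thesis using A by (intro exI[of _ "A ^ N"]) auto
qed

text \<open>Each factor 1 - 1/p of the product formula is at least 1/2.\<close>

lemma totient_lower_bound:
  assumes "q > 0"
  shows "real q \<le> 2 ^ card (prime_factors q) * real (totient q)"
proof -
  have "(\<Prod>p\<in>prime_factors q. 1 / 2 :: real) \<le> (\<Prod>p\<in>prime_factors q. 1 - 1 / real p)"
  proof (intro prod_mono conjI)
    fix p assume "p \<in> prime_factors q"
    then have "p \<ge> 2" using prime_ge_2_nat by auto
    then show "1 / 2 \<le> 1 - 1 / real p" by (simp add: field_simps)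
  qed auto
  then have "real q * (1 / 2) ^ card (prime_factors q) \<le> real (totient q)"
    unfolding totient_formula2 by (intro mult_left_mono) auto
  then show ?thesis by (simp add: power_one_over field_simps)
qed

section \<open>The Fourier transform of a disc\<close>

lemma has_vector_derivative_cis:
  assumes "(f has_real_derivative f') (at x within S)"
  shows "((\<lambda>x. cis (f x)) has_vector_derivative (\<i> * of_real f' * cis (f x))) (at x within S)"
proof -
  have "((\<lambda>x. of_real (f x) :: complex) has_vector_derivative of_real f') (at x within S)"
    using assms by (intro has_vector_derivative_of_real) (simp add: has_real_derivative_iff_has_vector_derivative)
  then have 1: "((\<lambda>x. \<i> * of_real (f x)) has_vector_derivative \<i> * of_real f') (at x within S)"
    by (rule has_vector_derivative_mult_right)
  have "(exp has_field_derivative exp (\<i> * of_real (f x))) (at (\<i> * of_real (f x)) within ((\<lambda>x. \<i> * of_real (f x)) ` S))"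
    by (rule DERIV_exp[THEN has_field_derivative_at_within])
  from field_vector_diff_chain_within[OF 1 this] show ?thesis
    by (simp add: o_def cis_conv_exp mult.commute)
qed

text \<open>Partial integration against 1 / f'. The boundary terms give 2 / \<mu>. As f'' \<ge> 0,
  the function 1 / f' is monotone, and its total variation contributes at most another 2 /
  \<mu>.\<close>

lemma oscillatory_first_derivative:
  fixes f f' f'' :: "real \<Rightarrow> real"
  assumes cd: "c \<le> d"
    and f': "\<And>x. x \<in> {c..d} \<Longrightarrow> (f has_real_derivative f' x) (at x within {c..d})"
    and f'': "\<And>x. x \<in> {c..d} \<Longrightarrow> (f' has_real_derivative f'' x) (at x within {c..d})"
    and cont: "continuous_on {c..d} f''"
    and pos: "\<And>x. x \<in> {c..d} \<Longrightarrow> f'' x \<ge> 0"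
    and \<mu>: "\<mu> > 0" "\<And>x. x \<in> {c..d} \<Longrightarrow> \<bar>f' x\<bar> \<ge> \<mu>"
  shows "norm (integral {c..d} (\<lambda>x. cis (f x))) \<le> 4 / \<mu>"
proof -
  have nz: "f' x \<noteq> 0" if "x \<in> {c..d}" for x using \<mu> that by force
  have contf: "continuous_on {c..d} f" using f' by (rule DERIV_continuous_on)
  have contf': "continuous_on {c..d} f'" using f'' by (rule DERIV_continuous_on)
  define w where "w = (\<lambda>x. f'' x / (f' x)\<^sup>2)"
  have contw: "continuous_on {c..d} w" unfolding w_def using cont contf' nz by (intro continuous_intros) auto
  have "((\<lambda>x. - (1 / f' x)) has_real_derivative w x) (at x within {c..d})" if "x \<in> {c..d}" for x
    using f''[OF that] nz[OF that] unfolding w_def by (auto intro!: derivative_eq_intros simp: power2_eq_square)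
  then have w_int: "(w has_integral (- (1 / f' d) - (- (1 / f' c)))) {c..d}"
    using cd by (intro fundamental_theorem_of_calculus) (auto simp: has_real_derivative_iff_has_vector_derivative)
  define G where "G = (\<lambda>x. cis (f x) * of_real (1 / f' x))"
  have G: "(G has_vector_derivative \<i> * cis (f x) - of_real (w x) * cis (f x)) (at x within {c..d})"
    if x: "x \<in> {c..d}" for x
  proof -
    have "((\<lambda>x. 1 / f' x) has_real_derivative - w x) (at x within {c..d})"
      using f''[OF x] nz[OF x] unfolding w_def by (auto intro!: derivative_eq_intros simp: power2_eq_square)
    then have "((\<lambda>x. of_real (1 / f' x) :: complex) has_vector_derivative of_real (- w x)) (at x within {c..d})"
      by (intro has_vector_derivative_of_real) (simp add: has_real_derivative_iff_has_vector_derivative)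
    from has_vector_derivative_mult[OF has_vector_derivative_cis[OF f'[OF x]] this]
    show ?thesis using nz[OF x] by (simp add: G_def mult_ac field_simps)
  qed
  have contc: "continuous_on {c..d} (\<lambda>x. cis (f x))" by (intro continuous_on_cis contf)
  have int1: "((\<lambda>x. \<i> * cis (f x) - of_real (w x) * cis (f x)) has_integral (G d - G c)) {c..d}"
    using cd G by (intro fundamental_theorem_of_calculus)
  have int2: "(\<lambda>x. of_real (w x) * cis (f x)) integrable_on {c..d}"
    by (intro integrable_continuous_real continuous_intros contw contc)
  define I2 where "I2 = integral {c..d} (\<lambda>x. of_real (w x) * cis (f x))"
  have "((\<lambda>x. \<i> * cis (f x) - of_real (w x) * cis (f x) + of_real (w x) * cis (f x)) has_integral (G d - G c + I2)) {c..d}"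
    using int1 int2 unfolding I2_def by (intro has_integral_add integrable_integral)
  then have "((\<lambda>x. - \<i> * (\<i> * cis (f x))) has_integral - \<i> * (G d - G c + I2)) {c..d}"
    by (intro has_integral_mult_right) simp
  then have "integral {c..d} (\<lambda>x. cis (f x)) = - \<i> * (G d - G c + I2)"
    by (intro integral_unique) (simp add: mult.assoc[symmetric])
  then have "norm (integral {c..d} (\<lambda>x. cis (f x))) = norm (G d - G c + I2)" by (simp add: norm_mult)
  moreover have "norm (G d - G c + I2) \<le> norm (G d) + norm (G c) + norm I2"
    by (meson norm_triangle_ineq norm_triangle_ineq4 add_right_mono order_trans)
  moreover have "norm I2 \<le> integral {c..d} w"
    unfolding I2_def
  proof (rule integral_norm_bound_integral[OF int2])
    show "w integrable_on {c..d}" using w_int by blast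
    show "norm (of_real (w x) * cis (f x)) \<le> w x" if "x \<in> {c..d}" for x

    proof -
      have "w x \<ge> 0" using pos[OF that] by (simp add: w_def)
      then show ?thesis by (simp add: norm_mult)
    qed
  qed
  moreover have "integral {c..d} w = 1 / f' c - 1 / f' d" using w_int by (simp add: integral_unique)
  moreover have "1 / f' c - 1 / f' d \<le> 1 / \<bar>f' c\<bar> + 1 / \<bar>f' d\<bar>" 
    using abs_ge_self[of "1 / f' c"] abs_ge_minus_self[of "1 / f' d"] unfolding abs_divide abs_one by linarith
  moreover have "norm (G d) = 1 / \<bar>f' d\<bar>" by (simp add: G_def norm_mult norm_divide)
  moreover have "norm (G c) = 1 / \<bar>f' c\<bar>" by (simp add: G_def norm_mult norm_divide)
  moreover have "1 / \<bar>f' d\<bar> + 1 / \<bar>f' c\<bar> + (1 / \<bar>f' c\<bar> + 1 / \<bar>f' d\<bar>) \<le> 4 / \<mu>"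
  proof -
    have "1 / \<bar>f' x\<bar> \<le> 1 / \<mu>" if "x \<in> {c..d}" for x
      using \<mu>(2)[OF that] \<mu>(1) by (intro divide_left_mono) auto
    from this[of c] this[of d] show ?thesis using cd by simp
  qed
  ultimately show ?thesis by linarith
qed

lemma norm_add3_le: "norm (x + (y + z)) \<le> norm x + (norm y + norm z)"
  by (meson add_left_mono norm_triangle_ineq order_trans)

text \<open>As f' grows at rate at least \<open>lam\<close>, its absolute value is at least
  \<open>lam\<close> times the distance to a point x0, a zero of f' or an end of the interval. Near
  x0 the trivial bound gives 2 / sqrt lam; the two remaining sides give 4 / sqrt lam each.\<close>

lemma van_der_corput_second_derivative:
  fixes f f' f'' :: "real \<Rightarrow> real"
  assumes ab: "a \<le> b"
    and f': "\<And>x. x \<in> {a..b} \<Longrightarrow> (f has_real_derivative f' x) (at x)"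
    and f'': "\<And>x. x \<in> {a..b} \<Longrightarrow> (f' has_real_derivative f'' x) (at x)"
    and cont: "continuous_on {a..b} f''"
    and lam: "lam > 0" "\<And>x. x \<in> {a..b} \<Longrightarrow> f'' x \<ge> lam"
  shows "norm (integral {a..b} (\<lambda>x. cis (f x))) \<le> 10 / sqrt lam"
proof -
  have contf: "continuous_on {a..b} f" using DERIV_isCont[OF f'] by (intro continuous_at_imp_continuous_on ballI) blast
  have contf': "continuous_on {a..b} f'" using DERIV_isCont[OF f''] by (intro continuous_at_imp_continuous_on ballI) blast
  have incr: "f' y - f' x \<ge> lam * (y - x)" if "x \<in> {a..b}" "y \<in> {a..b}" "x \<le> y" for x y
  proof (cases "x = y")
    case False
    then have "x < y" using that by simp
    moreover have "\<And>z. x \<le> z \<Longrightarrow> z \<le> y \<Longrightarrow> (f' has_real_derivative f'' z) (at z)" using that f'' by auto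
    ultimately obtain z where "x < z" "z < y" "f' y - f' x = (y - x) * f'' z" using MVT2 by blast
    moreover have "f'' z \<ge> lam" using lam that \<open>x < z\<close> \<open>z < y\<close> by auto
    ultimately show ?thesis using \<open>x < y\<close> by (simp add: mult.commute mult_left_mono)
  qed simp
  have "\<exists>x0\<in>{a..b}. \<forall>x\<in>{a..b}. lam * \<bar>x - x0\<bar> \<le> \<bar>f' x\<bar>"
  proof -
    have *: ?thesis if "x0 \<in> {a..b}" "\<And>x. x \<in> {a..b} \<Longrightarrow> x0 \<le> x \<Longrightarrow> lam * (x - x0) \<le> \<bar>f' x\<bar>"
      "\<And>x. x \<in> {a..b} \<Longrightarrow> x \<le> x0 \<Longrightarrow> lam * (x0 - x) \<le> \<bar>f' x\<bar>" for x0
    proof (intro bexI[of _ x0] ballI)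
      fix x assume "x \<in> {a..b}"
      then show "lam * \<bar>x - x0\<bar> \<le> \<bar>f' x\<bar>"
        using that(2)[of x] that(3)[of x] by (cases "x0 \<le> x") auto
    qed (rule that(1))
    consider "f' a \<ge> 0" | "f' b \<le> 0" | "f' a < 0" "f' b > 0" by linarith
    then show ?thesis
    proof cases
      case 1
      show ?thesis
      proof (rule *[of a])
        fix x assume x: "x \<in> {a..b}" "a \<le> x"
        then show "lam * (x - a) \<le> \<bar>f' x\<bar>" using incr[of a x] ab 1 by simp
      next
        fix x assume "x \<in> {a..b}" "x \<le> a"
        then show "lam * (a - x) \<le> \<bar>f' x\<bar>" by simp
      qed (use ab in simp)
    next
      case 2
      show ?thesis
      proof (rule *[of b])
        fix x assume x: "x \<in> {a..b}" "x \<le> b"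
        then show "lam * (b - x) \<le> \<bar>f' x\<bar>" using incr[of x b] ab 2 by simp
      next
        fix x assume "x \<in> {a..b}" "b \<le> x"
        then show "lam * (x - b) \<le> \<bar>f' x\<bar>" by simp
      qed (use ab in simp)
    next
      case 3
      then obtain x0 where x0: "a \<le> x0" "x0 \<le> b" "f' x0 = 0" using IVT'[of f' a 0 b] contf' ab by auto
      show ?thesis
      proof (rule *[of x0])
        fix x assume x: "x \<in> {a..b}" "x0 \<le> x"
        then show "lam * (x - x0) \<le> \<bar>f' x\<bar>" using incr[of x0 x] x0 by simp
      next
        fix x assume x: "x \<in> {a..b}" "x \<le> x0"
        then show "lam * (x0 - x) \<le> \<bar>f' x\<bar>" using incr[of x x0] x0 by simp
      qed (use x0 in simp)
    qed
  qed
  then obtain x0 where x0: "x0 \<in> {a..b}" "\<And>x. x \<in> {a..b} \<Longrightarrow> lam * \<bar>x - x0\<bar> \<le> \<bar>f' x\<bar>"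
    by blast
  \<comment> \<open>At this distance from x0 the lower bound for |f'| is sqrt lam, so all three
    pieces have the same order.\<close>
  define t where "t = 1 / sqrt lam"
  have t: "t > 0" using lam by (simp add: t_def)
  have lt: "lam * t = sqrt lam" using lam by (simp add: t_def real_div_sqrt)
  define c where "c = max a (x0 - t)"
  define d where "d = min b (x0 + t)"
  have acdb: "a \<le> c" "c \<le> d" "d \<le> b" "d - c \<le> 2 * t" using x0(1) t by (auto simp: c_def d_def)
  have contc: "continuous_on {a..b} (\<lambda>x. cis (f x))" by (intro continuous_on_cis contf)
  have int: "(\<lambda>x. cis (f x)) integrable_on {a..b}" by (rule integrable_continuous_real[OF contc])
  have part: "norm (integral {u..v} (\<lambda>x. cis (f x))) \<le> 4 / sqrt lam"
    if uv: "a \<le> u" "v \<le> b" "u \<le> v" "u = v \<or> (\<forall>x\<in>{u..v}. t \<le> \<bar>x - x0\<bar>)" for u v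
  proof (cases "u = v")
    case True
    then show ?thesis using lam by simp
  next
    case False
    have sub: "{u..v} \<subseteq> {a..b}" using uv by auto
    show ?thesis
    proof (rule oscillatory_first_derivative[of u v f f' f''])
      show "(f has_real_derivative f' x) (at x within {u..v})" if "x \<in> {u..v}" for x
        using f'[of x] that sub by (auto intro: has_field_derivative_at_within)
      show "(f' has_real_derivative f'' x) (at x within {u..v})" if "x \<in> {u..v}" for x
        using f''[of x] that sub by (auto intro: has_field_derivative_at_within)
      show "continuous_on {u..v} f''" using cont sub by (rule continuous_on_subset)
      show "f'' x \<ge> 0" if "x \<in> {u..v}" for x using lam(1) lam(2)[of x] that sub by force
      show "\<bar>f' x\<bar> \<ge> sqrt lam" if x: "x \<in> {u..v}" for x
      proof -
        have "sqrt lam = lam * t" by (rule lt[symmetric])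
        also have "\<dots> \<le> lam * \<bar>x - x0\<bar>" using uv(4) False x lam by (intro mult_left_mono) auto
        also have "\<dots> \<le> \<bar>f' x\<bar>" using x sub by (intro x0(2)) auto
        finally show ?thesis .
      qed
    qed (use uv lam in auto)
  qed
  have "integral {a..b} (\<lambda>x. cis (f x)) = integral {a..c} (\<lambda>x. cis (f x)) + integral {c..b} (\<lambda>x. cis (f x))"
    using acdb int by (intro Henstock_Kurzweil_Integration.integral_combine[symmetric]) auto
  also have "integral {c..b} (\<lambda>x. cis (f x)) = integral {c..d} (\<lambda>x. cis (f x)) + integral {d..b} (\<lambda>x. cis (f x))"
    using acdb int by (intro Henstock_Kurzweil_Integration.integral_combine[symmetric]) (auto intro: integrable_subinterval_real)
  finally have "norm (integral {a..b} (\<lambda>x. cis (f x))) \<le>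
      norm (integral {a..c} (\<lambda>x. cis (f x))) + (norm (integral {c..d} (\<lambda>x. cis (f x))) + norm (integral {d..b} (\<lambda>x. cis (f x))))"
    by (simp only: norm_add3_le)
  also have "\<dots> \<le> 4 / sqrt lam + (2 * t + 4 / sqrt lam)"
  proof (intro add_mono)
    show "norm (integral {a..c} (\<lambda>x. cis (f x))) \<le> 4 / sqrt lam"
      by (rule part) (use acdb x0(1) t in \<open>auto simp: c_def max_def\<close>)
    show "norm (integral {d..b} (\<lambda>x. cis (f x))) \<le> 4 / sqrt lam"
      by (rule part) (use acdb x0(1) t in \<open>auto simp: d_def min_def\<close>)
    have "norm (integral {c..d} (\<lambda>x. cis (f x))) \<le> 1 * (d - c)"
      using acdb by (intro integral_bound continuous_on_subset[OF contc]) auto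
    then show "norm (integral {c..d} (\<lambda>x. cis (f x))) \<le> 2 * t" using acdb by simp
  qed
  finally show ?thesis by (simp add: t_def)
qed

text \<open>The second derivative of the phase is 2 pi k \<rho>^2 (\<rho>^2 - y^2)^(-3/2), which is
  at least 2 pi k / \<rho> and independent of l. The square root is singular at both ends, so short
  end intervals are cut off and bounded trivially.\<close>

lemma semicircle_oscillatory_integral:
  fixes \<rho> k l :: real
  assumes \<rho>: "\<rho> > 0" and k: "k > 0"
  shows "norm (integral {-\<rho>..\<rho>} (\<lambda>y. cis (- (2 * pi * (l * y + k * sqrt (\<rho>\<^sup>2 - y\<^sup>2)))))) \<le> 10 / sqrt (2 * pi * k / \<rho>)"
proof (rule field_le_epsilon)
  fix e :: real assume e: "e > 0"
  define f where "f = (\<lambda>y. - (2 * pi * (l * y + k * sqrt (\<rho>\<^sup>2 - y\<^sup>2))))"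
  define f' where "f' = (\<lambda>y. - (2 * pi * l) + 2 * pi * k * (y / sqrt (\<rho>\<^sup>2 - y\<^sup>2)))"
  define f'' where "f'' = (\<lambda>y. 2 * pi * k * (1 / sqrt (\<rho>\<^sup>2 - y\<^sup>2) + y\<^sup>2 / (sqrt (\<rho>\<^sup>2 - y\<^sup>2)) ^ 3))"
  \<comment> \<open>The two end intervals have total length at most e.\<close>
  define \<eta> where "\<eta> = min (e / 2) \<rho>"
  have \<eta>: "\<eta> > 0" "\<eta> \<le> \<rho>" "2 * \<eta> \<le> e" using e \<rho> by (auto simp: \<eta>_def)
  define a where "a = - \<rho> + \<eta>"
  define b where "b = \<rho> - \<eta>"
  have ab: "- \<rho> \<le> a" "a \<le> b" "b \<le> \<rho>" using \<eta> by (auto simp: a_def b_def)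
  have pos: "\<rho>\<^sup>2 - y\<^sup>2 > 0" if "y \<in> {a..b}" for y
  proof -
    have "\<bar>y\<bar> < \<rho>" using that \<eta> by (auto simp: a_def b_def)
    then have "\<bar>y\<bar>\<^sup>2 < \<rho>\<^sup>2" by (intro power_strict_mono) auto
    then show ?thesis by simp
  qed
  have main: "norm (integral {a..b} (\<lambda>x. cis (f x))) \<le> 10 / sqrt (2 * pi * k / \<rho>)"
  proof (rule van_der_corput_second_derivative[of a b f f' f''])
    fix x assume x: "x \<in> {a..b}"
    note p = pos[OF x]
    show "(f has_real_derivative f' x) (at x)"
      unfolding f_def f'_def using p
      by (auto intro!: derivative_eq_intros simp: field_simps)
    show "(f' has_real_derivative f'' x) (at x)"
      unfolding f'_def f''_def using p
      by (auto intro!: derivative_eq_intros simp: field_simps power2_eq_square power3_eq_cube)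
    have s: "sqrt (\<rho>\<^sup>2 - x\<^sup>2) > 0" "sqrt (\<rho>\<^sup>2 - x\<^sup>2) \<le> \<rho>"
      using p \<rho> by (auto intro!: real_le_lsqrt)
    have "1 / \<rho> \<le> 1 / sqrt (\<rho>\<^sup>2 - x\<^sup>2) + 0" using s \<rho> by (simp add: frac_le)
    also have "\<dots> \<le> 1 / sqrt (\<rho>\<^sup>2 - x\<^sup>2) + x\<^sup>2 / (sqrt (\<rho>\<^sup>2 - x\<^sup>2)) ^ 3" using s by (intro add_left_mono) simp
    finally have "2 * pi * k * (1 / \<rho>) \<le> f'' x" unfolding f''_def using k by (intro mult_left_mono) auto
    then show "2 * pi * k / \<rho> \<le> f'' x" by simp
  next
    show "continuous_on {a..b} f''" unfolding f''_def using pos by (intro continuous_intros) (auto simp: less_imp_neq[THEN not_sym])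
  qed (use ab k \<rho> in auto)
  have contf: "continuous_on {-\<rho>..\<rho>} f" unfolding f_def by (intro continuous_intros)
  have contc: "continuous_on {-\<rho>..\<rho>} (\<lambda>x. cis (f x))" by (intro continuous_on_cis contf)
  have int: "(\<lambda>x. cis (f x)) integrable_on {-\<rho>..\<rho>}" by (rule integrable_continuous_real[OF contc])
  have "integral {-\<rho>..\<rho>} (\<lambda>x. cis (f x)) = integral {-\<rho>..a} (\<lambda>x. cis (f x)) + integral {a..\<rho>} (\<lambda>x. cis (f x))"
    using ab int by (intro Henstock_Kurzweil_Integration.integral_combine[symmetric]) auto
  also have "integral {a..\<rho>} (\<lambda>x. cis (f x)) = integral {a..b} (\<lambda>x. cis (f x)) + integral {b..\<rho>} (\<lambda>x. cis (f x))"
    using ab int by (intro Henstock_Kurzweil_Integration.integral_combine[symmetric]) (auto intro: integrable_subinterval_real)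
  finally have "norm (integral {-\<rho>..\<rho>} (\<lambda>x. cis (f x))) \<le>
      norm (integral {-\<rho>..a} (\<lambda>x. cis (f x))) + (norm (integral {a..b} (\<lambda>x. cis (f x))) + norm (integral {b..\<rho>} (\<lambda>x. cis (f x))))"
    by (simp only: norm_add3_le)
  also have "\<dots> \<le> 1 * (a - - \<rho>) + (10 / sqrt (2 * pi * k / \<rho>) + 1 * (\<rho> - b))"
    using ab by (intro add_mono main integral_bound continuous_on_subset[OF contc]) auto
  also have "\<dots> \<le> 10 / sqrt (2 * pi * k / \<rho>) + e" using \<eta> by (simp add: a_def b_def)
  finally show "norm (integral {-\<rho>..\<rho>} (\<lambda>y. cis (- (2 * pi * (l * y + k * sqrt (\<rho>\<^sup>2 - y\<^sup>2)))))) \<le> 10 / sqrt (2 * pi * k / \<rho>) + e"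
    by (simp add: f_def)
qed

text \<open>In terms of Bessel functions this is \<rho> J_1(2 pi \<rho> |\<xi>|) / |\<xi>| at \<xi>
  = (k, l), which explains the decay |\<xi>|^(-3/2).\<close>

definition disc_coeff :: "real \<Rightarrow> real \<Rightarrow> real \<Rightarrow> complex" where
  "disc_coeff \<rho> k l = (LINT z|(lborel :: (real \<times> real) measure).
     indicator (cball 0 \<rho>) z *\<^sub>R cis (- (2 * pi * (k * fst z + l * snd z))))"

lemma disc_integrable:
  fixes f :: "real \<times> real \<Rightarrow> 'b::{banach, second_countable_topology}"
  assumes "continuous_on UNIV f"
  shows "integrable lborel (\<lambda>z. indicator (cball 0 \<rho>) z *\<^sub>R f z)"
  by (intro borel_integrable_compact continuous_on_subset[OF assms]) auto

lemma indicator_disc: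
  assumes "\<rho> > 0"
  shows "indicator (cball 0 \<rho>) (x, y) =
    (indicator {-\<rho>..\<rho>} y * indicator {-sqrt (\<rho>\<^sup>2 - y\<^sup>2)..sqrt (\<rho>\<^sup>2 - y\<^sup>2)} x :: real)"
proof -
  have "(x, y) \<in> cball 0 \<rho> \<longleftrightarrow> sqrt (x\<^sup>2 + y\<^sup>2) \<le> \<rho>" by (simp add: norm_Pair)
  also have "\<dots> \<longleftrightarrow> x\<^sup>2 + y\<^sup>2 \<le> \<rho>\<^sup>2"
    using assms by (metis less_eq_real_def real_sqrt_abs abs_of_pos real_sqrt_le_iff)
  also have "\<dots> \<longleftrightarrow> y \<in> {-\<rho>..\<rho>} \<and> x \<in> {-sqrt (\<rho>\<^sup>2 - y\<^sup>2)..sqrt (\<rho>\<^sup>2 - y\<^sup>2)}"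
  proof -
    have y: "y\<^sup>2 \<le> \<rho>\<^sup>2 \<longleftrightarrow> y \<in> {-\<rho>..\<rho>}" using assms abs_le_square_iff[of y \<rho>] by (auto simp: abs_le_iff)
    have x: "x\<^sup>2 \<le> s \<longleftrightarrow> x \<in> {-sqrt s..sqrt s}" if "s \<ge> 0" for s
      using abs_le_square_iff[of x "sqrt s"] that by (auto simp: abs_le_iff)
    have "x\<^sup>2 + y\<^sup>2 \<le> \<rho>\<^sup>2 \<longleftrightarrow> y\<^sup>2 \<le> \<rho>\<^sup>2 \<and> x\<^sup>2 \<le> \<rho>\<^sup>2 - y\<^sup>2"
      using zero_le_power2[of x] by linarith
    then show ?thesis using x[of "\<rho>\<^sup>2 - y\<^sup>2"] y by auto
  qed
  finally show ?thesis by (auto simp: indicator_def)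
qed

lemma disc_coeff_swap: "disc_coeff \<rho> k l = disc_coeff \<rho> l k"
proof -
  define f where "f = (\<lambda>k l (x::real) (y::real). indicator (cball 0 \<rho>) (x, y) *\<^sub>R cis (- (2 * pi * (k * x + l * y))))"
  have int: "integrable (lborel \<Otimes>\<^sub>M lborel) (case_prod (f k l))" for k l
  proof -
    have "integrable lborel (\<lambda>z. indicator (cball 0 \<rho>) z *\<^sub>R cis (- (2 * pi * (k * fst z + l * snd z))))"
      by (intro disc_integrable continuous_intros continuous_on_cis)
    then show ?thesis unfolding lborel_prod f_def by (simp add: case_prod_unfold)
  qed
  have eq: "disc_coeff \<rho> k l = integral\<^sup>L (lborel \<Otimes>\<^sub>M lborel) (case_prod (f k l))" for k l
    unfolding disc_coeff_def lborel_prod f_def by (simp add: case_prod_unfold)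
  have sym: "f k l x y = f l k y x" for x y by (simp add: f_def norm_Pair add.commute indicator_def)
  have "disc_coeff \<rho> k l = (LINT x|lborel. LINT y|lborel. f k l x y)"
    unfolding eq by (rule lborel_pair.integral_fst[OF int, symmetric])
  also have "\<dots> = (LINT x|lborel. LINT y|lborel. f l k y x)" by (simp add: sym)
  also have "\<dots> = disc_coeff \<rho> l k" unfolding eq by (rule lborel_pair.integral_snd[OF int])
  finally show ?thesis .
qed

lemma interval_lborel_integral:
  fixes g :: "real \<Rightarrow> 'a::euclidean_space"
  assumes "continuous_on {a..b} g"
  shows "(LINT x|lborel. indicator {a..b} x *\<^sub>R g x) = integral {a..b} g"
proof -
  have "set_integrable lborel {a..b} g"
    unfolding set_integrable_def using assms by (intro borel_integrable_compact) auto
  from set_borel_integral_eq_integral(2)[OF this] show ?thesis by (simp add: set_lebesgue_integral_def)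
qed

lemma integral_cis_interval:
  assumes k: "k > 0" and s: "s \<ge> 0"
  shows "integral {-s..s} (\<lambda>x. cis (- (2 * pi * (k * x)))) = (cis (2 * pi * (k * s)) - cis (- (2 * pi * (k * s)))) / (2 * pi * k * \<i>)"
proof -
  define c where "c = \<i> * complex_of_real (2 * pi * k)"
  have c0: "c \<noteq> 0" using k by (simp add: c_def)
  have deriv: "((\<lambda>x. cis (- (2 * pi * (k * x)))) has_vector_derivative (\<i> * of_real (- (2 * pi * k)) * cis (- (2 * pi * (k * x))))) (at x within {-s..s})" for x
    by (rule has_vector_derivative_cis) (auto intro!: derivative_eq_intros)
  have "((\<lambda>x. \<i> * of_real (- (2 * pi * k)) * cis (- (2 * pi * (k * x)))) has_integral (cis (- (2 * pi * (k * s))) - cis (- (2 * pi * (k * (-s)))))) {-s..s}"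
    using s deriv by (intro fundamental_theorem_of_calculus) auto
  then have "((\<lambda>x. - c * cis (- (2 * pi * (k * x)))) has_integral (cis (- (2 * pi * (k * s))) - cis (2 * pi * (k * s)))) {-s..s}"
    by (simp add: c_def)
  then have "((\<lambda>x. - (1 / c) * (- c * cis (- (2 * pi * (k * x))))) has_integral (- (1 / c) * (cis (- (2 * pi * (k * s))) - cis (2 * pi * (k * s))))) {-s..s}"
    by (rule has_integral_mult_right)
  moreover have "- (1 / c) * (- c * z) = z" for z using c0 by simp
  moreover have "- (1 / c) * (u - v) = (v - u) / c" for u v by (simp add: diff_divide_distrib algebra_simps)
  ultimately have "((\<lambda>x. cis (- (2 * pi * (k * x)))) has_integral ((cis (2 * pi * (k * s)) - cis (- (2 * pi * (k * s)))) / c)) {-s..s}"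
    by (simp only:)
  then show ?thesis by (simp add: integral_unique c_def mult_ac)
qed

text \<open>Integration in x over the chord at height y gives the factor 1 / k; the two remaining
  oscillatory integrals over y will give the further k^(-1/2).\<close>

lemma disc_coeff_iterated:
  assumes \<rho>: "\<rho> > 0" and k: "k > 0"
  shows "disc_coeff \<rho> k l = (integral {-\<rho>..\<rho>} (\<lambda>y. cis (- (2 * pi * (l * y - k * sqrt (\<rho>\<^sup>2 - y\<^sup>2)))))
      - integral {-\<rho>..\<rho>} (\<lambda>y. cis (- (2 * pi * (l * y + k * sqrt (\<rho>\<^sup>2 - y\<^sup>2)))))) / (2 * pi * k * \<i>)"
proof -
  define S where "S = (\<lambda>y. sqrt (\<rho>\<^sup>2 - y\<^sup>2))"
  define f where "f = (\<lambda>(x::real) (y::real). indicator (cball 0 \<rho>) (x, y) *\<^sub>R cis (- (2 * pi * (k * x + l * y))))"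
  define g where "g = (\<lambda>y. cis (- (2 * pi * (l * y))) * ((cis (2 * pi * (k * S y)) - cis (- (2 * pi * (k * S y)))) / (2 * pi * k * \<i>)))"
  have "integrable lborel (\<lambda>z. indicator (cball 0 \<rho>) z *\<^sub>R cis (- (2 * pi * (k * fst z + l * snd z))))"
    by (intro disc_integrable continuous_intros continuous_on_cis)
  then have int: "integrable (lborel \<Otimes>\<^sub>M lborel) (case_prod f)"
    unfolding lborel_prod f_def by (simp add: case_prod_unfold)
  have "disc_coeff \<rho> k l = integral\<^sup>L (lborel \<Otimes>\<^sub>M lborel) (case_prod f)"
    unfolding disc_coeff_def lborel_prod f_def by (simp add: case_prod_unfold)
  also have "\<dots> = (LINT y|lborel. LINT x|lborel. f x y)" by (rule lborel_pair.integral_snd[OF int, symmetric])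
  also have "\<dots> = (LINT y|lborel. indicator {-\<rho>..\<rho>} y *\<^sub>R g y)"
  proof (intro Bochner_Integration.integral_cong refl)
    fix y :: real
    show "(LINT x|lborel. f x y) = indicator {-\<rho>..\<rho>} y *\<^sub>R g y"
    proof (cases "y \<in> {-\<rho>..\<rho>}")
      case True
      then have "\<bar>y\<bar> \<le> \<bar>\<rho>\<bar>" by auto
      then have "y\<^sup>2 \<le> \<rho>\<^sup>2" by (simp add: abs_le_square_iff)
      then have S: "S y \<ge> 0" by (simp add: S_def)
      have "(LINT x|lborel. f x y) = (LINT x|lborel. cis (- (2 * pi * (l * y))) * (indicator {-S y..S y} x *\<^sub>R cis (- (2 * pi * (k * x)))))"
      proof (intro Bochner_Integration.integral_cong refl)
        fix x :: real
        have "cis (- (2 * pi * (k * x + l * y))) = cis (- (2 * pi * (l * y))) * cis (- (2 * pi * (k * x)))"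
          by (simp add: cis_mult algebra_simps)
        then show "f x y = cis (- (2 * pi * (l * y))) * (indicator {-S y..S y} x *\<^sub>R cis (- (2 * pi * (k * x))))"
          using True unfolding f_def indicator_disc[OF \<rho>] S_def by simp
      qed
      also have "\<dots> = cis (- (2 * pi * (l * y))) * (LINT x|lborel. indicator {-S y..S y} x *\<^sub>R cis (- (2 * pi * (k * x))))"
        by (rule integral_mult_right_zero)
      also have "(LINT x|lborel. indicator {-S y..S y} x *\<^sub>R cis (- (2 * pi * (k * x)))) = integral {-S y..S y} (\<lambda>x. cis (- (2 * pi * (k * x))))"
        by (intro interval_lborel_integral continuous_intros continuous_on_cis)
      also have "\<dots> = (cis (2 * pi * (k * S y)) - cis (- (2 * pi * (k * S y)))) / (2 * pi * k * \<i>)"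
        by (rule integral_cis_interval[OF k S])
      finally show ?thesis using True by (simp add: g_def)
    next
      case False
      then show ?thesis unfolding f_def indicator_disc[OF \<rho>] by simp
    qed
  qed
  also have "\<dots> = integral {-\<rho>..\<rho>} g"
    unfolding g_def S_def using k by (intro interval_lborel_integral continuous_intros continuous_on_cis) auto
  also have "\<dots> = integral {-\<rho>..\<rho>} (\<lambda>y. (cis (- (2 * pi * (l * y - k * S y))) - cis (- (2 * pi * (l * y + k * S y)))) / (2 * pi * k * \<i>))"
    by (intro integral_cong) (simp add: g_def cis_mult algebra_simps diff_divide_distrib)
  also have "\<dots> = integral {-\<rho>..\<rho>} (\<lambda>y. cis (- (2 * pi * (l * y - k * S y))) - cis (- (2 * pi * (l * y + k * S y)))) / (2 * pi * k * \<i>)"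
    by (rule integral_divide)
  also have "integral {-\<rho>..\<rho>} (\<lambda>y. cis (- (2 * pi * (l * y - k * S y))) - cis (- (2 * pi * (l * y + k * S y))))
    = integral {-\<rho>..\<rho>} (\<lambda>y. cis (- (2 * pi * (l * y - k * S y)))) - integral {-\<rho>..\<rho>} (\<lambda>y. cis (- (2 * pi * (l * y + k * S y))))"
    unfolding S_def by (intro Henstock_Kurzweil_Integration.integral_diff integrable_continuous_real continuous_intros continuous_on_cis)
  finally show ?thesis by (simp add: S_def)
qed

lemma disc_coeff_bound_pos:
  assumes \<rho>: "\<rho> > 0" "\<rho> \<le> 1" and k: "k > 0"
  shows "norm (disc_coeff \<rho> k l) \<le> 2 * k powr (- (3 / 2))"
proof -
  define B where "B = 10 / sqrt (2 * pi * k / \<rho>)"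
  define I1 where "I1 = integral {-\<rho>..\<rho>} (\<lambda>y. cis (- (2 * pi * (l * y - k * sqrt (\<rho>\<^sup>2 - y\<^sup>2)))))"
  define I2 where "I2 = integral {-\<rho>..\<rho>} (\<lambda>y. cis (- (2 * pi * (l * y + k * sqrt (\<rho>\<^sup>2 - y\<^sup>2)))))"
  have b2: "norm I2 \<le> B" unfolding I2_def B_def by (rule semicircle_oscillatory_integral[OF \<rho>(1) k])
  \<comment> \<open>The integrand with - k is the conjugate of the one with k and - l, so the same
    bound serves both.\<close>
  have "I1 = integral {-\<rho>..\<rho>} (\<lambda>y. cnj (cis (- (2 * pi * (- l * y + k * sqrt (\<rho>\<^sup>2 - y\<^sup>2))))))"
    unfolding I1_def by (intro integral_cong) (simp add: cis_cnj algebra_simps)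
  also have "\<dots> = cnj (integral {-\<rho>..\<rho>} (\<lambda>y. cis (- (2 * pi * (- l * y + k * sqrt (\<rho>\<^sup>2 - y\<^sup>2))))))"
    by (rule Henstock_Kurzweil_Integration.integral_cnj[symmetric])
  finally have b1: "norm I1 \<le> B" unfolding B_def using semicircle_oscillatory_integral[OF \<rho>(1) k, of "- l"] by simp
  have "norm (disc_coeff \<rho> k l) = norm (I1 - I2) / (2 * pi * k)"
    unfolding disc_coeff_iterated[OF \<rho>(1) k] I1_def I2_def using k by (simp add: norm_divide norm_mult)
  also have "\<dots> \<le> (B + B) / (2 * pi * k)"
    using norm_triangle_ineq4[of I1 I2] b1 b2 k by (intro divide_right_mono) auto
  also have "\<dots> = B / (pi * k)" by (simp add: field_simps)
  also have "\<dots> \<le> 10 / sqrt (4 * k) / (pi * k)"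
  proof (rule divide_right_mono)
    show "B \<le> 10 / sqrt (4 * k)"
      unfolding B_def
    proof (intro divide_left_mono real_sqrt_le_mono)
      have "4 * k \<le> 2 * pi * k" using pi_ge_two k by simp
      also have "\<dots> \<le> 2 * pi * k / \<rho>" using \<rho> k by (simp add: field_simps)
      finally show "4 * k \<le> 2 * pi * k / \<rho>" .
    qed (use \<rho> k in auto)
  qed (use k in simp)
  also have "\<dots> = (5 / pi) * (1 / (sqrt k * k))" using k by (simp add: real_sqrt_mult)
  also have "\<dots> \<le> 2 * (1 / (sqrt k * k))" 
  proof (rule mult_right_mono)
    have "pi > 3" by (rule pi_gt3)
    then show "5 / pi \<le> 2" by (simp add: field_simps)
  qed (use k in simp)
  also have "2 * (1 / (sqrt k * k)) = 2 * k powr (- (3 / 2))"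
  proof -
    have "sqrt k * k = k powr (1 / 2) * k powr 1" using k by (simp add: powr_half_sqrt)
    also have "\<dots> = k powr (3 / 2)" by (subst powr_add[symmetric]) simp
    finally show ?thesis by (simp add: powr_minus_divide)
  qed
  finally show ?thesis .
qed

text \<open>Conjugation reverses the signs of both frequencies and reflection in the diagonal
  exchanges them, so the larger one may be assumed first and positive.\<close>

lemma disc_coeff_bound:
  fixes k l :: int
  assumes \<rho>: "\<rho> > 0" "\<rho> \<le> 1" and kl: "(k, l) \<noteq> (0, 0)"
  shows "norm (disc_coeff \<rho> (of_int k) (of_int l)) \<le> 2 * of_int (max \<bar>k\<bar> \<bar>l\<bar>) powr (- (3 / 2))"
proof -
  have conj: "norm (disc_coeff \<rho> (- a) (- b)) = norm (disc_coeff \<rho> a b)" for a b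
  proof -
    have "disc_coeff \<rho> (- a) (- b) = cnj (disc_coeff \<rho> a b)"
      unfolding disc_coeff_def Bochner_Integration.integral_cnj[symmetric]
      by (intro Bochner_Integration.integral_cong) (auto simp: cis_cnj algebra_simps)
    then show ?thesis by simp
  qed
  have one: "norm (disc_coeff \<rho> a b) \<le> 2 * \<bar>a\<bar> powr (- (3 / 2))" if "a \<noteq> 0" for a b
    using disc_coeff_bound_pos[OF \<rho>, of a b] disc_coeff_bound_pos[OF \<rho>, of "- a" "- b"] that
    by (cases "a > 0") (auto simp: conj)
  show ?thesis
  proof (cases "\<bar>l\<bar> \<le> \<bar>k\<bar>")
    case True
    then have "k \<noteq> 0" using kl by auto
    then show ?thesis using one[of "of_int k" "of_int l"] True by (simp add: max_absorb1)
  next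
    case False
    then have "l \<noteq> 0" by auto
    then show ?thesis using one[of "of_int l" "of_int k"] False by (simp add: disc_coeff_swap[of \<rho> "of_int k"] max_absorb2)
  qed
qed

section \<open>Smoothing\<close>

definition trig :: "int \<Rightarrow> real \<Rightarrow> complex" where
  "trig k x = cis (2 * pi * (of_int k * x))"

lemma trig_0 [simp]: "trig 0 x = 1"
  by (simp add: trig_def)

lemma norm_trig [simp]: "norm (trig k x) = 1"
  by (simp add: trig_def)

lemma trig_add: "trig (k + l) x = trig k x * trig l x"
  by (simp add: trig_def cis_mult algebra_simps)

lemma cnj_trig: "cnj (trig k x) = trig (- k) x"
  by (simp add: trig_def cis_cnj)

lemma continuous_trig [continuous_intros]: "continuous_on S (trig k)"
  unfolding trig_def by (intro continuous_on_cis continuous_intros)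

lemma trig_plus_int: "trig k (x + of_int n) = trig k x"
proof -
  have "cis (2 * pi * of_int (k * n)) = 1"
    by (rule cis_multiple_2pi) auto
  then show ?thesis by (simp add: trig_def cis_mult[symmetric] distrib_left)
qed

lemma integral_trig: "integral {0..1} (trig k) = (if k = 0 then 1 else 0)"
proof (cases "k = 0")
  case False
  define c where "c = \<i> * complex_of_real (2 * pi * of_int k)"
  have c: "c \<noteq> 0" using False by (simp add: c_def)
  have "(trig k has_vector_derivative c * trig k x) (at x within {0..1})" for x
    unfolding trig_def c_def by (rule has_vector_derivative_cis) (auto intro!: derivative_eq_intros)
  then have "((\<lambda>x. c * trig k x) has_integral (trig k 1 - trig k 0)) {0..1}"
    by (intro fundamental_theorem_of_calculus) auto
  moreover have "trig k 1 = trig k 0" using trig_plus_int[of k 0 1] by simp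
  ultimately have "((\<lambda>x. (1 / c) * (c * trig k x)) has_integral (1 / c) * 0) {0..1}"
    by (intro has_integral_mult_right) simp
  then have "(trig k has_integral 0) {0..1}" using c by simp
  then show ?thesis using False by (simp add: integral_unique)
next
  case True
  moreover have "trig 0 = (\<lambda>_. 1)" by (rule ext) simp
  ultimately show ?thesis by simp
qed

definition trig_poly :: "int \<Rightarrow> (real \<Rightarrow> complex) \<Rightarrow> bool" where
  "trig_poly H f \<longleftrightarrow> (\<exists>c. \<forall>x. f x = (\<Sum>k\<in>{-H..H}. c k * trig k x))"

lemma trig_poly_mult:
  assumes "trig_poly H f" "trig_poly G g"
  shows "trig_poly (H + G) (\<lambda>x. f x * g x)"
proof -
  from assms obtain c d where c: "\<And>x. f x = (\<Sum>k\<in>{-H..H}. c k * trig k x)"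
    and d: "\<And>x. g x = (\<Sum>k\<in>{-G..G}. d k * trig k x)" unfolding trig_poly_def by blast
  define e where "e = (\<lambda>m. \<Sum>z | z \<in> {-H..H} \<times> {-G..G} \<and> fst z + snd z = m. c (fst z) * d (snd z))"
  have "f x * g x = (\<Sum>m\<in>{-(H + G)..H + G}. e m * trig m x)" for x
  proof -
    have "f x * g x = (\<Sum>z\<in>{-H..H} \<times> {-G..G}. c (fst z) * d (snd z) * trig (fst z + snd z) x)"
      unfolding c d sum_product sum.cartesian_product by (intro sum.cong) (auto simp: trig_add mult_ac)
    also have "\<dots> = (\<Sum>m\<in>{-(H + G)..H + G}. \<Sum>z | z \<in> {-H..H} \<times> {-G..G} \<and> fst z + snd z = m. c (fst z) * d (snd z) * trig (fst z + snd z) x)"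
      by (rule sum.group[symmetric]) auto
    also have "\<dots> = (\<Sum>m\<in>{-(H + G)..H + G}. e m * trig m x)"
      unfolding e_def sum_distrib_right by (intro sum.cong refl) auto
    finally show ?thesis .
  qed
  then show ?thesis unfolding trig_poly_def by (intro exI[of _ e]) auto
qed

lemma trig_poly_power:
  assumes "trig_poly H f" "H \<ge> 0"
  shows "trig_poly (int n * H) (\<lambda>x. f x ^ n)"
proof (induction n)
  case 0
  show ?case unfolding trig_poly_def by (intro exI[of _ "\<lambda>_. 1"]) simp
next
  case (Suc n)
  from trig_poly_mult[OF assms(1) Suc] show ?case by (simp add: algebra_simps)
qed

lemma sin_ge_quarter: 
  assumes "0 \<le> t" "t \<le> pi / 2"
  shows "t / 4 \<le> sin t"
proof (cases "t \<le> pi / 3")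
  case True
  show ?thesis
  proof (cases "t = 0")
    case False
    then have t: "0 < t" using assms by simp
    obtain z where z: "0 < z" "z < t" "sin t - sin 0 = (t - 0) * cos z"
      using MVT2[of 0 t sin cos] t by auto
    have "cos (pi / 3) \<le> cos z" using z True by (intro cos_monotone_0_pi_le) auto
    then have "1 / 2 \<le> cos z" by (simp add: cos_60)
    then have "t * (1 / 2) \<le> t * cos z" using t by (intro mult_left_mono) auto
    then show ?thesis using z t by simp
  qed simp
next
  case False
  have "sin (pi / 6) \<le> sin t" using False assms by (intro sin_monotone_2pi_le) auto
  then have "1 / 2 \<le> sin t" by (simp add: sin_30)
  moreover have "t \<le> 2" using assms pi_less_4 by simp
  ultimately show ?thesis by simp
qed

lemma norm_trig_1_minus_1:
  assumes "0 \<le> d" "d \<le> x" "x \<le> 1 - d"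
  shows "d \<le> norm (trig 1 x - 1)"
proof -
  have eq: "norm (trig 1 x - 1) = 2 * \<bar>sin (pi * x)\<bar>"
  proof -
    have "(norm (trig 1 x - 1))\<^sup>2 = (cos (2 * (pi * x)) - 1)\<^sup>2 + (sin (2 * (pi * x)))\<^sup>2"
      by (simp add: trig_def cmod_power2 mult.assoc)
    also have "\<dots> = 4 * (sin (pi * x))\<^sup>2 * ((sin (pi * x))\<^sup>2 + (cos (pi * x))\<^sup>2)"
    proof -
      have "(1 - 2 * s\<^sup>2 - 1)\<^sup>2 + (2 * s * c)\<^sup>2 = 4 * s\<^sup>2 * (s\<^sup>2 + c\<^sup>2)" for s c :: real
        by (simp add: power2_eq_square algebra_simps)
      then show ?thesis unfolding cos_double_sin sin_double .
    qed
    also have "\<dots> = \<bar>2 * sin (pi * x)\<bar>\<^sup>2" by (simp add: power_mult_distrib)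
    finally have "norm (trig 1 x - 1) = \<bar>2 * sin (pi * x)\<bar>"
      by (rule power2_eq_imp_eq) auto
    then show ?thesis by (simp add: abs_mult)
  qed
  have half: "y / 2 \<le> sin (pi * y)" if "0 \<le> y" "y \<le> 1 / 2" for y
  proof -
    have "pi * y / 4 \<le> sin (pi * y)" using that by (intro sin_ge_quarter) auto
    moreover have "2 * y \<le> pi * y" using that pi_ge_two by (intro mult_right_mono) auto
    ultimately show ?thesis by linarith
  qed
  have "d / 2 \<le> sin (pi * x)"
  proof (cases "x \<le> 1 / 2")
    case True
    then show ?thesis using half[of x] assms by simp
  next
    case False
    have "sin (pi * x) = sin (pi * (1 - x))" by (simp add: right_diff_distrib sin_diff)
    then show ?thesis using half[of "1 - x"] assms False by simp
  qed
  then show ?thesis unfolding eq using assms by simp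
qed

text \<open>J is a normalised power |D|^(2 A) of a Dirichlet kernel, a generalised Jackson kernel.
  At distance d from the integers |D| is at most 2 / d by the geometric sum, so a large A makes the
  tail as small as (d M)^(-2 A), up to constants and a factor M from the normalisation.\<close>

lemma smoothing_kernel:
  fixes M A :: nat
  assumes M: "M \<ge> 1" and A: "A \<ge> 1"
  defines "H \<equiv> int (2 * A * M)"
  obtains J :: "real \<Rightarrow> real" and a :: "int \<Rightarrow> complex" where
    "continuous_on UNIV J" "\<And>x. J x \<ge> 0" "\<And>x n. J (x + of_int n) = J x" "integral {0..1} J = 1"
    "\<And>x. complex_of_real (J x) = (\<Sum>k\<in>{-H..H}. a k * trig k x)"
    "\<And>k. norm (a k) \<le> 1" "a 0 = 1"
    "\<And>d x. 0 < d \<Longrightarrow> d \<le> x \<Longrightarrow> x \<le> 1 - d \<Longrightarrow> J x \<le> 5 * real A * real M * (2 / (d * real M)) ^ (2 * A)"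
proof -
  define D where "D = (\<lambda>x. \<Sum>n<M. trig (int n) x)"
  define F where "F = (\<lambda>x. norm (D x) ^ (2 * A))"
  have H0: "H \<ge> 0" by (simp add: H_def)
  have tpD: "trig_poly (int M) D"
    unfolding trig_poly_def
  proof (intro exI allI)
    fix x
    have "(\<Sum>k\<in>{-int M..int M}. (if k \<in> int ` {..<M} then 1 else 0) * trig k x) = (\<Sum>k\<in>int ` {..<M}. trig k x)"
      by (rule sum.mono_neutral_cong_right) (auto simp: image_iff)
    then show "D x = (\<Sum>k\<in>{-int M..int M}. (if k \<in> int ` {..<M} then 1 else 0) * trig k x)"
      by (simp add: D_def sum.reindex)
  qed
  have tpD': "trig_poly (int M) (\<lambda>x. cnj (D x))"
    unfolding trig_poly_def
  proof (intro exI allI)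
    fix x
    have "(\<Sum>k\<in>{-int M..int M}. (if k \<in> (\<lambda>n. - int n) ` {..<M} then 1 else 0) * trig k x) = (\<Sum>k\<in>(\<lambda>n. - int n) ` {..<M}. trig k x)"
      by (rule sum.mono_neutral_cong_right) (auto simp: image_iff)
    also have "\<dots> = (\<Sum>n<M. trig (- int n) x)" by (simp add: sum.reindex inj_on_def)
    finally show "cnj (D x) = (\<Sum>k\<in>{-int M..int M}. (if k \<in> (\<lambda>n. - int n) ` {..<M} then 1 else 0) * trig k x)"
      by (simp add: D_def cnj_trig)
  qed
  have F_eq: "complex_of_real (F x) = (D x * cnj (D x)) ^ A" for x
    by (simp add: F_def complex_norm_square[symmetric] power_mult)
  have "trig_poly H (\<lambda>x. complex_of_real (F x))"
    unfolding F_eq using trig_poly_power[OF trig_poly_mult[OF tpD tpD'], of A] by (simp add: H_def algebra_simps)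
  then obtain c where c: "\<And>x. complex_of_real (F x) = (\<Sum>k\<in>{-H..H}. c k * trig k x)" unfolding trig_poly_def by blast
  have contD: "continuous_on S D" for S unfolding D_def by (intro continuous_intros)
  have contF: "continuous_on S F" for S unfolding F_def by (intro continuous_intros contD)
  have F_pos: "F x \<ge> 0" for x by (simp add: F_def)
  have F_int: "F integrable_on {0..1}" by (intro integrable_continuous_real contF)
  define C0 where "C0 = integral {0..1} F"
  have coeff: "c k = integral {0..1} (\<lambda>x. of_real (F x) * trig (- k) x)" if k: "k \<in> {-H..H}" for k
  proof -
    have "integral {0..1} (\<lambda>x. of_real (F x) * trig (- k) x) = integral {0..1} (\<lambda>x. \<Sum>m\<in>{-H..H}. c m * trig (m - k) x)"
      unfolding c sum_distrib_right by (simp add: mult.assoc trig_add[symmetric])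
    also have "\<dots> = (\<Sum>m\<in>{-H..H}. integral {0..1} (\<lambda>x. c m * trig (m - k) x))"
      by (intro Henstock_Kurzweil_Integration.integral_sum integrable_continuous_real continuous_intros) auto
    also have "\<dots> = (\<Sum>m\<in>{-H..H}. c m * (if m = k then 1 else 0))"
      by (simp add: integral_trig)
    also have "\<dots> = c k" using k by (simp add: if_distrib[where f = "\<lambda>x. _ * x"] sum.delta cong: if_cong)
    finally show ?thesis ..
  qed
  \<comment> \<open>F is nonnegative, so its mean dominates all its Fourier coefficients.\<close>
  have bound: "norm (c k) \<le> C0" if k: "k \<in> {-H..H}" for k
    unfolding coeff[OF k] C0_def
    by (rule integral_norm_bound_integral) (auto intro!: integrable_continuous_real continuous_intros contF simp: norm_mult F_pos)
  have c0: "c 0 = of_real C0"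
  proof -
    have "c 0 = integral {0..1} (\<lambda>x. complex_of_real (F x))" using coeff[of 0] H0 by simp
    also have "\<dots> = of_real C0" unfolding C0_def
      using integral_linear[OF F_int bounded_linear_of_real] by (simp add: o_def)
    finally show ?thesis .
  qed
  have Mp: "real M ^ (2 * A) > 0" using M by simp
  \<comment> \<open>The mean is bounded below through F 0 = M^(2 A), which is the sum of 2 H + 1 = 4
    A M + 1 coefficients of norm at most \<open>C0\<close>.\<close>
  have C0: "real M ^ (2 * A) \<le> (4 * real A * real M + 1) * C0"
  proof -
    have "D 0 = of_nat M" by (simp add: D_def trig_def)
    then have "complex_of_real (real M ^ (2 * A)) = (\<Sum>k\<in>{-H..H}. c k)"
      using c[of 0] by (simp add: F_def trig_def)
    then have "real M ^ (2 * A) = norm (\<Sum>k\<in>{-H..H}. c k)"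
      using Mp by (metis abs_of_pos norm_of_real)
    also have "\<dots> \<le> (\<Sum>k\<in>{-H..H}. C0)" by (rule sum_norm_le) (use bound in auto)
    also have "\<dots> = (4 * real A * real M + 1) * C0" by (simp add: H_def algebra_simps)
    finally show ?thesis .
  qed
  have C0_pos: "C0 > 0"
  proof (rule ccontr)
    assume "\<not> C0 > 0"
    then have "(4 * real A * real M + 1) * C0 \<le> 0" by (intro mult_nonneg_nonpos) auto
    then show False using C0 Mp by linarith
  qed
  define J where "J = (\<lambda>x. F x / C0)"
  define a where "a = (\<lambda>k. if k \<in> {-H..H} then c k / of_real C0 else 0)"
  show ?thesis
  proof (rule that[of J a])
    show "continuous_on UNIV J" unfolding J_def by (intro continuous_intros contF) (use C0_pos in auto)
    show "J x \<ge> 0" for x unfolding J_def using F_pos C0_pos by simp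
    show "J (x + of_int n) = J x" for x n by (simp add: J_def F_def D_def trig_plus_int)
    show "integral {0..1} J = 1" unfolding J_def using C0_pos by (simp add: C0_def)
    show "complex_of_real (J x) = (\<Sum>k\<in>{-H..H}. a k * trig k x)" for x
      unfolding J_def of_real_divide c sum_divide_distrib by (intro sum.cong) (auto simp: a_def)
    show "norm (a k) \<le> 1" for k using bound[of k] C0_pos by (simp add: a_def norm_divide)
    show "a 0 = 1" using c0 C0_pos H0 by (simp add: a_def)
    fix d x :: real assume d: "0 < d" "d \<le> x" "x \<le> 1 - d"
    have "D x * (trig 1 x - 1) = trig (int M) x - 1"
      unfolding D_def
    proof (induction M)
      case (Suc M)
      have "trig (1 + int M) x = trig 1 x * trig (int M) x" by (rule trig_add)
      then show ?case using Suc by (simp add: algebra_simps)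
    qed simp
    then have "norm (D x) * norm (trig 1 x - 1) = norm (trig (int M) x - 1)" by (metis norm_mult)
    also have "\<dots> \<le> 2" using norm_triangle_ineq4[of "trig (int M) x" 1] by simp
    finally have "norm (D x) * norm (trig 1 x - 1) \<le> 2" .
    moreover have "norm (D x) * d \<le> norm (D x) * norm (trig 1 x - 1)"
      using norm_trig_1_minus_1[of d x] d by (intro mult_left_mono) auto
    ultimately have "norm (D x) \<le> 2 / d" using d by (simp add: field_simps)
    then have "F x \<le> (2 / d) ^ (2 * A)" unfolding F_def by (intro power_mono) auto
    then have "F x * real M ^ (2 * A) \<le> (2 / d) ^ (2 * A) * ((4 * real A * real M + 1) * C0)"
      using C0 F_pos by (intro mult_mono) auto
    also have "\<dots> \<le> (2 / d) ^ (2 * A) * ((5 * real A * real M) * C0)"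
    proof -
      have "1 \<le> real A * real M" using A M by (metis mult_le_mono nat_mult_1 of_nat_1 of_nat_le_iff of_nat_mult)
      then show ?thesis using C0_pos d by (intro mult_left_mono mult_right_mono) auto
    qed
    finally have "F x * real M ^ (2 * A) \<le> (2 / d) ^ (2 * A) * ((5 * real A * real M) * C0)" .
    then show "J x \<le> 5 * real A * real M * (2 / (d * real M)) ^ (2 * A)"
      using C0_pos Mp d by (simp add: J_def power_divide power_mult_distrib field_simps)
  qed
qed

section \<open>Periodic kernels and the smoothed disc\<close>

lemma rectangle_product_integral:
  fixes f g :: "real \<Rightarrow> real"
  assumes f: "continuous_on UNIV f" and g: "continuous_on UNIV g"
  shows "integrable lborel (\<lambda>z. indicator ({a..b} \<times> {c..e}) z *\<^sub>R (f (fst z) * g (snd z)))"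
    and "(LINT z|lborel. indicator ({a..b} \<times> {c..e}) z *\<^sub>R (f (fst z) * g (snd z))) = integral {a..b} f * integral {c..e} g"
proof -
  have cont: "continuous_on S (\<lambda>z::real \<times> real. f (fst z) * g (snd z))" for S
    by (intro continuous_intros continuous_on_compose2[OF f] continuous_on_compose2[OF g]) auto
  show int: "integrable lborel (\<lambda>z. indicator ({a..b} \<times> {c..e}) z *\<^sub>R (f (fst z) * g (snd z)))"
    by (intro borel_integrable_compact cont compact_Times) auto
  have one: "(LINT x|lborel. indicator {a..b} x *\<^sub>R f x) = integral {a..b} f" if "continuous_on UNIV f" for a b and f :: "real \<Rightarrow> real"
    using that by (intro interval_lborel_integral continuous_on_subset[OF that]) auto
  define F where "F = (\<lambda>x y. indicator {a..b} x *\<^sub>R f x * (indicator {c..e} y *\<^sub>R g y))"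
  have eq: "(\<lambda>z. indicator ({a..b} \<times> {c..e}) z *\<^sub>R (f (fst z) * g (snd z))) = case_prod F"
    by (rule ext) (auto simp: F_def indicator_def)
  have intF: "integrable (lborel \<Otimes>\<^sub>M lborel) (case_prod F)" using int unfolding eq lborel_prod .
  have "(LINT z|lborel. case_prod F z) = (LINT z|(lborel \<Otimes>\<^sub>M lborel). case_prod F z)" by (simp only: lborel_prod)
  also have "\<dots> = (LINT x|lborel. LINT y|lborel. F x y)" by (rule lborel_pair.integral_fst[OF intF, symmetric])
  also have "\<dots> = (LINT x|lborel. indicator {a..b} x *\<^sub>R f x * integral {c..e} g)"
    unfolding F_def one[OF g, symmetric] by (intro Bochner_Integration.integral_cong refl integral_mult_right_zero)
  also have "\<dots> = integral {a..b} f * integral {c..e} g"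
    unfolding one[OF f, symmetric] by (rule integral_mult_left_zero)
  finally show "(LINT z|lborel. indicator ({a..b} \<times> {c..e}) z *\<^sub>R (f (fst z) * g (snd z))) = integral {a..b} f * integral {c..e} g"
    unfolding eq .
qed

lemma integral_reflect_shift:
  fixes f :: "real \<Rightarrow> real"
  assumes f: "continuous_on UNIV f"
  shows "integral {a..b} (\<lambda>x. f (v - x)) = integral {v - b..v - a} f"
proof -
  have one: "(LINT x|lborel. indicator {a..b} x *\<^sub>R f x) = integral {a..b} f" if "continuous_on UNIV f" for a b and f :: "real \<Rightarrow> real"
    using that by (intro interval_lborel_integral continuous_on_subset[OF that]) auto
  have "integral {v - b..v - a} f = (LINT x|lborel. indicator {v - b..v - a} (v + (-1) * x) *\<^sub>R f (v + (-1) * x))"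
    unfolding one[OF f, symmetric] by (subst lborel_integral_real_affine[of "-1" _ v]) simp_all
  also have "\<dots> = (LINT x|lborel. indicator {a..b} x *\<^sub>R f (v - x))"
    by (intro Bochner_Integration.integral_cong refl) (auto simp: indicator_def)
  also have "\<dots> = integral {a..b} (\<lambda>x. f (v - x))"
    by (intro one continuous_on_compose2[OF f] continuous_intros) auto
  finally show ?thesis ..
qed

lemma periodic_integral:
  fixes J :: "real \<Rightarrow> real"
  assumes J: "continuous_on UNIV J" and per: "\<And>x n. J (x + of_int n) = J x"
  shows "integral {a..a + 1} J = integral {0..1} J"
proof -
  have shift: "integral {u + of_int n..v + of_int n} J = integral {u..v} J" for u v n
  proof -
    have J': "continuous_on UNIV (\<lambda>x. J (- x))" by (intro continuous_on_compose2[OF J] continuous_intros) auto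
    have "integral {u..v} J = integral {u..v} (\<lambda>x. J (x + of_int n))"
      by (simp only: per)
    also have "(\<lambda>x. J (x + of_int n)) = (\<lambda>x. (\<lambda>x. J (- x)) (- of_int n - x))"
      by (rule ext) (simp add: add.commute)
    also have "integral {u..v} \<dots> = integral {- of_int n - v..- of_int n - u} (\<lambda>x. J (- x))" by (rule integral_reflect_shift[OF J'])
    also have "(\<lambda>x. J (- x)) = (\<lambda>x. J (0 - x))" by simp
    also have "integral {- of_int n - v..- of_int n - u} \<dots> = integral {0 - (- of_int n - u)..0 - (- of_int n - v)} J" by (rule integral_reflect_shift[OF J])
    finally show ?thesis by (simp add: add.commute)
  qed
  define n where "n = \<lfloor>a\<rfloor>"
  have n: "of_int n \<le> a" "a \<le> of_int n + 1" by (auto simp: n_def)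
  have int: "J integrable_on {u..v}" for u v by (intro integrable_continuous_real continuous_on_subset[OF J]) auto
  have "integral {a..a + 1} J = integral {a..of_int n + 1} J + integral {of_int n + 1..a + 1} J"
    using n int by (intro Henstock_Kurzweil_Integration.integral_combine[symmetric]) auto
  also have "integral {of_int n + 1..a + 1} J = integral {of_int n..a} J" using shift[of "of_int n" 1 a] by simp
  also have "integral {a..of_int n + 1} J + integral {of_int n..a} J = integral {of_int n..of_int n + 1} J"
    using n int Henstock_Kurzweil_Integration.integral_combine[of "of_int n" a "of_int n + 1" J] by simp
  also have "\<dots> = integral {0..1} J" using shift[of 0 n 1] by (simp add: add.commute)
  finally show ?thesis .
qed

text \<open>The convolution of the disc with the product kernel. The disc lies in the plane, but for
  periodic \<open>J\<close> this is the smoothed disc on the torus.\<close>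

definition smooth_disc :: "(real \<Rightarrow> real) \<Rightarrow> real \<Rightarrow> real \<times> real \<Rightarrow> real" where
  "smooth_disc J \<rho> v = (LINT z|lborel. indicator (cball 0 \<rho>) z *\<^sub>R (J (fst v - fst z) * J (snd v - snd z)))"

context
  fixes J :: "real \<Rightarrow> real" and d T :: real
  assumes contJ: "continuous_on UNIV J" and J_nonneg: "\<And>x. J x \<ge> 0"
    and J_periodic: "\<And>x n. J (x + of_int n) = J x" and J_int: "integral {0..1} J = 1"
    and d: "0 < d" "d \<le> 1 / 4" and J_tail: "\<And>x. d \<le> x \<Longrightarrow> x \<le> 1 - d \<Longrightarrow> J x \<le> T"
begin

lemma T_nonneg: "T \<ge> 0"
  using J_tail[of "1 / 2"] J_nonneg[of "1 / 2"] d by simp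

lemma continuous_J_shift: "continuous_on S (\<lambda>x. J (v - x))"
  by (intro continuous_on_compose2[OF contJ] continuous_intros) auto

lemma integrable_smooth_disc:
  "integrable lborel (\<lambda>z. indicator (cball 0 \<rho>) z *\<^sub>R (J (fst v - fst z) * J (snd v - snd z)))"
  by (intro disc_integrable continuous_intros continuous_on_compose2[OF contJ]) auto

lemma smooth_disc_nonneg: "smooth_disc J \<rho> v \<ge> 0"
  unfolding smooth_disc_def by (intro Bochner_Integration.integral_nonneg) (auto simp: J_nonneg)

lemma smooth_disc_periodic: "smooth_disc J \<rho> (v + (of_int m, of_int n)) = smooth_disc J \<rho> v"
proof -
  have "J (x + of_int k - y) = J (x - y)" for x y k using J_periodic[of "x - y" k] by (simp add: algebra_simps)
  then show ?thesis by (simp add: smooth_disc_def)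
qed

lemma unit_integral: "integral {-1/2..1/2} (\<lambda>x. J (v - x)) = 1"
  unfolding integral_reflect_shift[OF contJ]
  using periodic_integral[OF contJ J_periodic, of "v - 1/2"] J_int by (simp add: algebra_simps)

lemma disc_subset_square:
  fixes z :: "real \<times> real"
  shows "\<rho> \<le> 1 / 2 \<Longrightarrow> z \<in> cball 0 \<rho> \<Longrightarrow> z \<in> {-1/2..1/2} \<times> {-1/2..(1/2::real)}"
  using norm_fst_le[of "fst z" "snd z"] norm_snd_le[of "snd z" "fst z"] by (cases z) (auto simp: abs_le_iff)

lemma smooth_disc_le_1:
  assumes "\<rho> \<le> 1 / 2"
  shows "smooth_disc J \<rho> v \<le> 1"
proof -
  note rect = rectangle_product_integral[where a = "-1/2" and b = "1/2" and c = "-1/2" and e = "1/2", OF continuous_J_shift[of UNIV "fst v"] continuous_J_shift[of UNIV "snd v"]]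
  have "smooth_disc J \<rho> v \<le> (LINT z|lborel. indicator ({-1/2..1/2} \<times> {-1/2..1/2}) z *\<^sub>R (J (fst v - fst z) * J (snd v - snd z)))"
    unfolding smooth_disc_def
  proof (rule Bochner_Integration.integral_mono[OF integrable_smooth_disc rect(1)])
    fix z :: "real \<times> real"
    show "indicator (cball 0 \<rho>) z *\<^sub>R (J (fst v - fst z) * J (snd v - snd z)) \<le> indicator ({-1/2..1/2} \<times> {-1/2..1/2}) z *\<^sub>R (J (fst v - fst z) * J (snd v - snd z))"
      using disc_subset_square[OF assms, of z] by (auto simp: J_nonneg indicator_def)
  qed
  also have "\<dots> = 1" unfolding rect(2) by (simp only: unit_integral)
  finally show ?thesis .
qed

text \<open>When one of two nonnegative factors is at most T, the product is at most T times their
  sum; and each factor has integral 1 over the unit square around the disc.\<close>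

lemma smooth_disc_far:
  assumes \<rho>: "\<rho> \<le> 1 / 2" and far: "\<And>z. z \<in> cball 0 \<rho> \<Longrightarrow> J (fst v - fst z) \<le> T \<or> J (snd v - snd z) \<le> T"
  shows "smooth_disc J \<rho> v \<le> 2 * T"
proof -
  have one: "continuous_on UNIV (\<lambda>_::real. 1::real)" by simp
  note r1 = rectangle_product_integral[where a = "-1/2" and b = "1/2" and c = "-1/2" and e = "1/2", OF continuous_J_shift[of UNIV "fst v"] one]
  note r2 = rectangle_product_integral[where a = "-1/2" and b = "1/2" and c = "-1/2" and e = "1/2", OF one continuous_J_shift[of UNIV "snd v"]]
  let ?Q = "{-1/2..1/2} \<times> {-1/2..(1/2::real)} :: (real \<times> real) set"
  have "smooth_disc J \<rho> v \<le> (LINT z|lborel. T * (indicator ?Q z *\<^sub>R (J (fst v - fst z) * 1)) + T * (indicator ?Q z *\<^sub>R (1 * J (snd v - snd z))))"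
    unfolding smooth_disc_def
  proof (rule Bochner_Integration.integral_mono[OF integrable_smooth_disc])
    show "integrable lborel (\<lambda>z. T * (indicator ?Q z *\<^sub>R (J (fst v - fst z) * 1)) + T * (indicator ?Q z *\<^sub>R (1 * J (snd v - snd z))))"
      using r1(1) r2(1) by (intro Bochner_Integration.integrable_add integrable_mult_right)
    fix z :: "real \<times> real"
    show "indicator (cball 0 \<rho>) z *\<^sub>R (J (fst v - fst z) * J (snd v - snd z))
        \<le> T * (indicator ?Q z *\<^sub>R (J (fst v - fst z) * 1)) + T * (indicator ?Q z *\<^sub>R (1 * J (snd v - snd z)))"
    proof (cases "z \<in> cball 0 \<rho>")
      case True
      have "J (fst v - fst z) * J (snd v - snd z) \<le> T * J (fst v - fst z) + T * J (snd v - snd z)"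
        using far[OF True]
      proof
        assume "J (fst v - fst z) \<le> T"
        then have "J (fst v - fst z) * J (snd v - snd z) \<le> T * J (snd v - snd z)" using J_nonneg by (intro mult_right_mono)
        then show ?thesis using J_nonneg T_nonneg by (simp add: add_increasing)
      next
        assume "J (snd v - snd z) \<le> T"
        then have "J (fst v - fst z) * J (snd v - snd z) \<le> J (fst v - fst z) * T" using J_nonneg by (intro mult_left_mono)
        then show ?thesis using J_nonneg T_nonneg by (simp add: add_increasing2 mult.commute)
      qed
      then show ?thesis using True disc_subset_square[OF \<rho> True] by simp
    next
      case False
      then show ?thesis using J_nonneg T_nonneg by simp
    qed
  qed
  also have "\<dots> = T * (LINT z|lborel. indicator ?Q z *\<^sub>R (J (fst v - fst z) * 1)) + T * (LINT z|lborel. indicator ?Q z *\<^sub>R (1 * J (snd v - snd z)))"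
    using r1(1) r2(1) by (subst Bochner_Integration.integral_add) (auto intro!: integrable_mult_right)
  also have "\<dots> = 2 * T" unfolding r1(2) r2(2) unit_integral by simp
  finally show ?thesis .
qed

lemma central_mass: "integral {-d..d} J \<ge> 1 - T"
proof -
  have int: "J integrable_on {u..v}" for u v by (intro integrable_continuous_real continuous_on_subset[OF contJ]) auto
  have "integral {-d..d} J + integral {d..1 - d} J = integral {-d..-d + 1} J"
    using d int Henstock_Kurzweil_Integration.integral_combine[of "-d" d "1 - d" J] by simp
  also have "\<dots> = 1" using periodic_integral[OF contJ J_periodic, of "-d"] J_int by simp
  finally have "integral {-d..d} J = 1 - integral {d..1 - d} J" by simp
  moreover have "integral {d..1 - d} J \<le> integral {d..1 - d} (\<lambda>_. T)"
    using J_tail int by (intro integral_le) auto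
  moreover have "integral {d..1 - d} (\<lambda>_. T) \<le> T"
    using d T_nonneg by (simp add: mult_left_le_one_le)
  ultimately show ?thesis by linarith
qed

text \<open>The square of half-side d around v lies within distance 2 d of v, hence in the larger
  disc, and it carries mass at least (1 - T)^2.\<close>

lemma smooth_disc_near:
  assumes v: "norm v < R" and T: "T \<le> 1"
  shows "smooth_disc J (R + 2 * d) v \<ge> 1 - 2 * T"
proof -
  let ?Q = "{fst v - d..fst v + d} \<times> {snd v - d..snd v + d}"
  note rect = rectangle_product_integral[where a = "fst v - d" and b = "fst v + d" and c = "snd v - d" and e = "snd v + d", OF continuous_J_shift[of UNIV "fst v"] continuous_J_shift[of UNIV "snd v"]]
  have sub: "z \<in> cball 0 (R + 2 * d)" if "z \<in> ?Q" for z
  proof -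
    have "\<bar>fst (z - v)\<bar> \<le> d" "\<bar>snd (z - v)\<bar> \<le> d" using that by (auto simp: abs_le_iff)
    then have "norm (z - v) \<le> d + d" using norm_Pair_le[of "fst (z - v)" "snd (z - v)"] unfolding prod.collapse by (simp only: real_norm_def)
    moreover have "norm z \<le> norm v + norm (z - v)" using norm_triangle_ineq[of v "z - v"] by simp
    ultimately show ?thesis using v by simp
  qed
  have "(1 - T) * (1 - T) \<le> integral {-d..d} J * integral {-d..d} J"
    using central_mass T by (intro mult_mono) auto
  moreover have "(1 - T) * (1 - T) = 1 - 2 * T + T * T" by (simp add: algebra_simps)
  ultimately have "1 - 2 * T \<le> integral {-d..d} J * integral {-d..d} J"
    using zero_le_square[of T] by linarith
  also have "\<dots> = (LINT z|lborel. indicator ?Q z *\<^sub>R (J (fst v - fst z) * J (snd v - snd z)))"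
    unfolding rect(2) integral_reflect_shift[OF contJ] by simp
  also have "\<dots> \<le> smooth_disc J (R + 2 * d) v"
    unfolding smooth_disc_def
  proof (rule Bochner_Integration.integral_mono[OF rect(1) integrable_smooth_disc])
    fix z :: "real \<times> real"
    show "indicator ?Q z *\<^sub>R (J (fst v - fst z) * J (snd v - snd z)) \<le> indicator (cball 0 (R + 2 * d)) z *\<^sub>R (J (fst v - fst z) * J (snd v - snd z))"
      using sub[of z] by (auto simp: J_nonneg indicator_def)
  qed
  finally show ?thesis .
qed

lemma J_small_away_from_integers:
  assumes "\<And>n. d \<le> \<bar>x - of_int n\<bar>"
  shows "J x \<le> T"
proof -
  have "d \<le> x - of_int \<lfloor>x\<rfloor>" using assms[of "\<lfloor>x\<rfloor>"] by simp
  moreover have "x - of_int \<lfloor>x\<rfloor> \<le> 1 - d" using assms[of "\<lfloor>x\<rfloor> + 1"] by (simp add: abs_if split: if_splits)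
  ultimately have "J (x - of_int \<lfloor>x\<rfloor>) \<le> T" by (rule J_tail)
  then show ?thesis using J_periodic[of x "- \<lfloor>x\<rfloor>"] by simp
qed

text \<open>The smoothed disc of radius R + 2 d is nearly 1 on the disc of radius R, and that of
  radius R - 2 d is nearly 0 outside it. So the sharp count lies between two smooth ones; the errors
  are the tails 2 T and the areas of two annuli of width 2 d, each at most 10 d. All radii stay
  below 1, as R < 1/2 and d \<le> 1/4.\<close>

lemma count_in_disc:
  fixes P :: "'i \<Rightarrow> real \<times> real" and y :: "real \<times> real"
  assumes I: "finite I" and R: "0 < R" "R < 1 / 2"
    and err: "\<And>\<rho>. 0 < \<rho> \<Longrightarrow> \<rho> \<le> 1 \<Longrightarrow> \<bar>(\<Sum>i\<in>I. smooth_disc J \<rho> (P i - y)) - real (card I) * (pi * \<rho>\<^sup>2)\<bar> \<le> Err"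
  defines "B \<equiv> {i \<in> I. \<exists>m n. dist (P i) (y + (of_int m, of_int n)) < R}"
  shows "\<bar>real (card B) - real (card I) * (pi * R\<^sup>2)\<bar> \<le> real (card I) * (10 * d + 2 * T) + Err"
proof -
  have finB: "finite B" and BI: "B \<subseteq> I" using I by (auto simp: B_def)
  have cBI: "real (card B) \<le> real (card I)" using card_mono[OF I BI] by simp
  have Err0: "Err \<ge> 0" using err[of 1] by linarith
  have pi4: "pi \<le> 10 / 3" using pi_approx(2) by simp
  \<comment> \<open>\<open>smooth_disc_near\<close> needs T \<le> 1; for larger T the claim follows
    from card B \<le> card I.\<close>
  have upper: "real (card B) \<le> real (card I) * (pi * (R + 2 * d)\<^sup>2 + 2 * T) + Err"
  proof (cases "T \<le> 1")
    case True
    have near: "smooth_disc J (R + 2 * d) (P i - y) \<ge> 1 - 2 * T" if "i \<in> B" for i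
    proof -
      obtain m n where mn: "dist (P i) (y + (of_int m, of_int n)) < R" using \<open>i \<in> B\<close> by (auto simp: B_def)
      have "P i - y + (of_int (- m), of_int (- n)) = P i - (y + (of_int m, of_int n))" by (simp add: prod_eq_iff)
      then have "norm (P i - y + (of_int (- m), of_int (- n))) < R" using mn by (simp only: dist_norm)
      from smooth_disc_near[OF this True] show ?thesis unfolding smooth_disc_periodic .
    qed
    have "real (card B) * (1 - 2 * T) = (\<Sum>i\<in>B. 1 - 2 * T)" by simp
    also have "\<dots> \<le> (\<Sum>i\<in>B. smooth_disc J (R + 2 * d) (P i - y))" by (intro sum_mono near)
    also have "\<dots> \<le> (\<Sum>i\<in>I. smooth_disc J (R + 2 * d) (P i - y))"
      using I BI smooth_disc_nonneg by (intro sum_mono2) auto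
    also have "\<dots> \<le> real (card I) * (pi * (R + 2 * d)\<^sup>2) + Err" using err[of "R + 2 * d"] R d by simp
    finally have "real (card B) \<le> real (card I) * (pi * (R + 2 * d)\<^sup>2) + Err + 2 * T * real (card B)"
      by (simp add: algebra_simps)
    moreover have "2 * T * real (card B) \<le> 2 * T * real (card I)" using cBI T_nonneg by (intro mult_left_mono) auto
    ultimately show ?thesis by (simp add: algebra_simps)
  next
    case False
    have "real (card B) \<le> real (card I) * 1" using cBI by simp
    also have "\<dots> \<le> real (card I) * (pi * (R + 2 * d)\<^sup>2 + 2 * T)"
    proof (rule mult_left_mono)
      have "0 \<le> pi * (R + 2 * d)\<^sup>2" by simp
      then show "1 \<le> pi * (R + 2 * d)\<^sup>2 + 2 * T" using False by linarith
    qed simp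
    finally show ?thesis using Err0 by linarith
  qed
  have lower: "real (card I) * (pi * R\<^sup>2) \<le> real (card B) + real (card I) * (10 * d + 2 * T) + Err"
  proof (cases "R \<le> 2 * d")
    \<comment> \<open>There is no smaller disc, but then the area pi R^2 is itself at most 10
      d.\<close>
    case True
    have "R\<^sup>2 \<le> R * (1 / 2)" unfolding power2_eq_square using R by (intro mult_left_mono) auto
    then have "R\<^sup>2 \<le> d" using True by linarith
    then have "pi * R\<^sup>2 \<le> 10 / 3 * d" using pi4 by (intro mult_mono) auto
    then have "pi * R\<^sup>2 \<le> 10 * d + 2 * T" using d T_nonneg by linarith
    then have "real (card I) * (pi * R\<^sup>2) \<le> real (card I) * (10 * d + 2 * T)" by (intro mult_left_mono) auto
    then show ?thesis using Err0 by simp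
  next
    case False
    define \<rho> where "\<rho> = R - 2 * d"
    have \<rho>: "0 < \<rho>" "\<rho> \<le> 1 / 2" "\<rho> \<le> 1" using False R d by (auto simp: \<rho>_def)
    \<comment> \<open>For a point outside \<open>B\<close> and z in the smaller disc, one coordinate
      of P i - y - z stays at least d away from the integers; otherwise P i would be within \<rho> +
      2 d = R of a translate of y.\<close>
    have far: "smooth_disc J \<rho> (P i - y) \<le> 2 * T" if i: "i \<in> I - B" for i
    proof (rule smooth_disc_far[OF \<rho>(2)], rule ccontr)
      fix z assume z: "z \<in> cball 0 \<rho>" and "\<not> (J (fst (P i - y) - fst z) \<le> T \<or> J (snd (P i - y) - snd z) \<le> T)"
      then obtain m n where mn: "\<bar>fst (P i - y - z) - of_int m\<bar> < d" "\<bar>snd (P i - y - z) - of_int n\<bar> < d"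
        using J_small_away_from_integers by (metis fst_diff snd_diff not_le)
      have "norm (P i - y - z - (of_int m, of_int n)) \<le> \<bar>fst (P i - y - z) - of_int m\<bar> + \<bar>snd (P i - y - z) - of_int n\<bar>"
        using norm_Pair_le[of "fst (P i - y - z) - of_int m" "snd (P i - y - z) - of_int n"] by (simp add: minus_prod_def)
      also have "\<dots> < 2 * d" using mn by simp
      finally have "norm (z + (P i - y - z - (of_int m, of_int n))) < \<rho> + 2 * d"
        using norm_triangle_ineq[of z "P i - y - z - (of_int m, of_int n)"] z by simp
      moreover have "z + (P i - y - z - (of_int m, of_int n)) = P i - (y + (of_int m, of_int n))" by (simp add: algebra_simps)
      ultimately have "dist (P i) (y + (of_int m, of_int n)) < R" by (simp add: dist_norm \<rho>_def)
      then have "i \<in> B" using i unfolding B_def by blast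
      then show False using i by simp
    qed
    have "real (card I) * (pi * \<rho>\<^sup>2) \<le> (\<Sum>i\<in>I. smooth_disc J \<rho> (P i - y)) + Err" using err[OF \<rho>(1,3)] by linarith
    also have "(\<Sum>i\<in>I. smooth_disc J \<rho> (P i - y)) = (\<Sum>i\<in>B. smooth_disc J \<rho> (P i - y)) + (\<Sum>i\<in>I - B. smooth_disc J \<rho> (P i - y))"
      using sum.subset_diff[OF BI I] by (simp add: add.commute)
    also have "\<dots> \<le> (\<Sum>i\<in>B. 1) + (\<Sum>i\<in>I - B. 2 * T)"
      by (intro add_mono sum_mono far smooth_disc_le_1 \<rho>(2))
    also have "\<dots> \<le> real (card B) + real (card I) * (2 * T)"
      using card_mono[of I "I - B"] I T_nonneg by (simp add: mult_right_mono)
    finally have 1: "real (card I) * (pi * \<rho>\<^sup>2) \<le> real (card B) + real (card I) * (2 * T) + Err" by simp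
    have "R\<^sup>2 - \<rho>\<^sup>2 \<le> 2 * d"
    proof -
      have "R\<^sup>2 - \<rho>\<^sup>2 = (4 * R - 4 * d) * d" by (simp add: \<rho>_def power2_eq_square algebra_simps)
      also have "\<dots> \<le> 2 * d" using R d by (intro mult_right_mono) auto
      finally show ?thesis .
    qed
    then have "pi * (R\<^sup>2 - \<rho>\<^sup>2) \<le> pi * (2 * d)" by (intro mult_left_mono) auto
    also have "\<dots> \<le> 10 / 3 * (2 * d)" using pi4 d by (intro mult_right_mono) auto
    also have "\<dots> \<le> 10 * d" using d by simp
    finally have "real (card I) * (pi * (R\<^sup>2 - \<rho>\<^sup>2)) \<le> real (card I) * (10 * d)" by (intro mult_left_mono) auto
    with 1 show ?thesis by (simp add: algebra_simps)
  qed
  have "(R + 2 * d)\<^sup>2 - R\<^sup>2 \<le> 3 * d"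
  proof -
    have "(R + 2 * d)\<^sup>2 - R\<^sup>2 = (4 * R + 4 * d) * d" by (simp add: power2_eq_square algebra_simps)
    also have "\<dots> \<le> 3 * d" using R d by (intro mult_right_mono) auto
    finally show ?thesis .
  qed
  then have "pi * ((R + 2 * d)\<^sup>2 - R\<^sup>2) \<le> pi * (3 * d)" by (intro mult_left_mono) auto
  also have "\<dots> \<le> 10 / 3 * (3 * d)" using pi4 d by (intro mult_right_mono) auto
  finally have "real (card I) * (pi * ((R + 2 * d)\<^sup>2 - R\<^sup>2)) \<le> real (card I) * (10 * d)" by (intro mult_left_mono) auto
  with upper lower show ?thesis by (simp add: algebra_simps abs_le_iff)
qed

end

section \<open>Fourier expansion of the smoothed disc\<close>

lemma smooth_disc_expansion:
  fixes J :: "real \<Rightarrow> real" and a :: "int \<Rightarrow> complex"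
  assumes J: "\<And>x. complex_of_real (J x) = (\<Sum>k\<in>{-H..H}. a k * trig k x)"
  shows "complex_of_real (smooth_disc J \<rho> v) =
    (\<Sum>k\<in>{-H..H}. \<Sum>l\<in>{-H..H}. a k * a l * (trig k (fst v) * trig l (snd v)) * disc_coeff \<rho> (of_int k) (of_int l))"
proof -
  define E where "E = (\<lambda>k l (z :: real \<times> real). cis (- (2 * pi * (real_of_int k * fst z + real_of_int l * snd z))))"
  have intE: "integrable lborel (\<lambda>z. indicator (cball 0 \<rho>) z *\<^sub>R E k l z)" for k l
    unfolding E_def by (intro disc_integrable continuous_intros continuous_on_cis)
  have "complex_of_real (indicator (cball 0 \<rho>) z *\<^sub>R (J (fst v - fst z) * J (snd v - snd z))) =
      (\<Sum>k\<in>{-H..H}. \<Sum>l\<in>{-H..H}. (a k * a l * (trig k (fst v) * trig l (snd v))) * (indicator (cball 0 \<rho>) z *\<^sub>R E k l z))" for z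
  proof -
    have E: "trig k (fst v - fst z) * trig l (snd v - snd z) = trig k (fst v) * trig l (snd v) * E k l z" for k l
      by (simp add: trig_def E_def cis_mult algebra_simps)
    have "complex_of_real (J (fst v - fst z) * J (snd v - snd z)) =
      (\<Sum>k\<in>{-H..H}. \<Sum>l\<in>{-H..H}. a k * a l * (trig k (fst v - fst z) * trig l (snd v - snd z)))"
      by (simp add: J sum_product mult_ac)
    also have "\<dots> = (\<Sum>k\<in>{-H..H}. \<Sum>l\<in>{-H..H}. a k * a l * (trig k (fst v) * trig l (snd v)) * E k l z)"
      unfolding E by (simp add: mult_ac)
    finally show ?thesis by (simp add: indicator_def)
  qed
  then have "complex_of_real (smooth_disc J \<rho> v) = (LINT z|lborel. (\<Sum>k\<in>{-H..H}. \<Sum>l\<in>{-H..H}. (a k * a l * (trig k (fst v) * trig l (snd v))) * (indicator (cball 0 \<rho>) z *\<^sub>R E k l z)))"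
    unfolding smooth_disc_def integral_complex_of_real[symmetric] by (intro Bochner_Integration.integral_cong refl)
  also have "\<dots> = (\<Sum>k\<in>{-H..H}. \<Sum>l\<in>{-H..H}. (a k * a l * (trig k (fst v) * trig l (snd v))) * (LINT z|lborel. indicator (cball 0 \<rho>) z *\<^sub>R E k l z))"
  proof -
    define g where "g = (\<lambda>k l z. indicator (cball 0 \<rho>) z *\<^sub>R E k l z)"
    have g: "integrable lborel (g k l)" for k l using intE by (simp add: g_def)
    have "(LINT z|lborel. (\<Sum>k\<in>{-H..H}. \<Sum>l\<in>{-H..H}. (a k * a l * (trig k (fst v) * trig l (snd v))) * g k l z)) =
      (\<Sum>k\<in>{-H..H}. \<Sum>l\<in>{-H..H}. (a k * a l * (trig k (fst v) * trig l (snd v))) * (LINT z|lborel. g k l z))"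
      by (simp add: Bochner_Integration.integral_sum g Bochner_Integration.integrable_sum)
    then show ?thesis unfolding g_def .
  qed
  finally show ?thesis by (simp add: disc_coeff_def E_def)
qed

lemma disc_coeff_0:
  assumes "\<rho> \<ge> 0"
  shows "disc_coeff \<rho> 0 0 = of_real (pi * \<rho>\<^sup>2)"
proof -
  have "disc_coeff \<rho> 0 0 = (LINT z|(lborel :: (real \<times> real) measure). complex_of_real (indicator (cball 0 \<rho>) z))"
    unfolding disc_coeff_def by (intro Bochner_Integration.integral_cong refl) (simp add: indicator_def)
  also have "\<dots> = of_real (measure lborel (cball (0 :: real \<times> real) \<rho>))"
    by (simp only: integral_complex_of_real) (simp add: measure_def)
  also have "measure lborel (cball (0 :: real \<times> real) \<rho>) = pi * \<rho>\<^sup>2"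
    using content_cball[OF assms, of "0 :: real \<times> real"] by (simp add: unit_ball_vol_2 power2_eq_square)
  finally show ?thesis .
qed

text \<open>The frequency (0, 0) gives the main term exactly, because a 0 = 1. The centre y only
  rotates the other terms, so the bound is uniform in y.\<close>

lemma smooth_disc_sum_error:
  fixes J :: "real \<Rightarrow> real" and a :: "int \<Rightarrow> complex" and P :: "'i \<Rightarrow> real \<times> real"
  assumes J: "\<And>x. complex_of_real (J x) = (\<Sum>k\<in>{-H..H}. a k * trig k x)"
    and a: "\<And>k. norm (a k) \<le> 1" "a 0 = 1" and H: "H \<ge> 0" and \<rho>: "0 < \<rho>" "\<rho> \<le> 1"
  shows "\<bar>(\<Sum>i\<in>I. smooth_disc J \<rho> (P i - y)) - real (card I) * (pi * \<rho>\<^sup>2)\<bar> \<le>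
    (\<Sum>(k, l)\<in>{-H..H} \<times> {-H..H} - {(0, 0)}. 2 * of_int (max \<bar>k\<bar> \<bar>l\<bar>) powr (- (3 / 2)) *
       norm (\<Sum>i\<in>I. trig k (fst (P i)) * trig l (snd (P i))))"
proof -
  define W where "W = (\<lambda>k l. \<Sum>i\<in>I. trig k (fst (P i)) * trig l (snd (P i)))"
  define c where "c = (\<lambda>(k, l). a k * a l * (trig k (- fst y) * trig l (- snd y)) * disc_coeff \<rho> (of_int k) (of_int l) * W k l)"
  have "complex_of_real (\<Sum>i\<in>I. smooth_disc J \<rho> (P i - y)) = (\<Sum>i\<in>I. \<Sum>z\<in>{-H..H} \<times> {-H..H}. (case z of (k, l) \<Rightarrow>
      a k * a l * (trig k (- fst y) * trig l (- snd y)) * disc_coeff \<rho> (of_int k) (of_int l) * (trig k (fst (P i)) * trig l (snd (P i)))))"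
    unfolding of_real_sum smooth_disc_expansion[OF J] sum.cartesian_product
  proof (intro sum.cong refl, clarify)
    fix i k l
    have "trig k (fst (P i - y)) = trig k (fst (P i)) * trig k (- fst y)" "trig l (snd (P i - y)) = trig l (snd (P i)) * trig l (- snd y)"
      by (simp_all add: trig_def cis_mult algebra_simps)
    then show "a k * a l * (trig k (fst (P i - y)) * trig l (snd (P i - y))) * disc_coeff \<rho> (of_int k) (of_int l) =
      a k * a l * (trig k (- fst y) * trig l (- snd y)) * disc_coeff \<rho> (of_int k) (of_int l) * (trig k (fst (P i)) * trig l (snd (P i)))"
      by (simp only: mult_ac)
  qed
  also have "\<dots> = (\<Sum>z\<in>{-H..H} \<times> {-H..H}. c z)"
    unfolding c_def W_def by (subst sum.swap) (simp add: case_prod_unfold sum_distrib_left)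
  also have "\<dots> = c (0, 0) + (\<Sum>z\<in>{-H..H} \<times> {-H..H} - {(0, 0)}. c z)"
    using H by (intro sum.remove) auto
  also have "c (0, 0) = of_real (real (card I) * (pi * \<rho>\<^sup>2))"
    using \<rho> by (simp add: c_def a W_def disc_coeff_0)
  finally have "complex_of_real ((\<Sum>i\<in>I. smooth_disc J \<rho> (P i - y)) - real (card I) * (pi * \<rho>\<^sup>2)) = (\<Sum>z\<in>{-H..H} \<times> {-H..H} - {(0, 0)}. c z)"
    by (simp add: algebra_simps)
  then have "\<bar>(\<Sum>i\<in>I. smooth_disc J \<rho> (P i - y)) - real (card I) * (pi * \<rho>\<^sup>2)\<bar> = norm (\<Sum>z\<in>{-H..H} \<times> {-H..H} - {(0, 0)}. c z)"
    by (metis norm_of_real)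
  also have "\<dots> \<le> (\<Sum>(k, l)\<in>{-H..H} \<times> {-H..H} - {(0, 0)}. 2 * of_int (max \<bar>k\<bar> \<bar>l\<bar>) powr (- (3 / 2)) * norm (W k l))"
  proof (rule sum_norm_le)
    fix z assume z: "z \<in> {-H..H} \<times> {-H..H} - {(0, 0)}"
    obtain k l where kl: "z = (k, l)" by (cases z)
    have "norm (c z) = norm (a k) * norm (a l) * norm (disc_coeff \<rho> (of_int k) (of_int l)) * norm (W k l)"
      by (simp add: c_def kl norm_mult)
    also have "\<dots> \<le> 1 * 1 * (2 * of_int (max \<bar>k\<bar> \<bar>l\<bar>) powr (- (3 / 2))) * norm (W k l)"
      using a disc_coeff_bound[OF \<rho>, of k l] z kl by (intro mult_right_mono mult_mono) auto
    finally show "norm (c z) \<le> (case z of (k, l) \<Rightarrow> 2 * of_int (max \<bar>k\<bar> \<bar>l\<bar>) powr (- (3 / 2)) * norm (W k l))"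
      by (simp add: kl)
  qed
  finally show ?thesis by (simp add: W_def)
qed

section \<open>The discrepancy\<close>

lemma inverse_power_three_halves:
  assumes "n \<ge> 1"
  shows "1 / ((real n + 1) * sqrt (real n + 1)) \<le> 2 / sqrt (real n) - 2 / sqrt (real n + 1)"
    and "1 / sqrt (real n + 1) \<le> 2 * (sqrt (real n + 1) - sqrt (real n))"
proof -
  define a b where "a = sqrt (real n)" and "b = sqrt (real n + 1)"
  have a: "0 < a" "a \<le> b" "b * b - a * a = 1" "real n + 1 = b * b" using assms by (auto simp: a_def b_def)
  have b: "b > 0" using a by linarith
  have eq: "b - a = 1 / (a + b)" using a b by (simp add: field_simps)
  have "2 / a - 2 / b = 2 * (b - a) / (a * b)" using a b by (simp add: field_simps)
  also have "\<dots> = 2 / ((a + b) * (a * b))" unfolding eq by simp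
  also have "\<dots> \<ge> 2 / ((b + b) * (b * b))" using a b by (intro divide_left_mono mult_mono mult_pos_pos) auto
  finally show "1 / ((real n + 1) * sqrt (real n + 1)) \<le> 2 / sqrt (real n) - 2 / sqrt (real n + 1)"
    unfolding a_def[symmetric] b_def[symmetric] using a(4) by (simp add: mult.assoc)
  have "1 / b = 2 / (b + b)" by simp
  also have "\<dots> \<le> 2 / (a + b)" using a b by (intro divide_left_mono) auto
  also have "\<dots> = 2 * (b - a)" unfolding eq by simp
  finally show "1 / sqrt (real n + 1) \<le> 2 * (sqrt (real n + 1) - sqrt (real n))" by (simp only: a_def b_def)
qed

text \<open>Comparison with the integral of x^(-3/2) in telescoping form, started with equality at n
  = 1.\<close>

lemma sum_inverse_three_halves:
  assumes "n \<ge> 1"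
  shows "(\<Sum>d = 1..n. 1 / (real d * sqrt (real d))) \<le> 3 - 2 / sqrt (real n)"
  using assms
proof (induction n rule: dec_induct)
  case base
  then show ?case by simp
next
  case (step n)
  then show ?case using inverse_power_three_halves(1)[of n] by (simp add: add.commute)
qed

abbreviation freq_box :: "nat \<Rightarrow> (int \<times> int) set" where
  "freq_box n \<equiv> {- int n..int n} \<times> {- int n..int n}"

lemma powr_minus_three_halves:
  fixes x :: real
  assumes x: "x > 0"
  shows "x powr (- (3 / 2)) = 1 / (x * sqrt x)"
proof -
  have "x powr (- (3 / 2)) = 1 / x powr (1 + 1 / 2)" by (simp add: powr_minus_divide)
  also have "x powr (1 + 1 / 2) = x * sqrt x" using x by (simp only: powr_add powr_one powr_half_sqrt)
  finally show ?thesis .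
qed

text \<open>The shell max(|k|, |l|) = j has 8 j points of weight j^(-3/2), and the sum of the
  j^(-1/2) up to n is at most 2 sqrt n.\<close>

lemma freq_box_sum:
  "(\<Sum>(k, l)\<in>freq_box n - {(0, 0)}. of_int (max \<bar>k\<bar> \<bar>l\<bar>) powr (- (3 / 2))) \<le> 16 * sqrt (real n)"
proof (induction n)
  case 0
  then show ?case by simp
next
  case (Suc n)
  let ?w = "\<lambda>(k, l). of_int (max \<bar>k\<bar> \<bar>l\<bar>) powr (- (3 / 2)) :: real"
  have sub: "freq_box n \<subseteq> freq_box (Suc n)" by auto
  have split: "freq_box (Suc n) - {(0, 0)} = (freq_box n - {(0, 0)}) \<union> (freq_box (Suc n) - freq_box n)"
    using sub by auto
  have "sum ?w (freq_box (Suc n) - {(0, 0)}) = sum ?w (freq_box n - {(0, 0)}) + sum ?w (freq_box (Suc n) - freq_box n)"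
    unfolding split by (rule sum.union_disjoint) auto
  moreover have "sum ?w (freq_box (Suc n) - freq_box n) = (\<Sum>z\<in>freq_box (Suc n) - freq_box n. (real n + 1) powr (- (3 / 2)))"
  proof (rule sum.cong[OF refl])
    fix z assume z: "z \<in> freq_box (Suc n) - freq_box n"
    obtain k l where kl: "z = (k, l)" by (cases z)
    have "max \<bar>k\<bar> \<bar>l\<bar> = int n + 1" using z kl by auto
    then show "?w z = (real n + 1) powr (- (3 / 2))" by (simp add: kl)
  qed
  moreover have "real (card (freq_box (Suc n) - freq_box n)) = 8 * (real n + 1)"
  proof -
    have c: "card (freq_box m) = (2 * m + 1) * (2 * m + 1)" for m
    proof -
      have "nat (int m + 1 + int m) = 2 * m + 1" by simp
      then show ?thesis by (simp add: card_cartesian_product)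
    qed
    have "card (freq_box (Suc n) - freq_box n) = card (freq_box (Suc n)) - card (freq_box n)"
      by (rule card_Diff_subset[OF _ sub]) simp
    also have "\<dots> = 8 * (n + 1)" unfolding c by (simp add: algebra_simps)
    finally show ?thesis by simp
  qed
  ultimately have "sum ?w (freq_box (Suc n) - {(0, 0)}) = sum ?w (freq_box n - {(0, 0)}) + 8 * (real n + 1) * (real n + 1) powr (- (3 / 2))"
    by simp
  also have "8 * (real n + 1) * (real n + 1) powr (- (3 / 2)) = 8 * (1 / sqrt (real n + 1))"
  proof -
    have "8 * x * x powr (- (3 / 2)) = 8 * (1 / sqrt x)" if "x > 0" for x :: real
      using that by (simp add: powr_minus_three_halves)
    from this[of "real n + 1"] show ?thesis by linarith
  qed
  also have "\<dots> \<le> 16 * (sqrt (real n + 1) - sqrt (real n))"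
    using inverse_power_three_halves(2)[of n] by (cases "n = 0") simp_all
  finally show ?case using Suc.IH by (simp add: add.commute)
qed

text \<open>With d = gcd(k, l) and (k, l) = d (k', l') the summand is 1 / d times the weight of (k',
  l'). Dropping coprimality, the box of size n / d contributes at most 16 sqrt(n / d), and the sum
  of the d^(-3/2) is at most 3. So the gcd costs only a constant factor.\<close>

lemma freq_box_gcd_sum:
  assumes n: "n \<ge> 1"
  shows "(\<Sum>(k, l)\<in>freq_box n - {(0, 0)}. of_int (max \<bar>k\<bar> \<bar>l\<bar>) powr (- (3 / 2)) * sqrt (of_int (gcd k l))) \<le> 48 * sqrt (real n)"
proof -
  let ?w = "\<lambda>(k, l). of_int (max \<bar>k\<bar> \<bar>l\<bar>) powr (- (3 / 2)) :: real"
  let ?t = "SIGMA d:{1..n}. freq_box (n div d) - {(0, 0)}"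
  let ?g = "\<lambda>(d, z). 1 / real d * ?w z"
  have "(\<Sum>(k, l)\<in>freq_box n - {(0, 0)}. of_int (max \<bar>k\<bar> \<bar>l\<bar>) powr (- (3 / 2)) * sqrt (of_int (gcd k l))) \<le> sum ?g ?t"
  proof (rule sum_le_included[where i = "\<lambda>(d, (k, l)). (int d * k, int d * l)"])
    show "\<forall>y\<in>?t. 0 \<le> ?g y" by auto
    show "\<forall>x\<in>freq_box n - {(0, 0)}. \<exists>y\<in>?t. (case y of (d, (k, l)) \<Rightarrow> (int d * k, int d * l)) = x \<and>
        (case x of (k, l) \<Rightarrow> of_int (max \<bar>k\<bar> \<bar>l\<bar>) powr (- (3 / 2)) * sqrt (of_int (gcd k l))) \<le> ?g y"
    proof
      fix x assume x: "x \<in> freq_box n - {(0, 0)}"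
      obtain k l where kl: "x = (k, l)" by (cases x)
      define d where "d = nat (gcd k l)"
      have d: "int d = gcd k l" by (simp add: d_def)
      have nz: "k \<noteq> 0 \<or> l \<noteq> 0" using x kl by auto
      then have dpos: "d > 0" using d by (metis gcd_eq_0_iff gr0I of_nat_0)
      obtain k' l' where k': "k = int d * k'" "l = int d * l'"
        using d by (metis dvd_def gcd_dvd1 gcd_dvd2)
      have nz': "(k', l') \<noteq> (0, 0)" using nz k' by auto
      have bnd: "\<bar>u\<bar> \<le> int (n div d)" if "\<bar>int d * u\<bar> \<le> int n" for u
      proof -
        have "int (nat \<bar>u\<bar> * d) \<le> int n" using that by (simp add: abs_mult mult.commute)
        then have "nat \<bar>u\<bar> \<le> n div d" unfolding of_nat_le_iff using dpos by (simp only: less_eq_div_iff_mult_less_eq)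
        then show ?thesis by linarith
      qed
      have k'l': "\<bar>k'\<bar> \<le> int (n div d)" "\<bar>l'\<bar> \<le> int (n div d)"
        using x by (auto intro!: bnd simp: kl k'[symmetric])
      have "d \<le> n"
      proof (rule ccontr)
        assume "\<not> d \<le> n"
        then have "n div d = 0" by simp
        then show False using k'l' nz' by simp
      qed
      let ?m = "of_int (max \<bar>k'\<bar> \<bar>l'\<bar>) :: real"
      have m: "?m > 0" using nz' by (auto simp: max_def)
      have max_eq: "real_of_int (max \<bar>k\<bar> \<bar>l\<bar>) = real d * ?m"
        by (simp add: k' abs_mult of_int_max max_mult_distrib_left)
      have "of_int (max \<bar>k\<bar> \<bar>l\<bar>) powr (- (3 / 2)) * sqrt (of_int (gcd k l)) = 1 / (real d * ?m * sqrt (real d * ?m)) * sqrt (real d)"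
        unfolding max_eq d[symmetric] using m dpos by (subst powr_minus_three_halves) auto
      also have "\<dots> = 1 / real d * (1 / (?m * sqrt ?m))"
        using m dpos by (simp add: real_sqrt_mult field_simps)
      also have "\<dots> = 1 / real d * ?m powr (- (3 / 2))"
        using m by (simp only: powr_minus_three_halves)
      finally have "of_int (max \<bar>k\<bar> \<bar>l\<bar>) powr (- (3 / 2)) * sqrt (of_int (gcd k l)) \<le> 1 / real d * ?m powr (- (3 / 2))" by (rule eq_refl)
      moreover have "(d, (k', l')) \<in> ?t" using dpos \<open>d \<le> n\<close> k'l' nz' by (auto simp: abs_le_iff)
      ultimately show "\<exists>y\<in>?t. (case y of (d, (k, l)) \<Rightarrow> (int d * k, int d * l)) = x \<and>
        (case x of (k, l) \<Rightarrow> of_int (max \<bar>k\<bar> \<bar>l\<bar>) powr (- (3 / 2)) * sqrt (of_int (gcd k l))) \<le> ?g y"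
        unfolding kl by (intro bexI[of _ "(d, (k', l'))"] conjI) (simp_all add: k')
    qed
  qed auto
  also have "sum ?g ?t = (\<Sum>d = 1..n. 1 / real d * sum ?w (freq_box (n div d) - {(0, 0)}))"
    by (subst sum.Sigma[symmetric]) (auto simp: sum_distrib_left)
  also have "\<dots> \<le> (\<Sum>d = 1..n. 16 * sqrt (real n) * (1 / (real d * sqrt (real d))))"
  proof (rule sum_mono)
    fix d assume d: "d \<in> {1..n}"
    have "sum ?w (freq_box (n div d) - {(0, 0)}) \<le> 16 * sqrt (real (n div d))" by (rule freq_box_sum)
    also have "\<dots> \<le> 16 * sqrt (real n / real d)"
      by (intro mult_left_mono real_sqrt_le_mono) (simp_all add: of_nat_div_le_of_nat)
    finally have "1 / real d * sum ?w (freq_box (n div d) - {(0, 0)}) \<le> 1 / real d * (16 * sqrt (real n / real d))"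
      by (intro mult_left_mono) auto
    then show "1 / real d * sum ?w (freq_box (n div d) - {(0, 0)}) \<le> 16 * sqrt (real n) * (1 / (real d * sqrt (real d)))"
      by (simp add: real_sqrt_divide)
  qed
  also have "\<dots> = 16 * sqrt (real n) * (\<Sum>d = 1..n. 1 / (real d * sqrt (real d)))"
    by (rule sum_distrib_left[symmetric])
  also have "\<dots> \<le> 16 * sqrt (real n) * 3"
  proof (rule mult_left_mono)
    have "2 / sqrt (real n) \<ge> 0" by simp
    then show "(\<Sum>d = 1..n. 1 / (real d * sqrt (real d))) \<le> 3" using sum_inverse_three_halves[OF n] by linarith
  qed simp
  finally show ?thesis by simp
qed

section \<open>Exponential sums over the points, and balls on the torus\<close>

definition inverse_coords :: "nat \<Rightarrow> nat \<Rightarrow> real \<times> real" where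
  "inverse_coords q d = (real d / real q, of_int (modular_inverse (int q) (int d)) / real q)"

lemma kloosterman_inverse_coords:
  assumes q: "q > 0"
  shows "(\<Sum>d\<in>totatives q. trig k (fst (inverse_coords q d)) * trig l (snd (inverse_coords q d))) = kloosterman (int q) k l"
  unfolding kloosterman_def
\<comment> \<open>Totatives lie in 1..q and residues in 0..q-1. They differ only for q = 1, where
  the residue 0 stands for the totative 1.\<close>
proof (rule sum.reindex_bij_witness[where
      i = "\<lambda>(u, v). nat (if u = 0 then int q else u)" and
      j = "\<lambda>d. (int d mod int q, modular_inverse (int q) (int d) mod int q)"])
  fix d assume d: "d \<in> totatives q"
  then have d': "0 < d" "d \<le> q" "coprime (int d) (int q)" by (auto simp: totatives_def)
  note inv = cong_modular_inverse1[OF d'(3)]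
  have "(if int d mod int q = 0 then int q else int d mod int q) = int d"
    using d' by (cases "d = q") auto
  then show "(case (int d mod int q, modular_inverse (int q) (int d) mod int q) of (u, v) \<Rightarrow> nat (if u = 0 then int q else u)) = d"
    by simp
  show "(int d mod int q, modular_inverse (int q) (int d) mod int q) \<in> unit_pairs (int q)"
    using q inv by (intro unit_pairs_cong) auto
  have "ee (k * (int d mod int q) + l * (modular_inverse (int q) (int d) mod int q)) (int q) = ee (k * int d + l * modular_inverse (int q) (int d)) (int q)"
    by (intro ee_cong cong_add cong_mult cong_refl) (auto simp: Cong.cong_def)
  also have "\<dots> = trig k (fst (inverse_coords q d)) * trig l (snd (inverse_coords q d))"
    by (simp add: ee_def trig_def inverse_coords_def cis_mult add_divide_distrib distrib_left)
  finally show "(case (int d mod int q, modular_inverse (int q) (int d) mod int q) of (u, v) \<Rightarrow> ee (k * u + l * v) (int q)) =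
      trig k (fst (inverse_coords q d)) * trig l (snd (inverse_coords q d))" by simp
next
  fix z assume z: "z \<in> unit_pairs (int q)"
  obtain u v where uv: "z = (u, v)" by (cases z)
  define d where "d = nat (if u = 0 then int q else u)"
  have u: "0 \<le> u" "u < int q" using z by (auto simp: uv unit_pairs_def)
  have cop: "coprime u (int q)" using z unfolding uv by (rule unit_pairs_coprime)
  have d: "int d mod int q = u" using u by (auto simp: d_def)
  have cop': "coprime (int d) (int q)"
    using cop q unfolding d[symmetric] by (subst (asm) coprime_mod_left_iff) auto
  have "d > 0" "d \<le> q" using u q by (auto simp: d_def)
  then have tot: "d \<in> totatives q" using cop' by (simp add: totatives_def)
  have "(int d mod int q, modular_inverse (int q) (int d) mod int q) \<in> unit_pairs (int q)"
    using q cong_modular_inverse1[OF cop'] by (intro unit_pairs_cong) auto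
  then have "modular_inverse (int q) (int d) mod int q = v"
    unfolding d using z unfolding uv by (rule unit_pairs_unique(1))
  then show "(int (case z of (u, v) \<Rightarrow> nat (if u = 0 then int q else u)) mod int q,
      modular_inverse (int q) (int (case z of (u, v) \<Rightarrow> nat (if u = 0 then int q else u))) mod int q) = z"
    unfolding uv prod.case d_def[symmetric] using d by simp
  show "(case z of (u, v) \<Rightarrow> nat (if u = 0 then int q else u)) \<in> totatives q"
    unfolding uv prod.case d_def[symmetric] by (rule tot)
qed

text \<open>Enlarging gcd(k, l, q) to gcd(k, l) makes the sum over the frequencies independent of q,
  in the form bounded by \<open>freq_box_gcd_sum\<close>.\<close>

lemma kloosterman_gcd_bound:
  assumes q: "q > 0" and nz: "(k, l) \<noteq> (0, 0)"
  shows "norm (kloosterman (int q) k l) \<le> 6 ^ card (prime_factors q) * sqrt (real q) * sqrt (of_int (gcd k l))"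
proof -
  have "gcd (gcd k l) (int q) \<le> gcd k l" using nz by (intro zdvd_imp_le gcd_dvd1) (auto simp: gcd_pos_int)
  then have "sqrt (real q * of_int (gcd (gcd k l) (int q))) \<le> sqrt (real q * of_int (gcd k l))"
    by (intro real_sqrt_le_mono mult_left_mono) (auto simp del: gcd_int_int_eq)
  then have "6 ^ card (prime_factors q) * sqrt (real q * of_int (gcd (gcd k l) (int q))) \<le> 6 ^ card (prime_factors q) * sqrt (real q * of_int (gcd k l))"
    by (intro mult_left_mono) auto
  with kloosterman_bound[OF q, of k l]
  have "norm (kloosterman (int q) k l) \<le> 6 ^ card (prime_factors q) * sqrt (real q * of_int (gcd k l))" by linarith
  then show ?thesis by (simp add: real_sqrt_mult mult.assoc)
qed

lemma torus_of_surj: "\<exists>p. torus_of p = y"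
proof -
  have "\<exists>x. circle_of x = c" for c by (metis Quotient_abs_rep Quotient_circle)
  then obtain a b where "circle_of a = fst y" "circle_of b = snd y" by meson
  then have "torus_of (a, b) = y" by (simp add: torus_of_def)
  then show ?thesis ..
qed

lemma torus_of_in_ball:
  "torus_of p \<in> ball (torus_of y) R \<longleftrightarrow> (\<exists>m n. dist p (y + (of_int m, of_int n)) < R)"
proof -
  have bdd: "bdd_below ((\<lambda>(m :: int, n :: int). dist p (y + (of_int m, of_int n))) ` UNIV)"
    by (auto intro!: bdd_belowI[of _ 0])
  have "torus_of p \<in> ball (torus_of y) R \<longleftrightarrow> dist (torus_of p) (torus_of y) < R" by (simp add: dist_commute)
  also have "\<dots> \<longleftrightarrow> (\<exists>m n. dist p (y + (of_int m, of_int n)) < R)"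
    unfolding dist_torus_of by (subst cINF_less_iff[OF _ bdd]) auto
  finally show ?thesis .
qed

lemma emeasure_lborel_plus:
  assumes "S \<in> sets borel"
  shows "emeasure lborel {x. c + x \<in> S} = emeasure lborel (S :: (real \<times> real) set)"
proof -
  have "emeasure lborel S = emeasure (distr lborel borel ((+) c)) S" by (simp only: lborel_distr_plus)
  also have "\<dots> = emeasure lborel {x. c + x \<in> S}"
    using assms by (subst emeasure_distr) (auto simp: vimage_def)
  finally show ?thesis ..
qed

text \<open>Translating the pieces of the preimage of the ball in the unit square back by integer vectors
  reassembles a single disc in the plane.\<close>

lemma measure_vol_ball:
  assumes R: "0 < R" "R < 1 / 2"
  shows "measure vol (ball y R) = pi * R\<^sup>2"
proof -
  obtain p where p: "torus_of p = y" using torus_of_surj by blast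
  let ?S = "{0..<1} \<times> {0..<1} :: (real \<times> real) set"
  define t :: "int \<times> int \<Rightarrow> real \<times> real" where "t = (\<lambda>(m, n). (of_int m, of_int n))"
  have S: "?S \<in> sets borel" by (intro borel_Times) auto
  define Q where "Q = (\<lambda>z. {x. t z + x \<in> ?S})"
  have meas: "(\<lambda>x. t z + x) \<in> borel_measurable borel" for z by measurable
  have QB: "Q z \<in> sets borel" for z
    using measurable_sets[OF meas S] by (simp add: Q_def vimage_def)
  \<comment> \<open>Distinct lattice vectors are at distance at least 1 > 2 R, which will make the
    translated balls disjoint.\<close>
  have norm_t: "norm (t z - t z') \<ge> 1" if "z \<noteq> z'" for z z'
  proof -
    obtain m n m' n' where e: "z = (m, n)" "z' = (m', n')" by (metis surj_pair)
    have "1 \<le> \<bar>m - m'\<bar> \<or> 1 \<le> \<bar>n - n'\<bar>" using that e by auto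
    then have "1 \<le> \<bar>real_of_int (m - m')\<bar> \<or> 1 \<le> \<bar>real_of_int (n - n')\<bar>" by linarith
    then show ?thesis
      using norm_fst_le[of "real_of_int m - of_int m'" "real_of_int n - of_int n'"] norm_snd_le[of "real_of_int n - of_int n'" "real_of_int m - of_int m'"]
      by (auto simp: t_def e)
  qed
  have "emeasure vol (ball y R) = emeasure (restrict_space lborel ?S) (torus_of -` ball y R \<inter> ?S)"
    unfolding vol_def by (subst emeasure_distr) (auto intro: measurable_restrict_space1 simp: space_restrict_space)
  also have "\<dots> = emeasure lborel (torus_of -` ball y R \<inter> ?S)"
    using S by (subst emeasure_restrict_space) auto
  also have "torus_of -` ball y R \<inter> ?S = (\<Union>z. ball (p + t z) R \<inter> ?S)"
  proof (rule Set.set_eqI)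
    fix x
    have "torus_of x \<in> ball y R \<longleftrightarrow> (\<exists>m n. x \<in> ball (p + t (m, n)) R)"
      unfolding p[symmetric] torus_of_in_ball by (simp add: t_def dist_commute)
    then show "x \<in> torus_of -` ball y R \<inter> ?S \<longleftrightarrow> x \<in> (\<Union>z. ball (p + t z) R \<inter> ?S)"
      unfolding Int_iff vimage_eq UN_iff by (simp del: mem_ball)
  qed
  also have "emeasure lborel \<dots> = (\<integral>\<^sup>+z. emeasure lborel (ball (p + t z) R \<inter> ?S) \<partial>count_space UNIV)"
  proof (rule emeasure_UN_countable)
    show "ball (p + t z) R \<inter> ?S \<in> sets lborel" for z using S by simp
    show "disjoint_family_on (\<lambda>z. ball (p + t z) R \<inter> ?S) UNIV"
    unfolding disjoint_family_on_def
    proof (intro ballI impI, rule ccontr)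
      fix z z' assume "z \<noteq> z'" and "ball (p + t z) R \<inter> ?S \<inter> (ball (p + t z') R \<inter> ?S) \<noteq> {}"
      then obtain x where "dist (p + t z) x < R" "dist (p + t z') x < R" by auto
      then have "dist (p + t z) (p + t z') < R + R" by (metis dist_commute dist_triangle_less_add)
      then show False using R norm_t[OF \<open>z \<noteq> z'\<close>] by (simp add: dist_norm)
    qed
  qed auto
  also have "\<dots> = (\<integral>\<^sup>+z. emeasure lborel (ball p R \<inter> Q z) \<partial>count_space UNIV)"
  proof (rule nn_integral_cong)
    fix z
    have "{x. t z + x \<in> ball (p + t z) R \<inter> ?S} = ball p R \<inter> Q z"
      by (auto simp: Q_def dist_norm algebra_simps)
    then show "emeasure lborel (ball (p + t z) R \<inter> ?S) = emeasure lborel (ball p R \<inter> Q z)"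
      using emeasure_lborel_plus[of "ball (p + t z) R \<inter> ?S" "t z"] S by simp
  qed
  also have "\<dots> = emeasure lborel (\<Union>z. ball p R \<inter> Q z)"
  proof (rule emeasure_UN_countable[symmetric])
    show "ball p R \<inter> Q z \<in> sets lborel" for z using QB by simp
    show "disjoint_family_on (\<lambda>z. ball p R \<inter> Q z) UNIV"
    unfolding disjoint_family_on_def
    proof (intro ballI impI, rule ccontr)
      fix z z' assume "z \<noteq> z'" and "ball p R \<inter> Q z \<inter> (ball p R \<inter> Q z') \<noteq> {}"
      then obtain x where x: "x \<in> Q z" "x \<in> Q z'" by auto
      obtain m n m' n' where e: "z = (m, n)" "z' = (m', n')" by (metis surj_pair)
      obtain a b where ab: "x = (a, b)" by (cases x)
      have "\<bar>real_of_int m - of_int m'\<bar> < 1" "\<bar>real_of_int n - of_int n'\<bar> < 1"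
        using x by (auto simp: e ab Q_def t_def)
      then show False using \<open>z \<noteq> z'\<close> e by simp linarith
    qed
  qed auto
  also have "(\<Union>z. ball p R \<inter> Q z) = ball p R"
  proof -
    have "x \<in> Q (- \<lfloor>fst x\<rfloor>, - \<lfloor>snd x\<rfloor>)" for x
      by (cases x) (simp add: Q_def t_def, linarith)
    then show ?thesis by blast
  qed
  finally have "measure vol (ball y R) = measure lborel (ball p R)" by (simp add: measure_def)
  also have "\<dots> = pi * R\<^sup>2"
    using content_ball[of R p] R by (simp add: unit_ball_vol_2 power2_eq_square)
  finally show ?thesis .
qed

text \<open>Here d is the smoothing radius, and M and A are the length and the power of the kernel.
  The three summands are the area error, the tails and the Kloosterman error. The 96 is twice 48,
  from the coefficient bound and the frequency sum; the 12 is twice 6, from the totient and the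
  Kloosterman bound.\<close>

lemma mu_discrepancy_explicit:
  fixes q M A :: nat
  assumes q: "q > 0" and M: "M \<ge> 1" and A: "A \<ge> 1" and d: "0 < d" "d \<le> 1 / 4" and R: "0 < R" "R < 1 / 2"
  shows "\<bar>measure (mu q) (ball y R) - measure vol (ball y R)\<bar> \<le>
    10 * d + 10 * real A * real M * (2 / (d * real M)) ^ (2 * A) + 96 * 12 ^ card (prime_factors q) * sqrt (real (2 * A * M)) / sqrt (real q)"
proof -
  define n where "n = 2 * A * M"
  define T where "T = 5 * real A * real M * (2 / (d * real M)) ^ (2 * A)"
  define N where "N = real (totient q)"
  define W where "W = card (prime_factors q)"
  have n: "n \<ge> 1" using M A by (simp add: n_def)
  have N: "N > 0" using q by (simp add: N_def)
  obtain p where p: "torus_of p = y" using torus_of_surj by blast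
  obtain J a where
    J: "continuous_on UNIV J" "\<And>x. J x \<ge> 0" "\<And>x n. J (x + of_int n) = J x" "integral {0..1} J = 1" and
    expand: "\<And>x. complex_of_real (J x) = (\<Sum>k\<in>{- int n..int n}. a k * trig k x)" and
    a: "\<And>k. norm (a k) \<le> 1" "a 0 = 1" and
    tail: "\<And>d x. 0 < d \<Longrightarrow> d \<le> x \<Longrightarrow> x \<le> 1 - d \<Longrightarrow> J x \<le> 5 * real A * real M * (2 / (d * real M)) ^ (2 * A)"
    using smoothing_kernel[OF M A] unfolding n_def by blast
  define Err where "Err = 96 * 6 ^ W * sqrt (real q) * sqrt (real n)"
  have err: "\<bar>(\<Sum>i\<in>totatives q. smooth_disc J \<rho> (inverse_coords q i - p)) - real (card (totatives q)) * (pi * \<rho>\<^sup>2)\<bar> \<le> Err"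
    if \<rho>: "0 < \<rho>" "\<rho> \<le> 1" for \<rho>
  proof -
    have "\<bar>(\<Sum>i\<in>totatives q. smooth_disc J \<rho> (inverse_coords q i - p)) - real (card (totatives q)) * (pi * \<rho>\<^sup>2)\<bar> \<le>
      (\<Sum>(k, l)\<in>freq_box n - {(0, 0)}. 2 * of_int (max \<bar>k\<bar> \<bar>l\<bar>) powr (- (3 / 2)) *
       norm (\<Sum>i\<in>totatives q. trig k (fst (inverse_coords q i)) * trig l (snd (inverse_coords q i))))"
      by (rule smooth_disc_sum_error[OF expand a _ \<rho>]) simp
    also have "\<dots> \<le> (\<Sum>z\<in>freq_box n - {(0, 0)}. 2 * 6 ^ W * sqrt (real q) * (case z of (k, l) \<Rightarrow> of_int (max \<bar>k\<bar> \<bar>l\<bar>) powr (- (3 / 2)) * sqrt (of_int (gcd k l))))"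
    proof (rule sum_mono)
      fix z :: "int \<times> int" assume z: "z \<in> freq_box n - {(0, 0)}"
      obtain k l where kl: "z = (k, l)" by (cases z)
      have "(k, l) \<noteq> (0, 0)" using z kl by auto
      from kloosterman_gcd_bound[OF q this]
      have "2 * of_int (max \<bar>k\<bar> \<bar>l\<bar>) powr (- (3 / 2)) * norm (kloosterman (int q) k l)
        \<le> 2 * of_int (max \<bar>k\<bar> \<bar>l\<bar>) powr (- (3 / 2)) * (6 ^ W * sqrt (real q) * sqrt (of_int (gcd k l)))"
        unfolding W_def by (intro mult_left_mono) auto
      then show "(case z of (k, l) \<Rightarrow> 2 * of_int (max \<bar>k\<bar> \<bar>l\<bar>) powr (- (3 / 2)) *
         norm (\<Sum>i\<in>totatives q. trig k (fst (inverse_coords q i)) * trig l (snd (inverse_coords q i))))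
        \<le> 2 * 6 ^ W * sqrt (real q) * (case z of (k, l) \<Rightarrow> of_int (max \<bar>k\<bar> \<bar>l\<bar>) powr (- (3 / 2)) * sqrt (of_int (gcd k l)))"
        unfolding kl prod.case kloosterman_inverse_coords[OF q] by (simp only: mult_ac)
    qed
    also have "\<dots> = 2 * 6 ^ W * sqrt (real q) * (\<Sum>(k, l)\<in>freq_box n - {(0, 0)}. of_int (max \<bar>k\<bar> \<bar>l\<bar>) powr (- (3 / 2)) * sqrt (of_int (gcd k l)))"
      by (rule sum_distrib_left[symmetric])
    also have "\<dots> \<le> 2 * 6 ^ W * sqrt (real q) * (48 * sqrt (real n))"
      by (intro mult_left_mono freq_box_gcd_sum n) auto
    finally show ?thesis by (simp add: Err_def mult_ac)
  qed
  define B where "B = {i \<in> totatives q. \<exists>m n. dist (inverse_coords q i) (p + (of_int m, of_int n)) < R}"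
  have B: "\<bar>real (card B) - N * (pi * R\<^sup>2)\<bar> \<le> N * (10 * d + 2 * T) + Err"
    unfolding B_def N_def totient_def
    using J d tail[OF d(1)] R err by (intro count_in_disc) (auto simp: T_def)
  have "B = {i \<in> totatives q. inverse_point q i \<in> ball y R}"
    unfolding B_def p[symmetric] inverse_point_def inverse_coords_def torus_of_in_ball ..
  then have "measure (mu q) (ball y R) = real (card B) / N" by (simp add: measure_mu N_def)
  then have "measure (mu q) (ball y R) - measure vol (ball y R) = (real (card B) - N * (pi * R\<^sup>2)) / N"
    using N by (simp add: measure_vol_ball[OF R] diff_divide_distrib)
  then have "\<bar>measure (mu q) (ball y R) - measure vol (ball y R)\<bar> = \<bar>real (card B) - N * (pi * R\<^sup>2)\<bar> / N"
    using N by (simp add: abs_divide)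
  also have "\<dots> \<le> (N * (10 * d + 2 * T) + Err) / N" using B N by (intro divide_right_mono) auto
  also have "\<dots> = 10 * d + 2 * T + Err / N" using N by (simp add: add_divide_distrib)
  also have "Err / N \<le> Err / (real q / 2 ^ W)"
  proof (rule divide_left_mono)
    show "real q / 2 ^ W \<le> N" using totient_lower_bound[OF q] by (simp add: N_def W_def field_simps)
    show "0 < N * (real q / 2 ^ W)" using N q by simp
  qed (simp add: Err_def)
  also have "Err / (real q / 2 ^ W) = 96 * 12 ^ W * sqrt (real n) / sqrt (real q)"
  proof -
    have "sqrt (real q) / real q = 1 / sqrt (real q)" using q by (simp add: field_simps)
    moreover have "(12 :: real) ^ W = 6 ^ W * 2 ^ W" by (simp flip: power_mult_distrib)
    moreover have "Err / (real q / 2 ^ W) = 96 * (6 ^ W * 2 ^ W) * sqrt (real n) * (sqrt (real q) / real q)"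
      by (simp add: Err_def)
    ultimately show ?thesis by simp
  qed
  finally show ?thesis by (simp add: T_def W_def n_def)
qed

text \<open>The trivial bound, for those q for which the smoothing radius would exceed 1/4.\<close>

lemma measure_difference_le_1:
  assumes q: "q > 0" and R: "0 < R" "R < 1 / 2"
  shows "\<bar>measure (mu q) (ball y R) - measure vol (ball y R)\<bar> \<le> 1"
proof -
  have "card {d \<in> totatives q. inverse_point q d \<in> ball y R} \<le> totient q"
    unfolding totient_def by (intro card_mono) auto
  then have 1: "measure (mu q) (ball y R) \<le> 1" using q by (simp add: measure_mu)
  have "R\<^sup>2 \<le> (1 / 2)\<^sup>2" using R by (intro power_mono) auto
  then have "pi * R\<^sup>2 \<le> 4 * (1 / 2)\<^sup>2" using pi_less_4 by (intro mult_mono) auto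
  then have 2: "measure vol (ball y R) \<le> 1" by (simp add: measure_vol_ball[OF R] power2_eq_square)
  have "measure (mu q) (ball y R) \<ge> 0" "measure vol (ball y R) \<ge> 0" by simp_all
  with 1 2 show ?thesis by linarith
qed

theorem theorem1p1:
  shows "\<forall>\<epsilon>::real. \<epsilon> > 0 \<longrightarrow>
    (\<exists>C::real. C > 0 \<and>
      (\<forall>q::nat. q > 0 \<longrightarrow> ball_discrepancy (mu q) \<le> C * real q powr (- 1 / 3 + \<epsilon>)))"
proof (intro allI impI)
  fix \<epsilon> :: real assume \<epsilon>: "\<epsilon> > 0"
  obtain C1 where C1: "C1 > 0" "\<And>q :: nat. q > 0 \<Longrightarrow> 12 ^ card (prime_factors q) \<le> C1 * real q powr \<epsilon>"
    using power_omega_bound[of 12 \<epsilon>] \<epsilon> by auto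
  \<comment> \<open>With A \<ge> 1 / \<epsilon> the tail factor (q^\<epsilon>)^(-2 A) is at most 1 /
    q.\<close>
  define A where "A = nat \<lceil>1 / \<epsilon>\<rceil>"
  have "1 / \<epsilon> \<le> real A" unfolding A_def by (rule real_nat_ceiling_ge)
  then have A\<epsilon>: "1 \<le> \<epsilon> * real A" using \<epsilon> by (simp add: field_simps)
  then have A: "A \<ge> 1" by (cases A) auto
  \<comment> \<open>The 4 covers the case d > 1/4; the other summands are the coefficients of d in
    the three error terms.\<close>
  define C where "C = 4 + 10 + 20 * real A * 4 ^ A + 192 * C1 * sqrt (real A)"
  have "0 \<le> 20 * real A * 4 ^ A" "0 \<le> 192 * C1 * sqrt (real A)" using C1 by auto
  then have C: "C \<ge> 4" by (simp add: C_def)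
  have "ball_discrepancy (mu q) \<le> C * real q powr (- 1 / 3 + \<epsilon>)" if q: "q > 0" for q :: nat
    unfolding ball_discrepancy_def
  proof (rule cSUP_least)
    show "(UNIV :: torus set) \<times> {0<..<1/2::real} \<noteq> {}" by (auto intro!: exI[of _ "1/4"])
    fix z :: "torus \<times> real" assume "z \<in> UNIV \<times> {0<..<1/2}"
    then obtain y R where z: "z = (y, R)" and R: "0 < R" "R < 1 / 2" by auto
    define Q where "Q = real q"
    have Q: "Q \<ge> 1" using q by (simp add: Q_def)
    \<comment> \<open>The smoothing radius, wider by q^\<epsilon> than the resolution q^(-1/3) of
      the kernel.\<close>
    define d where "d = Q powr (- 1 / 3 + \<epsilon>)"
    have d0: "d > 0" using Q by (simp add: d_def)
    have "\<bar>measure (mu q) (ball y R) - measure vol (ball y R)\<bar> \<le> C * d"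
    proof (cases "d \<le> 1 / 4")
      case False
      have "1 \<le> 4 * d" using False by simp
      also have "\<dots> \<le> C * d" using C d0 by (intro mult_right_mono) auto
      finally show ?thesis using measure_difference_le_1[OF q R, of y] by linarith
    next
      case True
      \<comment> \<open>With this M the Kloosterman error sqrt(M / q) is of order q^(-1/3), and d M
        \<ge> q^\<epsilon> keeps the tails small.\<close>
      define M where "M = nat \<lceil>Q powr (1 / 3)\<rceil>"
      have M1: "Q powr (1 / 3) \<le> real M" unfolding M_def by (rule real_nat_ceiling_ge)
      have Q3: "1 \<le> Q powr (1 / 3)" using Q by (simp add: ge_one_powr_ge_zero)
      have M2: "real M \<le> 2 * Q powr (1 / 3)" using Q3 unfolding M_def by linarith
      have M: "M \<ge> 1" using M1 Q3 by linarith
      have dM: "Q powr \<epsilon> \<le> d * real M"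
      proof -
        have "Q powr \<epsilon> = d * Q powr (1 / 3)" by (simp add: d_def flip: powr_add)
        also have "\<dots> \<le> d * real M" using M1 d0 by (intro mult_left_mono) auto
        finally show ?thesis .
      qed
      have t: "10 * real A * real M * (2 / (d * real M)) ^ (2 * A) \<le> 20 * real A * 4 ^ A * d"
      proof -
        have "(2 / (d * real M)) ^ (2 * A) \<le> (2 / Q powr \<epsilon>) ^ (2 * A)"
          using dM Q d0 M by (intro power_mono divide_left_mono mult_pos_pos) auto
        also have "\<dots> = 4 ^ A / (Q powr \<epsilon>) ^ (2 * A)" by (simp add: power_divide power_mult)
        also have "(Q powr \<epsilon>) ^ (2 * A) = Q powr (2 * (\<epsilon> * real A))"
          using Q by (simp add: powr_powr flip: powr_realpow) (simp add: mult_ac)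
        also have "4 ^ A / Q powr (2 * (\<epsilon> * real A)) \<le> 4 ^ A / Q powr 1"
          using Q A\<epsilon> by (intro divide_left_mono powr_mono) auto
        finally have p: "(2 / (d * real M)) ^ (2 * A) \<le> 4 ^ A / Q powr 1" .
        have "10 * real A * real M * (2 / (d * real M)) ^ (2 * A) \<le> 10 * real A * (2 * Q powr (1 / 3)) * (4 ^ A / Q powr 1)"
          using p M2 d0 by (intro mult_mono) auto
        also have "\<dots> = 20 * real A * 4 ^ A * (Q powr (1 / 3) / Q powr 1)" by simp
        also have "Q powr (1 / 3) / Q powr 1 \<le> d"
          unfolding d_def powr_diff[symmetric] using Q \<epsilon> by (intro powr_mono) auto
        finally show ?thesis by (simp add: mult_left_mono)
      qed
      have e: "96 * 12 ^ card (prime_factors q) * sqrt (real (2 * A * M)) / sqrt (real q) \<le> 192 * C1 * sqrt (real A) * d"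
      proof -
        have "sqrt (real (2 * A * M)) \<le> sqrt (4 * real A * Q powr (1 / 3))"
          using mult_left_mono[OF M2, of "2 * real A"] by (intro real_sqrt_le_mono) simp
        also have "\<dots> = 2 * sqrt (real A) * Q powr (1 / 6)"
          using Q by (simp add: real_sqrt_mult powr_powr flip: powr_half_sqrt)
        finally have s: "sqrt (real (2 * A * M)) \<le> 2 * sqrt (real A) * Q powr (1 / 6)" .
        have "96 * 12 ^ card (prime_factors q) * sqrt (real (2 * A * M)) / sqrt (real q)
          \<le> 96 * (C1 * Q powr \<epsilon>) * (2 * sqrt (real A) * Q powr (1 / 6)) / sqrt (real q)"
          using C1(2)[OF q] C1(1) s by (intro divide_right_mono mult_mono) (auto simp: Q_def)
        also have "\<dots> = 192 * C1 * sqrt (real A) * (Q powr \<epsilon> * Q powr (1 / 6) / Q powr (1 / 2))"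
          using Q by (simp add: powr_half_sqrt Q_def)
        also have "Q powr \<epsilon> * Q powr (1 / 6) / Q powr (1 / 2) = d"
          by (simp add: d_def flip: powr_add powr_diff)
        finally show ?thesis .
      qed
      have "C * d = 4 * d + 10 * d + 20 * real A * 4 ^ A * d + 192 * C1 * sqrt (real A) * d"
        by (simp add: C_def algebra_simps)
      with mu_discrepancy_explicit[OF q M A d0 True R, of y] t e d0 show ?thesis by linarith
    qed
    then show "(case z of (y, R) \<Rightarrow> \<bar>measure (mu q) (ball y R) - measure vol (ball y R)\<bar>) \<le> C * real q powr (- 1 / 3 + \<epsilon>)"
      by (simp add: z d_def Q_def)
  qed
  then show "\<exists>C::real. C > 0 \<and> (\<forall>q::nat. q > 0 \<longrightarrow> ball_discrepancy (mu q) \<le> C * real q powr (- 1 / 3 + \<epsilon>))"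
    using C by (intro exI[of _ C]) auto
qed

end
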